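(* Let $p>1$, $p'=p/(p-1)$, $n\in\mathbb{N}$, let $\Omega\subset\mathbb{R}^N$ ($N\ge1$) be a domain of finite measure, and let $\mathbf{h}\in L^{p'}(\Omega;\mathbb{R}^n)$. Let $\mathbf{u}\in W_0^{1,p}(\Omega;\mathbb{R}^n)$ be the unique vector function such that $$\int_\Omega|\nabla\mathbf{u}|^{p-2}\nabla\mathbf{u}\cdot\nabla\boldsymbol{\xi}\,dx=\int_\Omega\mathbf{h}\cdot\boldsymbol{\xi}\,dx\quad\text{for any }\boldsymbol{\xi}\in W_0^{1,p}(\Omega;\mathbb{R}^n).$$ Then for any $\mathbf{v}\in W_0^{1,p}(\Omega;\mathbb{R}^n)$, $$\|\nabla(\mathbf{u}-\mathbf{v})\|_p\le C\,\|F'(\mathbf{v})\|_*^{\frac{1}{\max\{1,p-1\}}}\le C\inf_{\boldsymbol{\eta}^*\in Q^*_{\mathrm{vec}}}\Bigl(\|\boldsymbol{\tau}^*-\boldsymbol{\eta}^*\|_{p'}+C_F\|\mathbf{div}\,\boldsymbol{\eta}^*+\mathbf{h}\|_{p'}\Bigr)^{\frac{1}{\max\{1,p-1\}}},$$ where $\boldsymbol{\tau}^*:=|\nabla\mathbf{v}|^{p-2}\nabla\mathbf{v}$ and $$C=\begin{cases}2^{\frac{p-2}{p-1}},& p\ge2,\\ (p-1)^{-1}\,2^{\frac{2-p}{p}}\left(C_F^{p'}\|\mathbf{h}\|_{p'}^{p'}+\|\nabla\mathbf{v}\|_p^p\right)^{\frac{2-p}{p}},& p<2.\end{cases}$$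
   Context: For $\mathbf{u}=(u_1,\dots,u_n)$: $|\nabla\mathbf{u}|=(|\nabla u_1|^2+\dots+|\nabla u_n|^2)^{1/2}$, $\nabla\mathbf{u}\cdot\nabla\boldsymbol{\xi}=\nabla u_1\cdot\nabla\xi_1+\dots+\nabla u_n\cdot\nabla\xi_n$, $\mathbf{h}\cdot\boldsymbol{\xi}=h_1\xi_1+\dots+h_n\xi_n$; $|a|^{p-2}a:=0$ for $a=0$. $\|\cdot\|_q$ is the $L^q(\Omega)$ norm of the Euclidean length of the (vector- or matrix-valued) function. $C_F$ is the (optimal) constant of the embedding $W_0^{1,p}(\Omega)\subset L^p(\Omega)$, i.e. the best constant in $\|w\|_p\le C_F\|\nabla w\|_p$ for scalar $w\in W_0^{1,p}(\Omega)$. Further, $$Q^*_{\mathrm{vec}}=\{\boldsymbol{\eta}=(\eta_1,\dots,\eta_n)\in(L^{p'}(\Omega;\mathbb{R}^N))^n:\ \mathbf{div}\,\boldsymbol{\eta}\in L^{p'}(\Omega;\mathbb{R}^n)\},\qquad \mathbf{div}\,\boldsymbol{\eta}=(\mathrm{div}\,\eta_1,\dots,\mathrm{div}\,\eta_n)$$ (distributional divergences), and $$\langle F'(\mathbf{v}),\boldsymbol{\xi}\rangle=\int_\Omega|\nabla\mathbf{v}|^{p-2}\nabla\mathbf{v}\cdot\nabla\boldsymbol{\xi}\,dx-\int_\Omega\mathbf{h}\cdot\boldsymbol{\xi}\,dx,\qquad \|F'(\mathbf{v})\|_*=\sup_{\boldsymbol{\xi}\in W_0^{1,p}(\Omega;\mathbb{R}^n)\setminus\{0\}}\frac{\langle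 F'(\mathbf{v}),\boldsymbol{\xi}\rangle}{\|\nabla\boldsymbol{\xi}\|_p}.$$ *)

theory Defs
  imports "HOL-Analysis.Analysis"
begin

text \<open>
  A function on an open set \<open>\<Omega>\<close> of \<open>\<real>\<^sup>N\<close> is represented by a total function on \<open>real ^ 'N\<close> whose values
  outside \<open>\<Omega>\<close> are irrelevant: integrals, measurability and integrability refer to
  \<open>lebesgue_on \<Omega>\<close>. Functions are not identified when they agree almost everywhere. A matrix-valued
  function has values in \<open>real ^ 'N ^ 'n\<close>, row \<open>i\<close> belonging to the component \<open>i\<close>; \<open>norm\<close> and
  \<open>\<bullet>\<close> on this type are the Frobenius norm and inner product.
\<close>

definition Lp_space :: "real \<Rightarrow> (real ^ 'N) set \<Rightarrow> (real ^ 'N \<Rightarrow> 'b::euclidean_space) set" where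
  "Lp_space q \<Omega> = {f. f \<in> borel_measurable (lebesgue_on \<Omega>) \<and>
                       integrable (lebesgue_on \<Omega>) (\<lambda>x. norm (f x) powr q)}"

definition Lp_norm :: "real \<Rightarrow> (real ^ 'N) set \<Rightarrow> (real ^ 'N \<Rightarrow> 'b::euclidean_space) \<Rightarrow> real" where
  "Lp_norm q \<Omega> f = (LINT x|lebesgue_on \<Omega>. norm (f x) powr q) powr (1 / q)"

definition locally_integrable :: "(real ^ 'N) set \<Rightarrow> (real ^ 'N \<Rightarrow> 'b::euclidean_space) \<Rightarrow> bool" where
  "locally_integrable \<Omega> f \<longleftrightarrow> (\<forall>K. compact K \<and> K \<subseteq> \<Omega> \<longrightarrow> integrable (lebesgue_on K) f)"

definition partial :: "'N::finite \<Rightarrow> (real ^ 'N \<Rightarrow> real) \<Rightarrow> real ^ 'N \<Rightarrow> real" where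
  "partial j f x = frechet_derivative f (at x) (axis j 1)"

definition classical_grad :: "(real ^ 'N \<Rightarrow> real) \<Rightarrow> real ^ 'N \<Rightarrow> real ^ 'N" where
  "classical_grad f x = (\<chi> j. partial j f x)"

primrec C_k :: "nat \<Rightarrow> (real ^ 'N \<Rightarrow> real) \<Rightarrow> bool" where
  "C_k 0 = (\<lambda>f. continuous_on UNIV f)"
| "C_k (Suc k) = (\<lambda>f. f differentiable_on UNIV \<and> (\<forall>j. C_k k (partial j f)))"

definition test_functions :: "(real ^ 'N) set \<Rightarrow> (real ^ 'N \<Rightarrow> real) set" where
  "test_functions \<Omega> =
     {\<phi>. (\<forall>k. C_k k \<phi>) \<and> compact (closure {x. \<phi> x \<noteq> 0}) \<and> closure {x. \<phi> x \<noteq> 0} \<subseteq> \<Omega>}"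

definition has_weak_grad ::
  "(real ^ 'N) set \<Rightarrow> (real ^ 'N \<Rightarrow> real) \<Rightarrow> (real ^ 'N \<Rightarrow> real ^ 'N) \<Rightarrow> bool" where
  "has_weak_grad \<Omega> w G \<longleftrightarrow>
     locally_integrable \<Omega> w \<and> locally_integrable \<Omega> G \<and>
     (\<forall>\<phi>\<in>test_functions \<Omega>. \<forall>j.
        (LINT x|lebesgue_on \<Omega>. w x * partial j \<phi> x) = - (LINT x|lebesgue_on \<Omega>. G x $ j * \<phi> x))"

definition has_weak_div ::
  "(real ^ 'N) set \<Rightarrow> (real ^ 'N \<Rightarrow> real ^ 'N) \<Rightarrow> (real ^ 'N \<Rightarrow> real) \<Rightarrow> bool" where
  "has_weak_div \<Omega> g d \<longleftrightarrow>
     locally_integrable \<Omega> g \<and> locally_integrable \<Omega> d \<and>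
     (\<forall>\<phi>\<in>test_functions \<Omega>.
        (LINT x|lebesgue_on \<Omega>. g x \<bullet> classical_grad \<phi> x) = - (LINT x|lebesgue_on \<Omega>. d x * \<phi> x))"

text \<open>
  On open \<open>\<Omega>\<close> weak gradients and divergences are unique up to null sets, so the choices below
  affect no integral over \<open>\<Omega>\<close>. They are meaningful only where the weak derivative exists.
\<close>

definition weak_grad :: "(real ^ 'N) set \<Rightarrow> (real ^ 'N \<Rightarrow> real) \<Rightarrow> real ^ 'N \<Rightarrow> real ^ 'N" where
  "weak_grad \<Omega> w = (SOME G. has_weak_grad \<Omega> w G)"

definition weak_div :: "(real ^ 'N) set \<Rightarrow> (real ^ 'N \<Rightarrow> real ^ 'N) \<Rightarrow> real ^ 'N \<Rightarrow> real" where
  "weak_div \<Omega> g = (SOME d. has_weak_div \<Omega> g d)"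

definition W1p :: "real \<Rightarrow> (real ^ 'N) set \<Rightarrow> (real ^ 'N \<Rightarrow> real) set" where
  "W1p p \<Omega> = {w \<in> Lp_space p \<Omega>. \<exists>G\<in>Lp_space p \<Omega>. has_weak_grad \<Omega> w G}"

text \<open>The closure of the test functions in \<open>W\<^sup>1\<^sup>,\<^sup>p(\<Omega>)\<close>.\<close>

definition W0 :: "real \<Rightarrow> (real ^ 'N) set \<Rightarrow> (real ^ 'N \<Rightarrow> real) set" where
  "W0 p \<Omega> = {w \<in> W1p p \<Omega>. \<exists>\<phi> :: nat \<Rightarrow> real ^ 'N \<Rightarrow> real.
     (\<forall>k. \<phi> k \<in> test_functions \<Omega>) \<and>
     (\<lambda>k. Lp_norm p \<Omega> (\<lambda>x. \<phi> k x - w x)) \<longlonglongrightarrow> 0 \<and>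
     (\<lambda>k. Lp_norm p \<Omega> (\<lambda>x. classical_grad (\<phi> k) x - weak_grad \<Omega> w x)) \<longlonglongrightarrow> 0}"

definition W0_vec :: "real \<Rightarrow> (real ^ 'N) set \<Rightarrow> (real ^ 'N \<Rightarrow> real ^ 'n) set" where
  "W0_vec p \<Omega> = {u. \<forall>i. (\<lambda>x. u x $ i) \<in> W0 p \<Omega>}"

definition vgrad :: "(real ^ 'N) set \<Rightarrow> (real ^ 'N \<Rightarrow> real ^ 'n) \<Rightarrow> real ^ 'N \<Rightarrow> real ^ 'N ^ 'n" where
  "vgrad \<Omega> u x = (\<chi> i. weak_grad \<Omega> (\<lambda>y. u y $ i) x)"

definition vdiv :: "(real ^ 'N) set \<Rightarrow> (real ^ 'N \<Rightarrow> real ^ 'N ^ 'n) \<Rightarrow> real ^ 'N \<Rightarrow> real ^ 'n" where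
  "vdiv \<Omega> \<eta> x = (\<chi> i. weak_div \<Omega> (\<lambda>y. \<eta> y $ i) x)"

definition Q_vec :: "real \<Rightarrow> (real ^ 'N) set \<Rightarrow> (real ^ 'N \<Rightarrow> real ^ 'N ^ 'n) set" where
  "Q_vec q \<Omega> = {\<eta> \<in> Lp_space q \<Omega>.
     \<forall>i. \<exists>d\<in>Lp_space q \<Omega>. has_weak_div \<Omega> (\<lambda>x. \<eta> x $ i) d}"

text \<open>
  For nonempty open \<open>\<Omega>\<close> of finite measure and \<open>p > 1\<close> the set of admissible constants is nonempty, by
  the Friedrichs inequality, so the infimum is the best constant.
\<close>

definition C_F :: "real \<Rightarrow> (real ^ 'N) set \<Rightarrow> real" where
  "C_F p \<Omega> = Inf {C. 0 \<le> C \<and> (\<forall>w\<in>W0 p \<Omega>. Lp_norm p \<Omega> w \<le> C * Lp_norm p \<Omega> (weak_grad \<Omega> w))}"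

text \<open>
  The convention \<open>\<bar>a\<bar>\<^sup>p\<^sup>-\<^sup>2 a = 0\<close> for \<open>a = 0\<close> holds automatically here.
\<close>

definition p_flux :: "real \<Rightarrow> 'b::euclidean_space \<Rightarrow> 'b" where
  "p_flux p a = (norm a powr (p - 2)) *\<^sub>R a"

definition F_deriv :: "real \<Rightarrow> (real ^ 'N) set \<Rightarrow> (real ^ 'N \<Rightarrow> real ^ 'n) \<Rightarrow>
    (real ^ 'N \<Rightarrow> real ^ 'n) \<Rightarrow> (real ^ 'N \<Rightarrow> real ^ 'n) \<Rightarrow> real" where
  "F_deriv p \<Omega> h v \<xi> =
     (LINT x|lebesgue_on \<Omega>. p_flux p (vgrad \<Omega> v x) \<bullet> vgrad \<Omega> \<xi> x) - (LINT x|lebesgue_on \<Omega>. h x \<bullet> \<xi> x)"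

text \<open>
  The supremum is over a bounded set whenever \<open>v\<close> is in \<open>W0_vec p \<Omega>\<close>, \<open>h\<close> is in \<open>L\<^sup>p\<^sup>'\<close> and \<open>\<Omega>\<close> has finite
  measure. Excluding \<open>\<xi> = 0\<close> means excluding the functions that vanish almost everywhere.
\<close>

definition F_deriv_norm :: "real \<Rightarrow> (real ^ 'N) set \<Rightarrow> (real ^ 'N \<Rightarrow> real ^ 'n) \<Rightarrow>
    (real ^ 'N \<Rightarrow> real ^ 'n) \<Rightarrow> real" where
  "F_deriv_norm p \<Omega> h v =
     (SUP \<xi> \<in> {\<xi> \<in> W0_vec p \<Omega>. \<not> (AE x in lebesgue_on \<Omega>. \<xi> x = 0)}.
        F_deriv p \<Omega> h v \<xi> / Lp_norm p \<Omega> (vgrad \<Omega> \<xi>))"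

end

theory Submission
  imports Defs
begin

text \<open>
  Testing the equation for \<open>u\<close> with \<open>\<xi> = v - u\<close> turns \<open>\<langle>F'(v), \<xi>\<rangle>\<close> into the integral of
  \<open>(|\<nabla>u|\<^sup>p\<^sup>-\<^sup>2\<nabla>u - |\<nabla>v|\<^sup>p\<^sup>-\<^sup>2\<nabla>v) \<cdot> \<nabla>(u - v)\<close>, which pointwise monotonicity inequalities bound from
  below: directly for \<open>p \<ge> 2\<close>, and for \<open>p < 2\<close> after a Hoelder step whose second factor the energy
  identity for \<open>u\<close> controls. The second inequality integrates \<open>\<eta>\<close> by parts in \<open>\<langle>F'(v), \<xi>\<rangle>\<close> and
  applies the Friedrichs inequality to the vector function \<open>\<xi>\<close>.
\<close>

section \<open>Lebesgue spaces\<close>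

text \<open>\<open>C_F\<close> and \<open>F_deriv_norm\<close> are an \<open>Inf\<close> and a
  \<open>SUP\<close> of reals, which carry information only once the set is nonempty and bounded on
  the right side. Hence a Friedrichs inequality with some constant has to be established before the
  best constant can be used, and the bound of \<open>F_deriv\<close> by the majorant has to precede
  the first inequality of the theorem: at \<open>\<eta> = 0\<close> it makes the supremum finite.
  Weak gradients are picked by \<open>SOME\<close>, so they are linear only almost everywhere; the
  fundamental lemma supplies the uniqueness behind this. Origin of the constants: for p \<ge> 2 the
  pointwise inequality has the factor 2 powr (2 - p), attained at b = -a, and solving for the error
  norm turns it into 2 powr ((p - 2) / (p - 1)). For p < 2 the factor p - 1 is the slope of t powr
  (p - 1) at t = 1, and the term with \<open>h\<close> in \<open>C\<close> bounds the p-th power of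
  the norm of the gradient of \<open>u\<close>, the only place where the unknown \<open>u\<close>
  would enter.\<close>

lemma powr_convex_combination:
  fixes x y l p :: real
  assumes "p \<ge> 1" "0 \<le> x" "0 \<le> y" "0 \<le> l" "l \<le> 1"
  shows "(l * x + (1 - l) * y) powr p \<le> l * x powr p + (1 - l) * y powr p"
proof (cases "x = 0 \<or> y = 0")
  case True
  have *: "(m * z) powr p \<le> m * z powr p" if "0 \<le> m" "m \<le> 1" "0 \<le> z" for m z :: real
  proof -
    have "m powr p \<le> m powr 1" using that assms by (intro powr_mono') auto
    then show ?thesis using that by (simp add: powr_mult mult_right_mono)
  qed
  show ?thesis using True *[of l x] *[of "1 - l" y] assms by auto
next
  case False
  then show ?thesis
    using powr_convex[OF \<open>p \<ge> 1\<close>] assms unfolding convex_on_def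
    by (auto dest!: bspec[of _ _ x] bspec[of _ _ y])
qed

lemma powr_add_le:
  fixes x y p :: real
  assumes "p \<ge> 1" "0 \<le> x" "0 \<le> y"
  shows "(x + y) powr p \<le> 2 powr (p - 1) * (x powr p + y powr p)"
proof -
  have "(x + y) powr p = 2 powr p * ((1/2) * x + (1 - 1/2) * y) powr p"
    using assms by (subst powr_mult[symmetric]) (auto simp: algebra_simps)
  also have "\<dots> \<le> 2 powr p * ((1/2) * x powr p + (1 - 1/2) * y powr p)"
    using assms by (intro mult_left_mono powr_convex_combination) auto
  also have "\<dots> = 2 powr (p - 1) * (x powr p + y powr p)"
    by (simp add: powr_diff field_simps)
  finally show ?thesis .
qed

text \<open>Each z among x and y satisfies z \<le> x + y, so z powr p \<le> z * (x + y) powr (p -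
  1); adding the two bounds gives the claim.\<close>

lemma powr_superadditive:
  fixes x y p :: real
  assumes "p \<ge> 1" "0 \<le> x" "0 \<le> y"
  shows "x powr p + y powr p \<le> (x + y) powr p"
proof (cases "x + y = 0")
  case True
  then have "x = 0" "y = 0" using assms by auto
  then show ?thesis by simp
next
  case False
  then have s: "x + y > 0" using assms by auto
  have *: "z powr p \<le> z * (x + y) powr (p - 1)" if "0 \<le> z" "z \<le> x + y" for z
  proof -
    have "z powr p = z * z powr (p - 1)" using that by (cases "z = 0") (auto simp: powr_diff)
    also have "\<dots> \<le> z * (x + y) powr (p - 1)" using that assms by (intro mult_left_mono powr_mono2) auto
    finally show ?thesis .
  qed
  have "x powr p + y powr p \<le> (x + y) * (x + y) powr (p - 1)"
    using *[of x] *[of y] assms by (simp add: algebra_simps)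
  also have "\<dots> = (x + y) powr p" using s by (simp add: powr_diff)
  finally show ?thesis .
qed

text \<open>Young's inequality applied directly only gives integrability of the product; the norm
  bound comes from applying it to f and g divided by their norms \<open>a\<close> and
  \<open>b\<close>.\<close>

lemma holder_inequality:
  fixes f g :: "'a \<Rightarrow> real"
  assumes pq: "p > 1" "q > 1" "1 / p + 1 / q = 1"
    and [measurable]: "f \<in> borel_measurable M" "g \<in> borel_measurable M"
    and nn: "\<And>x. 0 \<le> f x" "\<And>x. 0 \<le> g x"
    and If: "integrable M (\<lambda>x. f x powr p)" and Ig: "integrable M (\<lambda>x. g x powr q)"
  shows "integrable M (\<lambda>x. f x * g x)"
    and "(LINT x|M. f x * g x) \<le> (LINT x|M. f x powr p) powr (1 / p) * (LINT x|M. g x powr q) powr (1 / q)"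
proof -
  have bd: "f x * g x \<le> f x powr p / p + g x powr q / q" for x
    using Youngs_inequality[OF pq] nn by auto
  show I: "integrable M (\<lambda>x. f x * g x)"
    by (rule Bochner_Integration.integrable_bound[of _ "\<lambda>x. f x powr p / p + g x powr q / q"])
      (use If Ig bd nn in \<open>auto simp: abs_mult intro!: AE_I2 order_trans[OF _ abs_ge_self]\<close>)
  define A where "A = (LINT x|M. f x powr p)"
  define B where "B = (LINT x|M. g x powr q)"
  have A0: "A \<ge> 0" and B0: "B \<ge> 0" by (auto simp: A_def B_def)
  show "(LINT x|M. f x * g x) \<le> A powr (1 / p) * B powr (1 / q)"
  proof (cases "A = 0 \<or> B = 0")
    \<comment> \<open>Normalising would divide by zero here; instead one factor, hence the product,
      vanishes almost everywhere.\<close>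
    case True
    have "AE x in M. f x * g x = 0"
    proof (cases "A = 0")
      case True
      then have "AE x in M. f x powr p = 0"
        using integral_nonneg_eq_0_iff_AE[OF If] by (auto simp: A_def)
      then show ?thesis by eventually_elim simp
    next
      case False
      with True have "AE x in M. g x powr q = 0"
        using integral_nonneg_eq_0_iff_AE[OF Ig] by (auto simp: B_def)
      then show ?thesis by eventually_elim simp
    qed
    then have "(LINT x|M. f x * g x) = (LINT x|M. 0)" by (intro integral_cong_AE) auto
    then show ?thesis by simp
  next
    case False
    then have A: "A > 0" and B: "B > 0" using A0 B0 by auto
    define a where "a = A powr (1 / p)"
    define b where "b = B powr (1 / q)"
    have ab: "a > 0" "b > 0" "a powr p = A" "b powr q = B"
      using A B pq by (auto simp: a_def b_def powr_powr)
    have "(f x * g x) / (a * b) \<le> f x powr p / (p * A) + g x powr q / (q * B)" for x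
      using Youngs_inequality[OF pq, of "f x / a" "g x / b"] nn[of x] ab
      by (simp add: powr_divide mult.commute)
    then have "(LINT x|M. (f x * g x) / (a * b)) \<le> (LINT x|M. f x powr p / (p * A) + g x powr q / (q * B))"
      using I If Ig by (intro integral_mono) auto
    also have "\<dots> = A / (p * A) + B / (q * B)"
      using If Ig by (simp add: A_def B_def)
    also have "\<dots> = 1" using A B pq by simp
    finally have "(LINT x|M. f x * g x) / (a * b) \<le> 1" by simp
    then show ?thesis using ab by (simp add: a_def b_def)
  qed
qed

section \<open>Norms and linear structure of the Lebesgue spaces\<close>

lemma Lp_spaceD:
  assumes "f \<in> Lp_space q \<Omega>"
  shows "f \<in> borel_measurable (lebesgue_on \<Omega>)" "integrable (lebesgue_on \<Omega>) (\<lambda>x. norm (f x) powr q)"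
  using assms by (auto simp: Lp_space_def)

lemma Lp_norm_nonneg [simp]: "0 \<le> Lp_norm q \<Omega> f"
  by (simp add: Lp_norm_def)

lemma Lp_norm_powr:
  assumes "q > 0"
  shows "Lp_norm q \<Omega> f powr q = (LINT x|lebesgue_on \<Omega>. norm (f x) powr q)"
  using assms by (simp add: Lp_norm_def powr_powr)

lemma Lp_norm_zero [simp]: "Lp_norm q \<Omega> (\<lambda>x. 0) = 0"
  by (simp add: Lp_norm_def)

lemma Lp_norm_uminus [simp]: "Lp_norm q \<Omega> (\<lambda>x. - f x) = Lp_norm q \<Omega> f"
  by (simp add: Lp_norm_def)

lemma Lp_norm_minus_commute: "Lp_norm q \<Omega> (\<lambda>x. f x - g x) = Lp_norm q \<Omega> (\<lambda>x. g x - f x)"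
  by (simp add: Lp_norm_def norm_minus_commute)

lemma Lp_norm_scaleR:
  assumes "q > 0"
  shows "Lp_norm q \<Omega> (\<lambda>x. c *\<^sub>R f x) = \<bar>c\<bar> * Lp_norm q \<Omega> f"
  using assms by (simp add: Lp_norm_def powr_mult powr_powr)

lemma Lp_norm_le_iff_integral:
  assumes "q > 0" "0 \<le> c"
  shows "Lp_norm q \<Omega> f \<le> c \<longleftrightarrow> (LINT x|lebesgue_on \<Omega>. norm (f x) powr q) \<le> c powr q"
  unfolding Lp_norm_powr[OF assms(1), symmetric]
  using assms powr_less_mono2[of q c "Lp_norm q \<Omega> f"]
  by (auto intro: powr_mono2 simp: not_le[symmetric])

lemma Lp_norm_cong_AE:
  assumes "AE x in lebesgue_on \<Omega>. f x = g x"
    and [measurable]: "f \<in> borel_measurable (lebesgue_on \<Omega>)" "g \<in> borel_measurable (lebesgue_on \<Omega>)"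
  shows "Lp_norm q \<Omega> f = Lp_norm q \<Omega> g"
  unfolding Lp_norm_def
  by (rule arg_cong[where f = "\<lambda>t. t powr _"], rule integral_cong_AE) (use assms(1) in auto)

lemma Lp_space_dominated:
  assumes g: "g \<in> Lp_space q \<Omega>" and f: "f \<in> borel_measurable (lebesgue_on \<Omega>)"
    and le: "AE x in lebesgue_on \<Omega>. norm (f x) \<le> norm (g x)" and q: "q > 0"
  shows "f \<in> Lp_space q \<Omega>" "Lp_norm q \<Omega> f \<le> Lp_norm q \<Omega> g"
proof -
  note [measurable] = f Lp_spaceD(1)[OF g]
  have le': "AE x in lebesgue_on \<Omega>. norm (f x) powr q \<le> norm (g x) powr q"
    using le by eventually_elim (use q in \<open>auto intro: powr_mono2\<close>)
  have I: "integrable (lebesgue_on \<Omega>) (\<lambda>x. norm (f x) powr q)"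
    by (rule Bochner_Integration.integrable_bound[OF Lp_spaceD(2)[OF g]]) (use le' in auto)
  then show "f \<in> Lp_space q \<Omega>" by (simp add: Lp_space_def)
  show "Lp_norm q \<Omega> f \<le> Lp_norm q \<Omega> g"
    unfolding Lp_norm_def
    by (intro powr_mono2 integral_mono_AE I Lp_spaceD(2)[OF g] le') (use q in auto)
qed

lemma Lp_space_zero [simp]: "(\<lambda>x. 0) \<in> Lp_space q \<Omega>"
  by (simp add: Lp_space_def)

lemma Lp_space_scaleR:
  assumes "f \<in> Lp_space q \<Omega>"
  shows "(\<lambda>x. c *\<^sub>R f x) \<in> Lp_space q \<Omega>"
  using assms by (auto simp: Lp_space_def powr_mult)

lemma Lp_space_uminus:
  assumes "f \<in> Lp_space q \<Omega>"
  shows "(\<lambda>x. - f x) \<in> Lp_space q \<Omega>"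
  using Lp_space_scaleR[OF assms, of "-1"] by simp

lemma Lp_space_add:
  assumes f: "f \<in> Lp_space q \<Omega>" and g: "g \<in> Lp_space q \<Omega>" and q: "q \<ge> 1"
  shows "(\<lambda>x. f x + g x) \<in> Lp_space q \<Omega>"
proof -
  note [measurable] = Lp_spaceD(1)[OF f] Lp_spaceD(1)[OF g]
  have "norm (f x + g x) powr q \<le> 2 powr (q - 1) * (norm (f x) powr q + norm (g x) powr q)" for x
    using q by (intro order_trans[OF powr_mono2 powr_add_le] norm_triangle_ineq) auto
  moreover have "integrable (lebesgue_on \<Omega>)
      (\<lambda>x. 2 powr (q - 1) * (norm (f x) powr q + norm (g x) powr q))"
    using Lp_spaceD(2)[OF f] Lp_spaceD(2)[OF g] by auto
  ultimately have "integrable (lebesgue_on \<Omega>) (\<lambda>x. norm (f x + g x) powr q)"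
    by (elim Bochner_Integration.integrable_bound) (auto intro!: AE_I2 order_trans[OF _ abs_ge_self])
  then show ?thesis by (simp add: Lp_space_def)
qed

lemma Lp_space_diff:
  assumes "f \<in> Lp_space q \<Omega>" "g \<in> Lp_space q \<Omega>" "q \<ge> 1"
  shows "(\<lambda>x. f x - g x) \<in> Lp_space q \<Omega>"
  using Lp_space_add[OF assms(1) Lp_space_uminus[OF assms(2)] assms(3)] by simp

lemma Lp_space_sum:
  assumes "\<And>i. i \<in> I \<Longrightarrow> f i \<in> Lp_space q \<Omega>" "q \<ge> 1"
  shows "(\<lambda>x. \<Sum>i\<in>I. f i x) \<in> Lp_space q \<Omega>"
  using assms(1) by (induction I rule: infinite_finite_induct) (auto intro!: Lp_space_add assms(2))

text \<open>Pointwise, norm f + norm g is A + B times the convex combination of norm f / A and norm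
  g / B with weights A / (A + B) and B / (A + B), so Minkowski's inequality follows from convexity
  of the power. The slack e / 2 keeps A and B positive when a norm vanishes.\<close>

lemma Lp_norm_triangle:
  assumes f: "f \<in> Lp_space q \<Omega>" and g: "g \<in> Lp_space q \<Omega>" and q: "q \<ge> 1"
  shows "Lp_norm q \<Omega> (\<lambda>x. f x + g x) \<le> Lp_norm q \<Omega> f + Lp_norm q \<Omega> g"
proof (rule field_le_epsilon)
  fix e :: real assume e: "e > 0"
  define A where "A = Lp_norm q \<Omega> f + e / 2"
  define B where "B = Lp_norm q \<Omega> g + e / 2"
  have AB: "A > 0" "B > 0" using e by (auto simp: A_def B_def add_nonneg_pos)
  define l where "l = A / (A + B)"
  have l: "0 \<le> l" "l \<le> 1" "1 - l = B / (A + B)" using AB by (auto simp: l_def field_simps)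
  have pw: "norm (f x + g x) powr q
      \<le> (A + B) powr q * (l * (norm (f x) powr q / A powr q) + (1 - l) * (norm (g x) powr q / B powr q))" for x
  proof -
    have "norm (f x + g x) powr q \<le> (norm (f x) + norm (g x)) powr q"
      using q by (intro powr_mono2 norm_triangle_ineq) auto
    also have "norm (f x) + norm (g x) = (A + B) * (l * (norm (f x) / A) + (1 - l) * (norm (g x) / B))"
    proof -
      have "(A + B) * (l * (norm (f x) / A)) = norm (f x)" "(A + B) * ((1 - l) * (norm (g x) / B)) = norm (g x)"
        using AB unfolding l(3) by (simp_all add: l_def)
      then show ?thesis by (simp add: distrib_left)
    qed
    also have "\<dots> powr q = (A + B) powr q * (l * (norm (f x) / A) + (1 - l) * (norm (g x) / B)) powr q"
      using AB l(1,2) by (intro powr_mult)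
    also have "\<dots> \<le> (A + B) powr q * (l * (norm (f x) / A) powr q + (1 - l) * (norm (g x) / B) powr q)"
      using AB l(1,2) q by (intro mult_left_mono powr_convex_combination) auto
    finally show ?thesis using AB by (simp add: powr_divide)
  qed
  have le: "(LINT x|lebesgue_on \<Omega>. norm (f x) powr q) / A powr q \<le> 1"
    "(LINT x|lebesgue_on \<Omega>. norm (g x) powr q) / B powr q \<le> 1"
    using AB e q by (auto simp flip: Lp_norm_powr intro!: powr_mono2 simp: A_def B_def)
  have "(LINT x|lebesgue_on \<Omega>. norm (f x + g x) powr q) \<le> (LINT x|lebesgue_on \<Omega>.
      (A + B) powr q * (l * (norm (f x) powr q / A powr q) + (1 - l) * (norm (g x) powr q / B powr q)))"
    using Lp_spaceD(2)[OF f] Lp_spaceD(2)[OF g] Lp_spaceD(2)[OF Lp_space_add[OF f g q]]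
    by (intro integral_mono pw) auto
  also have "\<dots> = (A + B) powr q * (l * ((LINT x|lebesgue_on \<Omega>. norm (f x) powr q) / A powr q)
      + (1 - l) * ((LINT x|lebesgue_on \<Omega>. norm (g x) powr q) / B powr q))"
    using Lp_spaceD(2)[OF f] Lp_spaceD(2)[OF g] by simp
  also have "\<dots> \<le> (A + B) powr q * (l * 1 + (1 - l) * 1)"
    using l(1,2) by (intro mult_left_mono add_mono le) auto
  finally have "Lp_norm q \<Omega> (\<lambda>x. f x + g x) \<le> A + B"
    using q AB by (subst Lp_norm_le_iff_integral) auto
  then show "Lp_norm q \<Omega> (\<lambda>x. f x + g x) \<le> Lp_norm q \<Omega> f + Lp_norm q \<Omega> g + e"
    by (simp add: A_def B_def)
qed

lemma Lp_norm_sum_le: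
  assumes "\<And>i. i \<in> I \<Longrightarrow> f i \<in> Lp_space q \<Omega>" "q \<ge> 1"
  shows "Lp_norm q \<Omega> (\<lambda>x. \<Sum>i\<in>I. f i x) \<le> (\<Sum>i\<in>I. Lp_norm q \<Omega> (f i))"
  using assms(1)
proof (induction I rule: infinite_finite_induct)
  case (insert i I)
  then have "Lp_norm q \<Omega> (\<lambda>x. f i x + (\<Sum>i\<in>I. f i x)) \<le> Lp_norm q \<Omega> (f i) + Lp_norm q \<Omega> (\<lambda>x. \<Sum>i\<in>I. f i x)"
    using assms(2) by (intro Lp_norm_triangle Lp_space_sum) auto
  with insert show ?case by (auto intro: order_trans)
qed auto

lemma Lp_norm_diff_abs_le:
  assumes f: "f \<in> Lp_space q \<Omega>" and g: "g \<in> Lp_space q \<Omega>" and q: "q \<ge> 1"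
  shows "\<bar>Lp_norm q \<Omega> f - Lp_norm q \<Omega> g\<bar> \<le> Lp_norm q \<Omega> (\<lambda>x. f x - g x)"
  using Lp_norm_triangle[OF Lp_space_diff[OF f g q] g q] Lp_norm_triangle[OF Lp_space_diff[OF g f q] f q]
    Lp_norm_minus_commute[of q \<Omega> f g]
  by simp

lemma Lp_norm_tendsto:
  assumes "\<And>k. f k \<in> Lp_space q \<Omega>" "g \<in> Lp_space q \<Omega>" "q \<ge> 1"
    and lim: "(\<lambda>k. Lp_norm q \<Omega> (\<lambda>x. f k x - g x)) \<longlonglongrightarrow> 0"
  shows "(\<lambda>k. Lp_norm q \<Omega> (f k)) \<longlonglongrightarrow> Lp_norm q \<Omega> g"
  by (rule Lim_transform2[OF tendsto_const], rule Lim_null_comparison[OF _ lim])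
    (use Lp_norm_diff_abs_le[OF assms(2,1,3)] Lp_norm_minus_commute[of q \<Omega> g] in \<open>auto simp: abs_minus_commute\<close>)

section \<open>Vector-valued functions and duality pairings\<close>

lemma norm_axis: "norm (axis i x) = norm x"
  by (simp add: norm_vec_def L2_set_def axis_def if_distrib[of norm] if_distrib[of "\<lambda>t. t ^ 2"] cong: if_cong)

lemma Lp_space_vec_iff:
  fixes f :: "real ^ 'N \<Rightarrow> 'b::euclidean_space ^ 'n"
  assumes q: "q \<ge> 1"
  shows "f \<in> Lp_space q \<Omega> \<longleftrightarrow> (\<forall>i. (\<lambda>x. f x $ i) \<in> Lp_space q \<Omega>)"
proof safe
  fix i assume f: "f \<in> Lp_space q \<Omega>"
  have "(\<lambda>x. f x $ i) \<in> borel_measurable (lebesgue_on \<Omega>)"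
    using Lp_spaceD(1)[OF f]
    by (rule measurable_compose) (intro borel_measurable_continuous_onI continuous_intros)
  then show "(\<lambda>x. f x $ i) \<in> Lp_space q \<Omega>"
    by (rule Lp_space_dominated(1)[OF f]) (use q in \<open>auto intro: Finite_Cartesian_Product.norm_nth_le\<close>)
next
  assume f: "\<forall>i. (\<lambda>x. f x $ i) \<in> Lp_space q \<Omega>"
  have "(\<lambda>x. axis i (f x $ i)) \<in> Lp_space q \<Omega>" for i
  proof (rule Lp_space_dominated(1)[OF f[rule_format, of i]])
    have "continuous_on UNIV (axis i :: 'b \<Rightarrow> 'b ^ 'n)"
      unfolding axis_def
    proof (intro continuous_on_vec_lambda)
      show "continuous_on UNIV (\<lambda>x :: 'b. if j = i then x else 0)" for j
        by (cases "j = i") auto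
    qed
    then show "(\<lambda>x. axis i (f x $ i)) \<in> borel_measurable (lebesgue_on \<Omega>)"
      by (intro measurable_compose[OF Lp_spaceD(1)[OF f[rule_format, of i]] borel_measurable_continuous_onI])
  qed (use q in \<open>auto simp: norm_axis\<close>)
  then have "(\<lambda>x. \<Sum>i\<in>UNIV. axis i (f x $ i)) \<in> Lp_space q \<Omega>"
    using q by (intro Lp_space_sum) auto
  moreover have "(\<Sum>i\<in>UNIV. axis i (f x $ i)) = f x" for x
    by (simp add: vec_eq_iff axis_def if_distrib cong: if_cong)
  ultimately show "f \<in> Lp_space q \<Omega>" by simp
qed

text \<open>Crude, but enough to turn convergence of every component into convergence of the vector
  function.\<close>

lemma Lp_norm_vec_le:
  fixes f :: "real ^ 'N \<Rightarrow> 'b::euclidean_space ^ 'n"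
  assumes q: "q \<ge> 1" and f: "f \<in> Lp_space q \<Omega>"
  shows "Lp_norm q \<Omega> f \<le> (\<Sum>i\<in>UNIV. Lp_norm q \<Omega> (\<lambda>x. f x $ i))"
proof -
  have *: "(\<lambda>x. norm (f x $ i)) \<in> Lp_space q \<Omega>" for i
  proof -
    have "(\<lambda>x. f x $ i) \<in> Lp_space q \<Omega>" using f q by (simp add: Lp_space_vec_iff)
    from Lp_spaceD[OF this] show ?thesis by (simp add: Lp_space_def)
  qed
  have "Lp_norm q \<Omega> f \<le> Lp_norm q \<Omega> (\<lambda>x. \<Sum>i\<in>UNIV. norm (f x $ i))"
    using q * Lp_spaceD(1)[OF f]
    by (intro Lp_space_dominated(2)[OF Lp_space_sum])
      (auto intro!: AE_I2 order_trans[OF _ abs_ge_self] simp: norm_le_l1_cart norm_vec_def L2_set_le_sum)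
  also have "\<dots> \<le> (\<Sum>i\<in>UNIV. Lp_norm q \<Omega> (\<lambda>x. norm (f x $ i)))"
    by (rule Lp_norm_sum_le[OF * q])
  finally show ?thesis by (simp add: Lp_norm_def)
qed

lemma Lp_holder:
  fixes f g :: "real ^ 'N \<Rightarrow> 'b::euclidean_space"
  assumes pq: "p > 1" "q > 1" "1 / p + 1 / q = 1"
    and f: "f \<in> Lp_space p \<Omega>" and g: "g \<in> Lp_space q \<Omega>"
  shows "integrable (lebesgue_on \<Omega>) (\<lambda>x. f x \<bullet> g x)"
    and "\<bar>LINT x|lebesgue_on \<Omega>. f x \<bullet> g x\<bar> \<le> Lp_norm p \<Omega> f * Lp_norm q \<Omega> g"
proof -
  note [measurable] = Lp_spaceD(1)[OF f] Lp_spaceD(1)[OF g]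
  have H: "integrable (lebesgue_on \<Omega>) (\<lambda>x. norm (f x) * norm (g x))"
    "(LINT x|lebesgue_on \<Omega>. norm (f x) * norm (g x)) \<le> Lp_norm p \<Omega> f * Lp_norm q \<Omega> g"
    using holder_inequality[OF pq, of "\<lambda>x. norm (f x)" "lebesgue_on \<Omega>" "\<lambda>x. norm (g x)"]
      Lp_spaceD(2)[OF f] Lp_spaceD(2)[OF g] by (auto simp: Lp_norm_def)
  show I: "integrable (lebesgue_on \<Omega>) (\<lambda>x. f x \<bullet> g x)"
    by (rule Bochner_Integration.integrable_bound[OF H(1)]) (auto simp: Cauchy_Schwarz_ineq2)
  have "\<bar>LINT x|lebesgue_on \<Omega>. f x \<bullet> g x\<bar> \<le> (LINT x|lebesgue_on \<Omega>. \<bar>f x \<bullet> g x\<bar>)"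
    by (rule integral_abs_bound)
  also have "\<dots> \<le> (LINT x|lebesgue_on \<Omega>. norm (f x) * norm (g x))"
    using I H(1) by (intro integral_mono) (auto simp: Cauchy_Schwarz_ineq2)
  finally show "\<bar>LINT x|lebesgue_on \<Omega>. f x \<bullet> g x\<bar> \<le> Lp_norm p \<Omega> f * Lp_norm q \<Omega> g"
    using H(2) by simp
qed

text \<open>By Hoelder's inequality. This is how integral identities known for test functions are
  carried over to \<open>W0\<close>.\<close>

lemma Lp_pairing_tendsto:
  fixes f :: "nat \<Rightarrow> real ^ 'N \<Rightarrow> 'b::euclidean_space"
  assumes pq: "p > 1" "q > 1" "1 / p + 1 / q = 1"
    and f: "\<And>k. f k \<in> Lp_space p \<Omega>" "g \<in> Lp_space p \<Omega>" and w: "w \<in> Lp_space q \<Omega>"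
    and lim: "(\<lambda>k. Lp_norm p \<Omega> (\<lambda>x. f k x - g x)) \<longlonglongrightarrow> 0"
  shows "(\<lambda>k. LINT x|lebesgue_on \<Omega>. f k x \<bullet> w x) \<longlonglongrightarrow> (LINT x|lebesgue_on \<Omega>. g x \<bullet> w x)"
proof (rule LIM_zero_cancel, rule Lim_null_comparison)
  show "(\<lambda>k. Lp_norm p \<Omega> (\<lambda>x. f k x - g x) * Lp_norm q \<Omega> w) \<longlonglongrightarrow> 0"
    using tendsto_mult_left_zero[OF lim] .
  have "\<bar>(LINT x|lebesgue_on \<Omega>. f k x \<bullet> w x) - (LINT x|lebesgue_on \<Omega>. g x \<bullet> w x)\<bar>
      \<le> Lp_norm p \<Omega> (\<lambda>x. f k x - g x) * Lp_norm q \<Omega> w" for k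
    using Lp_holder[OF pq Lp_space_diff w, of "f k" g] Lp_holder(1)[OF pq _ w, of g]
      Lp_holder(1)[OF pq _ w, of "f k"] f pq(1)
    by (simp add: inner_diff_left)
  then show "\<forall>\<^sub>F k in sequentially. norm ((LINT x|lebesgue_on \<Omega>. f k x \<bullet> w x) - (LINT x|lebesgue_on \<Omega>. g x \<bullet> w x))
      \<le> Lp_norm p \<Omega> (\<lambda>x. f k x - g x) * Lp_norm q \<Omega> w" by simp
qed

section \<open>Strong monotonicity of the flux\<close>

text \<open>An affine function attains its minimum over a segment at an end point. With c = a
  \<bullet> b and m the product of the norms, this reduces a vector inequality to parallel and
  antiparallel vectors.\<close>

lemma affine_le_on_segment:
  fixes m :: real
  assumes "c \<in> {-m..m}" "\<alpha> + \<beta> * m \<ge> 0" "\<alpha> - \<beta> * m \<ge> 0"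
  shows "\<alpha> + \<beta> * c \<ge> 0"
proof -
  have "\<bar>\<beta> * c\<bar> \<le> \<bar>\<beta>\<bar> * m" using assms(1) by (auto simp: abs_mult intro!: mult_left_mono)
  moreover have "\<bar>\<beta>\<bar> * m \<le> \<alpha>" using assms by (cases "\<beta> \<ge> 0") auto
  ultimately show ?thesis by linarith
qed

text \<open>For fixed norms the right side is affine in a \<bullet> b; both monotonicity
  inequalities exploit this.\<close>

lemma p_flux_inner:
  fixes a b :: "'b::euclidean_space"
  assumes "s = norm a" "t = norm b"
  shows "(p_flux p a - p_flux p b) \<bullet> (a - b)
    = s powr p + t powr p - (s powr (p - 2) + t powr (p - 2)) * (a \<bullet> b)"
proof -
  have *: "norm z powr (p - 2) * (z \<bullet> z) = norm z powr p" for z :: 'b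
    by (cases "z = 0") (auto simp: powr_diff dot_square_norm)
  show ?thesis
    using *[of a] *[of b] assms
    by (simp add: p_flux_def inner_diff_left inner_diff_right algebra_simps inner_commute)
qed

lemma powr_mult_base: "x powr (a - 1) * x = x powr a" if "0 \<le> x" for x a :: real
  using that by (cases "x = 0") (auto simp: powr_diff)

lemma powr_sub2_mult_base: "x powr (a - 2) * x = x powr (a - 1)" if "0 \<le> x" for x a :: real
  using powr_mult_base[OF that, of "a - 1"] by simp

text \<open>The right sides are the values of \<open>p_flux_inner\<close> at the two extremes
  allowed by Cauchy-Schwarz, a \<bullet> b = - (s * t) and a \<bullet> b = s * t.\<close>

lemma
  fixes s t p :: real
  assumes "0 \<le> s" "0 \<le> t"
  shows powr_sum_mult_sum: "(s powr (p - 1) + t powr (p - 1)) * (s + t)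
      = s powr p + t powr p + (s powr (p - 2) + t powr (p - 2)) * (s * t)"
    and powr_diff_mult_diff: "(s powr (p - 1) - t powr (p - 1)) * (s - t)
      = s powr p + t powr p - (s powr (p - 2) + t powr (p - 2)) * (s * t)"
  using powr_mult_base[of s p] powr_mult_base[of t p] powr_sub2_mult_base[of s p] powr_sub2_mult_base[of t p] assms
  by (simp_all add: algebra_simps)

text \<open>For fixed norms the right side is affine in a \<bullet> b, while
  \<open>norm (a - b) powr p\<close> is the power p / 2 \<ge> 1 of an affine function, hence convex.
  So only the two extreme values of a \<bullet> b matter, treated in \<open>plus\<close> and
  \<open>minus\<close>. Equality holds at b = -a.\<close>

lemma p_flux_monotone_ge2:
  fixes a b :: "'b::euclidean_space"
  assumes p: "p \<ge> 2"
  shows "2 powr (2 - p) * norm (a - b) powr p \<le> (p_flux p a - p_flux p b) \<bullet> (a - b)"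
proof -
  define s t where "s = norm a" and "t = norm b"
  define c where "c = a \<bullet> b"
  have st: "s \<ge> 0" "t \<ge> 0" by (auto simp: s_def t_def)
  have c: "c \<in> {-(s*t)..s*t}"
    using Cauchy_Schwarz_ineq2[of a b] by (auto simp: c_def s_def t_def abs_le_iff)
  note e1 = powr_sum_mult_sum[OF st, of p] and e2 = powr_diff_mult_diff[OF st, of p]
  \<comment> \<open>Antiparallel vectors. \<open>powr_add_le\<close> with exponent p - 1 \<ge> 1
    produces the factor 2 powr (p - 2), which the constant cancels.\<close>
  have plus: "2 powr (2 - p) * (s + t) powr p \<le> (s powr (p - 1) + t powr (p - 1)) * (s + t)"
  proof -
    have "2 powr (2 - p) * (s + t) powr p = 2 powr (2 - p) * (s + t) powr (p - 1) * (s + t)"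
      using powr_mult_base[of "s + t" p] st by simp
    also have "\<dots> \<le> 2 powr (2 - p) * (2 powr (p - 1 - 1) * (s powr (p - 1) + t powr (p - 1))) * (s + t)"
      using p st by (intro mult_right_mono mult_left_mono powr_add_le) auto
    also have "\<dots> = (s powr (p - 1) + t powr (p - 1)) * (s + t)"
      by (simp add: powr_diff field_simps)
    finally show ?thesis .
  qed
  \<comment> \<open>Parallel vectors. The constant is at most 1, and superadditivity of the power p
    - 1 is applied to x = (x - y) + y.\<close>
  have minus: "2 powr (2 - p) * \<bar>s - t\<bar> powr p \<le> (s powr (p - 1) - t powr (p - 1)) * (s - t)"
  proof -
    have *: "2 powr (2 - p) * \<bar>x - y\<bar> powr p \<le> (x powr (p - 1) - y powr (p - 1)) * (x - y)"
      if "0 \<le> y" "y \<le> x" for x y :: real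
    proof -
      have "2 powr (2 - p) \<le> 2 powr (0::real)" using p by (intro powr_mono) auto
      then have "2 powr (2 - p) * \<bar>x - y\<bar> powr p \<le> (x - y) powr p"
        using that by (simp add: mult_left_le_one_le)
      also have "\<dots> = (x - y) powr (p - 1) * (x - y)" using powr_mult_base[of "x - y" p] that by simp
      also have "\<dots> \<le> (x powr (p - 1) - y powr (p - 1)) * (x - y)"
        using powr_superadditive[of "p - 1" "x - y" y] p that by (intro mult_right_mono) auto
      finally show ?thesis .
    qed
    show ?thesis using *[of t s] *[of s t] st
      by (cases "t \<le> s") (auto simp: abs_minus_commute algebra_simps)
  qed
  \<comment> \<open>The barycentric coordinate of c in its segment; if s * t = 0 the segment is the
    point 0 and any value in [0, 1] serves.\<close>
  define l where "l = (if s * t = 0 then 0 else (s * t + c) / (2 * (s * t)))"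
  have l: "0 \<le> l" "l \<le> 1" "c = l * (s * t) + (1 - l) * (- (s * t))"
    using c st by (auto simp: l_def field_simps)
  have nab: "norm (a - b) ^ 2 = s ^ 2 + t ^ 2 - 2 * c"
    unfolding s_def t_def c_def by (simp add: power2_norm_eq_inner inner_diff_left inner_diff_right inner_commute)
  have sq: "x powr p = (x ^ 2) powr (p / 2)" if "x \<ge> 0" for x :: real
    using that by (cases "x = 0") (auto simp: powr_powr simp flip: powr_numeral)
  have "norm (a - b) powr p = (l * (s - t) ^ 2 + (1 - l) * (s + t) ^ 2) powr (p / 2)"
    unfolding sq[OF norm_ge_zero] nab l(3) by (simp add: algebra_simps power2_eq_square)
  also have "\<dots> \<le> l * ((s - t) ^ 2) powr (p / 2) + (1 - l) * ((s + t) ^ 2) powr (p / 2)"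
    using l(1,2) p by (intro powr_convex_combination) auto
  also have "\<dots> = l * \<bar>s - t\<bar> powr p + (1 - l) * (s + t) powr p"
    using sq[of "\<bar>s - t\<bar>"] sq[of "s + t"] st by simp
  finally have "2 powr (2 - p) * norm (a - b) powr p
      \<le> 2 powr (2 - p) * (l * \<bar>s - t\<bar> powr p + (1 - l) * (s + t) powr p)"
    by (intro mult_left_mono) auto
  also have "\<dots> = l * (2 powr (2 - p) * \<bar>s - t\<bar> powr p) + (1 - l) * (2 powr (2 - p) * (s + t) powr p)"
    by (simp add: algebra_simps)
  also have "\<dots> \<le> l * ((s powr (p - 1) - t powr (p - 1)) * (s - t))
      + (1 - l) * ((s powr (p - 1) + t powr (p - 1)) * (s + t))"
    using l(1,2) plus minus by (intro add_mono mult_left_mono) auto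
  also have "\<dots> = s powr p + t powr p - (s powr (p - 2) + t powr (p - 2)) * c"
    unfolding e1 e2 by (subst l(3)) (simp add: algebra_simps)
  also have "\<dots> = (p_flux p a - p_flux p b) \<bullet> (a - b)"
    using p_flux_inner[OF s_def t_def] by (simp add: c_def)
  finally show ?thesis .
qed

text \<open>The tangent at x lies above the concave power: the mean value theorem yields a slope at
  some z < x, which is at least the slope at x. At y = 0 the power can fail to be differentiable, so
  that case is direct.\<close>

lemma powr_concave_tangent:
  fixes x y r :: real
  assumes "0 < r" "r \<le> 1" "0 \<le> y" "y \<le> x"
  shows "r * x powr (r - 1) * (x - y) \<le> x powr r - y powr r"
proof (cases "y = x")
  case False
  then have yx: "y < x" using assms by simp
  show ?thesis
  proof (cases "y = 0")
    case True
    then have "r * x powr (r - 1) * (x - y) = r * x powr r"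
      using powr_mult_base[of x r] assms by simp
    also have "\<dots> \<le> x powr r" using assms by (simp add: mult_left_le_one_le)
    finally show ?thesis using True by simp
  next
    case False
    then have y: "y > 0" using assms by simp
    obtain z where z: "y < z" "z < x" "x powr r - y powr r = (x - y) * (r * z powr (r - 1))"
      using MVT2[OF yx, of "\<lambda>z. z powr r" "\<lambda>z. r * z powr (r - 1)"] has_real_derivative_powr y
      by (metis less_le_trans)
    have "x powr (r - 1) \<le> z powr (r - 1)" using z y assms by (intro powr_mono2') auto
    then have "(x - y) * (r * x powr (r - 1)) \<le> (x - y) * (r * z powr (r - 1))"
      using yx assms by (intro mult_left_mono) auto
    then show ?thesis using z(3) by (simp add: mult_ac)
  qed
qed auto

text \<open>For fixed norms both sides are affine in a \<bullet> b, since
  \<open>norm (a - b) ^ 2\<close> is, so the two extreme cases suffice. The factor p - 1 is the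
  tangent slope of the concave power p - 1 in the parallel case; the antiparallel case uses p - 1
  \<le> 1.\<close>

lemma p_flux_monotone_lt2:
  fixes a b :: "'b::euclidean_space"
  assumes p: "1 < p" "p < 2"
  shows "(p - 1) * norm (a - b) ^ 2 * max (norm a) (norm b) powr (p - 2) \<le> (p_flux p a - p_flux p b) \<bullet> (a - b)"
proof -
  define s t where "s = norm a" and "t = norm b"
  define M where "M = max s t"
  define c where "c = a \<bullet> b"
  have st: "s \<ge> 0" "t \<ge> 0" by (auto simp: s_def t_def)
  have c: "c \<in> {-(s*t)..s*t}"
    using Cauchy_Schwarz_ineq2[of a b] by (auto simp: c_def s_def t_def abs_le_iff)
  note e1 = powr_sum_mult_sum[OF st, of p] and e2 = powr_diff_mult_diff[OF st, of p]
  have plus: "(p - 1) * M powr (p - 2) * (s + t) ^ 2 \<le> (s powr (p - 1) + t powr (p - 1)) * (s + t)"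
  proof -
    have *: "M powr (p - 2) * x \<le> x powr (p - 1)" if "0 \<le> x" "x \<le> M" for x
    proof (cases "x = 0")
      case False
      then have "M powr (p - 2) * x \<le> x powr (p - 2) * x"
        using that p by (intro mult_right_mono powr_mono2') auto
      then show ?thesis using powr_sub2_mult_base[of x p] that by simp
    qed auto
    have "(p - 1) * M powr (p - 2) * (s + t) ^ 2 = (p - 1) * ((M powr (p - 2) * s + M powr (p - 2) * t) * (s + t))"
      by (simp add: power2_eq_square algebra_simps)
    also have "\<dots> \<le> (M powr (p - 2) * s + M powr (p - 2) * t) * (s + t)"
      using p st by (intro mult_left_le_one_le) auto
    also have "\<dots> \<le> (s powr (p - 1) + t powr (p - 1)) * (s + t)"
      using st *[of s] *[of t] by (intro mult_right_mono add_mono) (auto simp: M_def)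
    finally show ?thesis .
  qed
  have minus: "(p - 1) * M powr (p - 2) * (s - t) ^ 2 \<le> (s powr (p - 1) - t powr (p - 1)) * (s - t)"
  proof -
    have *: "(p - 1) * x powr (p - 2) * (x - y) ^ 2 \<le> (x powr (p - 1) - y powr (p - 1)) * (x - y)"
      if "0 \<le> y" "y \<le> x" for x y :: real
      using mult_right_mono[OF powr_concave_tangent[of "p - 1" y x], of "x - y"] that p
      by (simp add: power2_eq_square mult_ac)
    show ?thesis using *[of t s] *[of s t] st
      by (cases "t \<le> s") (auto simp: M_def max_def power2_commute algebra_simps)
  qed
  have nab: "norm (a - b) ^ 2 = s ^ 2 + t ^ 2 - 2 * c"
    unfolding s_def t_def c_def by (simp add: power2_norm_eq_inner inner_diff_left inner_diff_right inner_commute)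
  let ?k = "(p - 1) * M powr (p - 2)"
  \<comment> \<open>The difference of the two sides, written as an affine function of c; its values
    at the ends of the segment are \<open>minus\<close> and \<open>plus\<close>.\<close>
  have "(s powr p + t powr p - ?k * (s ^ 2 + t ^ 2)) + (2 * ?k - (s powr (p - 2) + t powr (p - 2))) * c \<ge> 0"
  proof (rule affine_le_on_segment[OF c])
    show "(s powr p + t powr p - ?k * (s ^ 2 + t ^ 2)) + (2 * ?k - (s powr (p - 2) + t powr (p - 2))) * (s * t) \<ge> 0"
      using minus unfolding e2 by (simp add: power2_eq_square algebra_simps)
    show "(s powr p + t powr p - ?k * (s ^ 2 + t ^ 2)) - (2 * ?k - (s powr (p - 2) + t powr (p - 2))) * (s * t) \<ge> 0"
      using plus unfolding e1 by (simp add: power2_eq_square algebra_simps)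
  qed
  then have "(p - 1) * norm (a - b) ^ 2 * M powr (p - 2) \<le> s powr p + t powr p - (s powr (p - 2) + t powr (p - 2)) * c"
    unfolding nab by (simp add: algebra_simps)
  then show ?thesis using p_flux_inner[OF s_def t_def] by (simp add: c_def M_def s_def t_def)
qed

section \<open>Smooth functions with compact support\<close>

lemma partial_eqI:
  assumes "(f has_derivative f') (at x)"
  shows "partial j f x = f' (axis j 1)"
  using frechet_derivative_at[OF assms] by (simp add: partial_def)

lemma C_k_continuous: "C_k k f \<Longrightarrow> continuous_on UNIV f"
  by (cases k) (auto intro: differentiable_imp_continuous_on)

lemma C_k_has_derivative:
  assumes "C_k (Suc k) f"
  shows "(f has_derivative frechet_derivative f (at x)) (at x)"
  using assms by (auto simp: differentiable_on_def frechet_derivative_works[symmetric])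

lemma C_k_SucI:
  assumes "\<And>x. (f has_derivative f' x) (at x)" "\<And>j. C_k k (\<lambda>x. f' x (axis j 1))"
  shows "C_k (Suc k) f"
proof -
  have "partial j f = (\<lambda>x. f' x (axis j 1))" for j
    using partial_eqI[OF assms(1)] by auto
  moreover have "f differentiable_on UNIV"
    using assms(1) by (auto simp: differentiable_on_def differentiable_def)
  ultimately show ?thesis using assms(2) by simp
qed

lemma C_k_partial: "C_k (Suc k) f \<Longrightarrow> C_k k (\<lambda>x. frechet_derivative f (at x) (axis j 1))"
  by (simp add: partial_def[abs_def])

lemma C_k_Suc_imp: "C_k (Suc k) f \<Longrightarrow> C_k k f"
proof (induction k arbitrary: f)
  case 0
  then show ?case by (auto intro: differentiable_imp_continuous_on)
next
  case (Suc k)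
  show ?case
  proof (rule C_k_SucI)
    show "(f has_derivative frechet_derivative f (at x)) (at x)" for x
      using C_k_has_derivative[OF Suc.prems] .
    show "C_k k (\<lambda>x. frechet_derivative f (at x) (axis j 1))" for j
      by (intro Suc.IH C_k_partial[OF Suc.prems])
  qed
qed

lemma C_k_const: "C_k k (\<lambda>x :: real ^ 'N. c)"
proof (induction k arbitrary: c)
  case (Suc k)
  show ?case by (rule C_k_SucI[where f' = "\<lambda>x h. 0"]) (auto intro: Suc)
qed simp

lemma C_k_nth: "C_k k (\<lambda>x :: real ^ 'N. x $ i)"
proof (cases k)
  case (Suc m)
  have "((\<lambda>x. x $ i) has_derivative (\<lambda>h. h $ i)) (at x)" for x :: "real ^ 'N"
    by (rule bounded_linear.has_derivative[OF bounded_linear_vec_nth has_derivative_ident])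
  then show ?thesis unfolding Suc by (intro C_k_SucI[where f' = "\<lambda>x h. h $ i"] C_k_const) auto
qed (auto intro: continuous_intros)

lemma C_k_add: "C_k k f \<Longrightarrow> C_k k g \<Longrightarrow> C_k k (\<lambda>x. f x + g x)"
proof (induction k arbitrary: f g)
  case 0 then show ?case by (auto intro: continuous_intros)
next
  case (Suc k)
  show ?case
    by (rule C_k_SucI, rule has_derivative_add[OF Suc.prems[THEN C_k_has_derivative]],
      intro Suc.IH C_k_partial Suc.prems)
qed

lemma C_k_mult: "C_k k f \<Longrightarrow> C_k k g \<Longrightarrow> C_k k (\<lambda>x. f x * g x)"
proof (induction k arbitrary: f g)
  case 0 then show ?case by (auto intro: continuous_intros)
next
  case (Suc k)
  show ?case
    by (rule C_k_SucI, rule has_derivative_mult[OF Suc.prems[THEN C_k_has_derivative]],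
      intro C_k_add Suc.IH C_k_partial Suc.prems C_k_Suc_imp)
qed

lemma C_k_sum: "(\<And>i. i \<in> I \<Longrightarrow> C_k k (f i)) \<Longrightarrow> C_k k (\<lambda>x. \<Sum>i\<in>I. f i x)"
  by (induction I rule: infinite_finite_induct) (auto intro!: C_k_const C_k_add)

lemma C_k_prod: "(\<And>i. i \<in> I \<Longrightarrow> C_k k (f i)) \<Longrightarrow> C_k k (\<lambda>x. \<Prod>i\<in>I. f i x)"
  by (induction I rule: infinite_finite_induct) (auto intro!: C_k_const C_k_mult)

lemma C_k_diff: "C_k k f \<Longrightarrow> C_k k g \<Longrightarrow> C_k k (\<lambda>x. f x - g x)"
  using C_k_add[OF _ C_k_mult[OF C_k_const[where c = "-1"]], of k f g] by simp

text \<open>Taking the outer function from a family G that is closed under differentiation on S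
  replaces a higher-order chain rule: one derivative produces a product whose outer factor is again
  in G, and the induction over k is uniform in g.\<close>

lemma C_k_compose:
  fixes f :: "real ^ 'N \<Rightarrow> real"
  assumes G: "\<And>g. g \<in> G \<Longrightarrow> \<exists>g'\<in>G. \<forall>t\<in>S. (g has_real_derivative g' t) (at t)"
    and S: "range f \<subseteq> S" and "g \<in> G" "C_k k f"
  shows "C_k k (\<lambda>x. g (f x))"
  using assms(3,4)
proof (induction k arbitrary: g)
  case 0
  obtain g' where "\<forall>t\<in>S. (g has_real_derivative g' t) (at t)" using G[OF 0(1)] by auto
  then have "continuous_on S g" by (meson DERIV_isCont continuous_at_imp_continuous_on)
  then show ?case using 0 S continuous_on_compose2[of S g UNIV f] by auto
next
  case (Suc k)
  obtain g' where g': "g' \<in> G" "\<And>t. t \<in> S \<Longrightarrow> (g has_real_derivative g' t) (at t)"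
    using G[OF Suc.prems(1)] by auto
  have "((\<lambda>x. g (f x)) has_derivative (\<lambda>h. frechet_derivative f (at x) h * g' (f x))) (at x)" for x
    using has_derivative_compose[OF C_k_has_derivative[OF Suc.prems(2)]
        g'(2)[unfolded has_field_derivative_def]] S by (auto simp: mult.commute)
  then show ?case
    by (rule C_k_SucI)
      (rule C_k_mult[OF C_k_partial[OF Suc.prems(2)] Suc.IH[OF g'(1) C_k_Suc_imp[OF Suc.prems(2)]]])
qed

text \<open>Constant multiples of powers form a family closed under differentiation on the positive
  reals.\<close>

lemma C_k_powr:
  assumes "C_k k f" "\<And>x. f x > 0"
  shows "C_k k (\<lambda>x. f x powr s)"
proof -
  have "C_k k (\<lambda>x. (\<lambda>t. 1 * t powr s) (f x))"
  proof (rule C_k_compose[where G = "{\<lambda>t. c * t powr s | c s. True}" and S = "{0<..}" and g = "\<lambda>t. 1 * t powr s"])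
    fix g :: "real \<Rightarrow> real" assume "g \<in> {\<lambda>t. c * t powr s | c s. True}"
    then obtain c s where g: "g = (\<lambda>t. c * t powr s)" by auto
    have "\<forall>t\<in>{0<..}. (g has_real_derivative (c * s) * t powr (s - 1)) (at t)"
      unfolding g by (auto intro!: derivative_eq_intros)
    then show "\<exists>g'\<in>{\<lambda>t. c * t powr s | c s. True}. \<forall>t\<in>{0<..}. (g has_real_derivative g' t) (at t)"
      by (intro bexI[of _ "\<lambda>t. (c * s) * t powr (s - 1)"]) auto
  qed (use assms in blast)+
  then show ?thesis by simp
qed

section \<open>The smooth function exp (-1/t)\<close>

text \<open>P = 1 gives the classical smooth function that is flat at 0. The polynomial in 1 / t
  makes the family contain all its derivatives, as \<open>C_k_compose\<close> demands.\<close>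

definition exp_bump :: "real poly \<Rightarrow> real \<Rightarrow> real" where
  "exp_bump P t = (if t > 0 then poly P (1 / t) * exp (- (1 / t)) else 0)"

lemma poly_times_exp_tendsto_0:
  fixes P :: "real poly"
  shows "((\<lambda>y. poly P y * exp (- y)) \<longlongrightarrow> 0) at_top"
proof -
  have "((\<lambda>y. \<Sum>i\<le>degree P. coeff P i * (y ^ i / exp y)) \<longlongrightarrow> (\<Sum>i\<le>degree P. coeff P i * 0)) at_top"
    by (intro tendsto_intros tendsto_power_div_exp_0)
  then show ?thesis
    by (simp add: poly_altdef sum_distrib_right exp_minus divide_inverse mult.assoc)
qed

text \<open>With y = 1 / t, differentiating P(y) exp(-y) in t gives y^2 (P - P')(y) exp(-y), and
  \<open>[:0, 0, 1:]\<close> is the polynomial y^2. At t = 0 the exponential decay beats every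
  polynomial.\<close>

lemma exp_bump_has_derivative:
  "(exp_bump P has_real_derivative exp_bump ([:0, 0, 1:] * (P - pderiv P)) t) (at t)"
proof -
  consider "t > 0" | "t < 0" | "t = 0" by linarith
  then show ?thesis
  proof cases
    case 1
    have "((\<lambda>t. poly P (1 / t) * exp (- (1 / t))) has_real_derivative
        exp_bump ([:0, 0, 1:] * (P - pderiv P)) t) (at t)"
      using 1 by (auto intro!: derivative_eq_intros DERIV_chain2[OF poly_DERIV]
          simp: exp_bump_def field_simps power2_eq_square)
    then show ?thesis
      by (rule has_field_derivative_transform_within[where d = t])
        (use 1 in \<open>auto simp: exp_bump_def dist_real_def\<close>)
  next
    case 2
    have "((\<lambda>t. 0) has_real_derivative exp_bump ([:0, 0, 1:] * (P - pderiv P)) t) (at t)"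
      using 2 by (auto simp: exp_bump_def)
    then show ?thesis
      by (rule has_field_derivative_transform_within[where d = "- t"])
        (use 2 in \<open>auto simp: exp_bump_def dist_real_def\<close>)
  next
    case 3
    \<comment> \<open>\<open>pCons 0 P\<close> is y P(y): the extra factor y = 1 / s is the
      denominator of the difference quotient at 0.\<close>
    have "((\<lambda>s. poly (pCons 0 P) (inverse s) * exp (- inverse s)) \<longlongrightarrow> 0) (at_right 0)"
      by (rule filterlim_compose[OF poly_times_exp_tendsto_0 filterlim_inverse_at_top_right])
    then have "((\<lambda>s. exp_bump P s / s) \<longlongrightarrow> 0) (at_right 0)"
      by (rule Lim_transform_eventually)
        (auto simp: eventually_at_right_field exp_bump_def field_simps intro!: exI[of _ 1])
    moreover have "((\<lambda>s. exp_bump P s / s) \<longlongrightarrow> 0) (at_left 0)"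
      by (rule Lim_transform_eventually[OF tendsto_const])
        (auto simp: eventually_at_left_field exp_bump_def intro!: exI[of _ "-1"])
    ultimately have "((\<lambda>s. exp_bump P s / s) \<longlongrightarrow> 0) (at 0)"
      by (intro filterlim_split_at)
    then show ?thesis using 3 by (simp add: has_field_derivative_iff exp_bump_def)
  qed
qed

lemma C_k_exp_bump: "C_k k f \<Longrightarrow> C_k k (\<lambda>x. exp_bump P (f x))"
  by (rule C_k_compose[where G = "range exp_bump" and S = UNIV])
    (auto intro: exp_bump_has_derivative)

lemma exp_bump_1: "exp_bump 1 t = (if t > 0 then exp (- (1 / t)) else 0)"
  by (simp add: exp_bump_def)

section \<open>Test functions\<close>

lemma test_functionsI:
  assumes "\<And>k. C_k k \<phi>" "compact K" "K \<subseteq> \<Omega>" "\<And>x. x \<notin> K \<Longrightarrow> \<phi> x = 0"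
  shows "\<phi> \<in> test_functions \<Omega>"
proof -
  have "closure {x. \<phi> x \<noteq> 0} \<subseteq> K"
    using assms by (intro closure_minimal) (auto intro: compact_imp_closed)
  moreover from this have "compact (closure {x. \<phi> x \<noteq> 0})"
    using assms(2) by (metis closed_closure compact_Int_closed inf.absorb_iff2)
  ultimately show ?thesis using assms by (auto simp: test_functions_def)
qed

text \<open>Off its closed support the function vanishes on an open set, so its derivatives vanish
  there as well; one compact K serves them all.\<close>

lemma test_functionsE:
  assumes "\<phi> \<in> test_functions \<Omega>"
  obtains K where "compact K" "K \<subseteq> \<Omega>" "\<And>x. x \<notin> K \<Longrightarrow> \<phi> x = 0"
    "\<And>x. x \<notin> K \<Longrightarrow> classical_grad \<phi> x = 0" "\<And>x j. x \<notin> K \<Longrightarrow> partial j \<phi> x = 0"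
proof
  let ?K = "closure {x. \<phi> x \<noteq> 0}"
  show "compact ?K" "?K \<subseteq> \<Omega>" using assms by (auto simp: test_functions_def)
  show "\<phi> x = 0" if "x \<notin> ?K" for x
    using that closure_subset[of "{x. \<phi> x \<noteq> 0}"] by auto
  show 0: "partial j \<phi> x = 0" if "x \<notin> ?K" for x j
  proof -
    have "(\<phi> has_derivative (\<lambda>h. 0)) (at x)"
    proof (rule has_derivative_transform_within_open[of "\<lambda>x. 0" _ _ _ "- ?K"])
      show "0 = \<phi> y" if "y \<in> - ?K" for y
        using that closure_subset[of "{x. \<phi> x \<noteq> 0}"] by auto
    qed (use that in auto)
    then show ?thesis by (simp add: partial_eqI)
  qed
  show "classical_grad \<phi> x = 0" if "x \<notin> ?K" for x
    using 0[OF that] by (simp add: classical_grad_def vec_eq_iff)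
qed

lemma test_functions_C_k: "\<phi> \<in> test_functions \<Omega> \<Longrightarrow> C_k k \<phi>"
  by (simp add: test_functions_def)

lemma test_functions_partial_C_k: "\<phi> \<in> test_functions \<Omega> \<Longrightarrow> C_k k (partial j \<phi>)"
  using test_functions_C_k[of \<phi> \<Omega> "Suc k"] by simp

lemma test_functions_partial:
  assumes "\<phi> \<in> test_functions \<Omega>"
  shows "partial j \<phi> \<in> test_functions \<Omega>"
  by (rule test_functionsE[OF assms]) (rule test_functionsI, auto intro: test_functions_partial_C_k assms)

lemma test_functions_add:
  assumes "\<phi> \<in> test_functions \<Omega>" "\<psi> \<in> test_functions \<Omega>"
  shows "(\<lambda>x. \<phi> x + \<psi> x) \<in> test_functions \<Omega>"
proof -
  obtain K where K: "compact K" "K \<subseteq> \<Omega>" "\<And>x. x \<notin> K \<Longrightarrow> \<phi> x = 0"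
    using assms(1) by (elim test_functionsE) blast
  obtain L where L: "compact L" "L \<subseteq> \<Omega>" "\<And>x. x \<notin> L \<Longrightarrow> \<psi> x = 0"
    using assms(2) by (elim test_functionsE) blast
  show ?thesis
    by (rule test_functionsI[of _ "K \<union> L"])
      (use K L in \<open>auto intro!: compact_Un C_k_add assms[THEN test_functions_C_k]\<close>)
qed

lemma test_functions_mult:
  assumes "\<phi> \<in> test_functions \<Omega>" "\<And>k. C_k k f"
  shows "(\<lambda>x. f x * \<phi> x) \<in> test_functions \<Omega>"
  by (rule test_functionsE[OF assms(1)])
    (rule test_functionsI, auto intro!: C_k_mult assms(2) test_functions_C_k[OF assms(1)])

lemma test_functions_cmult:
  "\<phi> \<in> test_functions \<Omega> \<Longrightarrow> (\<lambda>x. c * \<phi> x) \<in> test_functions \<Omega>"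
  by (rule test_functions_mult) (auto intro: C_k_const)

lemma test_functions_zero: "(\<lambda>x. 0) \<in> test_functions \<Omega>"
  by (rule test_functionsI[of _ "{}"]) (auto intro: C_k_const)

lemma has_derivative_classical_grad:
  assumes "\<phi> \<in> test_functions \<Omega>"
  shows "(\<phi> has_derivative (\<lambda>h. classical_grad \<phi> x \<bullet> h)) (at x)"
proof -
  let ?D = "frechet_derivative \<phi> (at x)"
  have D: "(\<phi> has_derivative ?D) (at x)"
    by (rule C_k_has_derivative[OF test_functions_C_k[OF assms, of "Suc 0"]])
  then interpret linear ?D by (rule has_derivative_linear)
  have "?D h = classical_grad \<phi> x \<bullet> h" for h
  proof -
    have "h = (\<Sum>j\<in>UNIV. h $ j *\<^sub>R axis j 1)"
      by (simp add: vec_eq_iff axis_def if_distrib cong: if_cong)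
    then have "?D h = ?D (\<Sum>j\<in>UNIV. h $ j *\<^sub>R axis j 1)" by simp
    also have "\<dots> = (\<Sum>j\<in>UNIV. h $ j * ?D (axis j 1))" by (simp add: sum scale)
    finally show ?thesis by (simp add: classical_grad_def partial_def inner_vec_def mult.commute)
  qed
  then have "?D = (\<lambda>h. classical_grad \<phi> x \<bullet> h)" by auto
  with D show ?thesis by simp
qed

lemma classical_grad_eqI:
  assumes "(f has_derivative (\<lambda>h. g \<bullet> h)) (at x)"
  shows "classical_grad f x = g"
  using partial_eqI[OF assms] by (simp add: classical_grad_def vec_eq_iff inner_axis)

lemma classical_grad_linear_combination:
  assumes "\<phi> \<in> test_functions \<Omega>" "\<psi> \<in> test_functions \<Omega>"
  shows "classical_grad (\<lambda>x. a * \<phi> x + b * \<psi> x) x = a *\<^sub>R classical_grad \<phi> x + b *\<^sub>R classical_grad \<psi> x"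
  by (rule classical_grad_eqI)
    (auto intro!: derivative_eq_intros has_derivative_classical_grad[OF assms(1)]
      has_derivative_classical_grad[OF assms(2)] simp: inner_add_left)

lemma continuous_test_functions:
  assumes "\<phi> \<in> test_functions \<Omega>"
  shows "continuous_on UNIV \<phi>" "continuous_on UNIV (classical_grad \<phi>)"
  using C_k_continuous[OF test_functions_C_k[OF assms]]
    C_k_continuous[OF test_functions_partial_C_k[OF assms]]
  unfolding classical_grad_def[abs_def] by (auto intro!: continuous_on_vec_lambda)

lemma borel_measurable_test_functions [measurable_dest]:
  assumes "\<phi> \<in> test_functions \<Omega>"
  shows "\<phi> \<in> borel_measurable borel" "classical_grad \<phi> \<in> borel_measurable borel"
  using continuous_test_functions[OF assms] by (auto intro: borel_measurable_continuous_onI)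

lemma continuous_compact_support_bounded:
  fixes f :: "'a::euclidean_space \<Rightarrow> 'b::real_normed_vector"
  assumes "continuous_on UNIV f" "compact K" "\<And>x. x \<notin> K \<Longrightarrow> f x = 0"
  obtains B where "B > 0" "\<And>x. norm (f x) \<le> B"
proof -
  have "bounded (f ` K)"
    using assms by (intro compact_imp_bounded compact_continuous_image) (auto intro: continuous_on_subset)
  then obtain B where "B > 0" "\<forall>y\<in>f ` K. norm y \<le> B" by (auto simp: bounded_pos)
  then have "norm (f x) \<le> B" for x using assms(3)[of x] by (cases "x \<in> K") auto
  with \<open>B > 0\<close> that show thesis by blast
qed

section \<open>Integration by parts for test functions\<close>

lemma borel_measurable_lebesgue_on:
  "f \<in> borel_measurable borel \<Longrightarrow> f \<in> borel_measurable (lebesgue_on \<Omega>)"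
  by (rule measurable_restrict_space1) (simp add: measurable_completion)

text \<open>Moves integrals over \<Omega> to the whole space, where translation invariance and
  Fubini's theorem apply.\<close>

lemma LINT_lebesgue_on_eq_lborel:
  fixes f :: "real ^ 'N \<Rightarrow> 'b::euclidean_space"
  assumes "\<Omega> \<in> sets lebesgue" "f \<in> borel_measurable borel" "\<And>x. x \<notin> \<Omega> \<Longrightarrow> f x = 0"
  shows "(LINT x|lebesgue_on \<Omega>. f x) = (LINT x|lborel. f x)"
    and "integrable (lebesgue_on \<Omega>) f \<longleftrightarrow> integrable lborel f"
proof -
  have *: "(\<lambda>x. if x \<in> \<Omega> then f x else 0) = f" using assms(3) by auto
  show "(LINT x|lebesgue_on \<Omega>. f x) = (LINT x|lborel. f x)"
    using Lebesgue_Measure.integral_restrict_UNIV[OF assms(1), of f] integral_completion[of f lborel] assms(2)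
    unfolding * by simp
  show "integrable (lebesgue_on \<Omega>) f \<longleftrightarrow> integrable lborel f"
    using Lebesgue_Measure.integrable_restrict_UNIV[OF assms(1), of f] integrable_completion[of f lborel] assms(2)
    unfolding * by simp
qed

lemma integrable_compact_support:
  fixes f :: "real ^ 'N \<Rightarrow> 'b::euclidean_space"
  assumes "continuous_on UNIV f" "compact K" "\<And>x. x \<notin> K \<Longrightarrow> f x = 0"
  shows "integrable lborel f"
proof -
  have "integrable lborel (\<lambda>x. indicator K x *\<^sub>R f x)"
    using assms by (intro borel_integrable_compact) (auto intro: continuous_on_subset)
  moreover have "(\<lambda>x. indicator K x *\<^sub>R f x) = f" using assms(3) by (auto simp: indicator_def)
  ultimately show ?thesis by simp
qed

lemma Lp_space_compact_support:
  fixes f :: "real ^ 'N \<Rightarrow> 'b::euclidean_space"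
  assumes f: "continuous_on UNIV f" "compact K" "\<And>x. x \<notin> K \<Longrightarrow> f x = 0"
    and K: "K \<subseteq> \<Omega>" and \<Omega>: "\<Omega> \<in> sets lebesgue" and q: "q > 0"
  shows "f \<in> Lp_space q \<Omega>"
proof -
  have [measurable]: "f \<in> borel_measurable borel" using f(1) by (rule borel_measurable_continuous_onI)
  have "continuous_on UNIV (\<lambda>x. norm (f x) powr q)"
    using f(1) q by (intro continuous_on_powr' continuous_intros) auto
  then have "integrable lborel (\<lambda>x. norm (f x) powr q)"
    using f by (intro integrable_compact_support[of _ K]) auto
  then have "integrable (lebesgue_on \<Omega>) (\<lambda>x. norm (f x) powr q)"
    using f(3) K by (subst LINT_lebesgue_on_eq_lborel(2)[OF \<Omega>]) auto
  then show ?thesis by (simp add: Lp_space_def borel_measurable_lebesgue_on)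
qed

lemma test_functions_Lp_space:
  assumes \<phi>: "\<phi> \<in> test_functions \<Omega>" and "\<Omega> \<in> sets lebesgue" "q > 0"
  shows "\<phi> \<in> Lp_space q \<Omega>" "classical_grad \<phi> \<in> Lp_space q \<Omega>"
proof -
  obtain K where "compact K" "K \<subseteq> \<Omega>" "\<And>x. x \<notin> K \<Longrightarrow> \<phi> x = 0" "\<And>x. x \<notin> K \<Longrightarrow> classical_grad \<phi> x = 0"
    using \<phi> by (elim test_functionsE) blast
  then show "\<phi> \<in> Lp_space q \<Omega>" "classical_grad \<phi> \<in> Lp_space q \<Omega>"
    using assms(2,3) Lp_space_compact_support[OF continuous_test_functions(1)[OF \<phi>]]
      Lp_space_compact_support[OF continuous_test_functions(2)[OF \<phi>]] by blast+
qed

text \<open>Every difference quotient integrates to 0 by translation invariance, and dominated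
  convergence passes to the derivative; this avoids iterated integrals.\<close>

lemma integral_partial_compact_support:
  assumes \<phi>: "\<phi> \<in> test_functions \<Omega>"
  shows "(LINT x|lborel. partial j \<phi> x) = 0"
proof -
  obtain K where K: "compact K" "\<And>x. x \<notin> K \<Longrightarrow> \<phi> x = 0" "\<And>x. x \<notin> K \<Longrightarrow> classical_grad \<phi> x = 0"
    using \<phi> by (elim test_functionsE) blast
  obtain B where B: "B > 0" "\<And>x. norm (classical_grad \<phi> x) \<le> B"
    using continuous_compact_support_bounded[OF continuous_test_functions(2)[OF \<phi>] K(1,3)] by blast
  define e :: "real ^ 'a" where "e = axis j 1"
  have e: "norm e = 1" by (simp add: e_def)
  \<comment> \<open>Contains K and its translates by - (1 / (n + 1)) e, so all difference quotients
    vanish off one compact set.\<close>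
  define K' where "K' = {x - y | x y. x \<in> K \<and> y \<in> cball 0 1}"
  have K': "compact K'" unfolding K'_def by (intro compact_differences K(1)) auto
  define s where "s n x = real (Suc n) * (\<phi> (x + (1 / real (Suc n)) *\<^sub>R e) - \<phi> x)" for n x
  have [measurable]: "\<phi> \<in> borel_measurable borel" "partial j \<phi> \<in> borel_measurable borel"
    using borel_measurable_test_functions(1) \<phi> test_functions_partial[OF \<phi>] by blast+
  have I\<phi>: "integrable lborel \<phi>"
    using integrable_compact_support[OF continuous_test_functions(1)[OF \<phi>] K(1,2)] .
  have lim: "(\<lambda>n. s n x) \<longlonglongrightarrow> partial j \<phi> x" for x
  proof -
    have "((\<lambda>t. \<phi> (x + t *\<^sub>R e)) has_derivative (\<lambda>t. classical_grad \<phi> (x + 0 *\<^sub>R e) \<bullet> (t *\<^sub>R e))) (at 0)"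
      by (rule has_derivative_compose[OF _ has_derivative_classical_grad[OF \<phi>]])
        (auto intro!: derivative_eq_intros)
    then have "((\<lambda>t. \<phi> (x + t *\<^sub>R e)) has_real_derivative partial j \<phi> x) (at 0)"
      unfolding has_field_derivative_def
      by (rule has_derivative_eq_rhs) (auto simp: fun_eq_iff e_def classical_grad_def inner_axis)
    then have "((\<lambda>t. (\<phi> (x + t *\<^sub>R e) - \<phi> x) / t) \<longlongrightarrow> partial j \<phi> x) (at 0)"
      by (simp add: has_field_derivative_iff)
    then have "((\<lambda>n. (\<phi> (x + (1 / real (Suc n)) *\<^sub>R e) - \<phi> x) / (1 / real (Suc n))) \<longlonglongrightarrow> partial j \<phi> x)"
      by (rule filterlim_compose)
        (auto simp: filterlim_at simp del: of_nat_Suc intro!: LIMSEQ_inverse_real_of_nat simp flip: inverse_eq_divide)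
    then show ?thesis by (simp add: s_def mult.commute)
  qed
  have bd: "norm (s n x) \<le> indicator K' x * B" for n x
  proof (cases "x \<in> K'")
    case True
    have "norm (\<phi> (x + (1 / real (Suc n)) *\<^sub>R e) - \<phi> x) \<le> B * norm (x + (1 / real (Suc n)) *\<^sub>R e - x)"
    proof (rule differentiable_bound[OF convex_UNIV])
      fix y show "(\<phi> has_derivative (\<lambda>h. classical_grad \<phi> y \<bullet> h)) (at y within UNIV)"
        by (simp add: has_derivative_classical_grad[OF \<phi>])
      have "norm (classical_grad \<phi> y \<bullet> h) \<le> B * norm h" for h
        by (metis B(2) Cauchy_Schwarz_ineq2 mult_right_mono norm_ge_zero order_trans real_norm_def)
      then show "onorm (\<lambda>h. classical_grad \<phi> y \<bullet> h) \<le> B" by (rule onorm_le)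
    qed auto
    also have "\<dots> = B / real (Suc n)" by (simp add: e)
    finally have "real (Suc n) * norm (\<phi> (x + (1 / real (Suc n)) *\<^sub>R e) - \<phi> x) \<le> real (Suc n) * (B / real (Suc n))"
      by (intro mult_left_mono) auto
    then show ?thesis using True by (simp add: s_def abs_mult del: of_nat_Suc)
  next
    case False
    have "x \<notin> K"
    proof
      assume "x \<in> K"
      then have "x - 0 \<in> K'" unfolding K'_def by (intro CollectI exI conjI refl) auto
      with False show False by simp
    qed
    moreover have "x + (1 / real (Suc n)) *\<^sub>R e \<notin> K"
    proof
      assume "x + (1 / real (Suc n)) *\<^sub>R e \<in> K"
      then have "(x + (1 / real (Suc n)) *\<^sub>R e) - (1 / real (Suc n)) *\<^sub>R e \<in> K'"
        unfolding K'_def by (intro CollectI exI conjI refl) (auto simp: e)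
      with False show False by simp
    qed
    ultimately show ?thesis using K(2) B(1) by (simp add: s_def)
  qed
  have "(\<lambda>n. LINT x|lborel. s n x) \<longlonglongrightarrow> (LINT x|lborel. partial j \<phi> x)"
  proof (rule integral_dominated_convergence[where w = "\<lambda>x. indicator K' x * B"])
    show "integrable lborel (\<lambda>x. indicator K' x * B)"
      using borel_integrable_compact[OF K', of "\<lambda>x. B"] by simp
  qed (use lim bd in \<open>auto simp: s_def\<close>)
  moreover have "(LINT x|lborel. s n x) = 0" for n
  proof -
    let ?d = "(1 / real (Suc n)) *\<^sub>R e"
    have "integrable (distr lborel borel ((+) ?d)) \<phi>" using I\<phi> by (simp add: lborel_distr_plus)
    then have I: "integrable lborel (\<lambda>x. \<phi> (x + ?d))"
      by (simp add: integrable_distr_eq add.commute)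
    have "(LINT x|lborel. \<phi> x) = (LINT x|distr lborel borel ((+) ?d). \<phi> x)" by (simp add: lborel_distr_plus)
    also have "\<dots> = (LINT x|lborel. \<phi> (x + ?d))" by (simp add: integral_distr add.commute)
    finally show ?thesis unfolding s_def using I I\<phi> by simp
  qed
  ultimately show ?thesis by (simp add: LIMSEQ_const_iff)
qed

lemma integration_by_parts_test_functions:
  assumes \<phi>: "\<phi> \<in> test_functions \<Omega>" and \<psi>: "\<psi> \<in> test_functions \<Omega>"
  shows "(LINT x|lborel. \<phi> x * partial j \<psi> x) = - (LINT x|lborel. partial j \<phi> x * \<psi> x)"
proof -
  have D: "partial j (\<lambda>x. \<phi> x * \<psi> x) x = \<phi> x * partial j \<psi> x + partial j \<phi> x * \<psi> x" for x
    using partial_eqI[OF has_derivative_mult[OF has_derivative_classical_grad[OF \<phi>]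
          has_derivative_classical_grad[OF \<psi>]], of j]
    by (simp add: classical_grad_def inner_axis)
  have I: "integrable lborel (\<lambda>x. f x * g x)"
    if "f \<in> test_functions \<Omega>" "g \<in> test_functions \<Omega>" for f g :: "real ^ 'a \<Rightarrow> real"
    using test_functions_mult[OF that(2) test_functions_C_k[OF that(1)]]
    by (elim test_functionsE) (rule integrable_compact_support, auto intro!: continuous_intros
        continuous_test_functions(1)[OF that(1)] continuous_test_functions(1)[OF that(2)])
  have "(LINT x|lborel. \<phi> x * partial j \<psi> x + partial j \<phi> x * \<psi> x) = 0"
    using integral_partial_compact_support[OF test_functions_mult[OF \<psi> test_functions_C_k[OF \<phi>]], of j]
    by (simp add: D)
  then show ?thesis
    using I[OF \<phi> test_functions_partial[OF \<psi>]] I[OF test_functions_partial[OF \<phi>] \<psi>] by simp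
qed

section \<open>The Friedrichs inequality for test functions\<close>

lemma nn_integral_lborel_translate:
  fixes f :: "'a::euclidean_space \<Rightarrow> ennreal"
  assumes [measurable]: "f \<in> borel_measurable borel"
  shows "(\<integral>\<^sup>+x. f (x + c) \<partial>lborel) = (\<integral>\<^sup>+x. f x \<partial>lborel)"
proof -
  have "(\<integral>\<^sup>+x. f x \<partial>lborel) = (\<integral>\<^sup>+x. f x \<partial>distr lborel borel ((+) c))"
    by (simp add: lborel_distr_plus)
  also have "\<dots> = (\<integral>\<^sup>+x. f (x + c) \<partial>lborel)"
    by (simp add: nn_integral_distr add.commute)
  finally show ?thesis by simp
qed

text \<open>The fundamental theorem of calculus along the segment from x to x + h, followed by
  Hoelder's inequality on the unit interval. Stated with nonnegative integrals so that the order of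
  integration can be exchanged freely afterwards.\<close>

lemma increment_powr_le:
  fixes \<phi> :: "real ^ 'N \<Rightarrow> real"
  assumes \<phi>: "\<phi> \<in> test_functions \<Omega>" and p: "p > 1"
  shows "ennreal (\<bar>\<phi> (x + h) - \<phi> x\<bar> powr p)
    \<le> (\<integral>\<^sup>+t. ennreal (norm h powr p * norm (classical_grad \<phi> (x + t *\<^sub>R h)) powr p) * indicator {0..1} t \<partial>lborel)"
proof -
  define g where "g t = classical_grad \<phi> (x + t *\<^sub>R h) \<bullet> h" for t
  have cont: "continuous_on UNIV g"
    unfolding g_def
    by (intro continuous_intros continuous_on_compose2[OF continuous_test_functions(2)[OF \<phi>]]) auto
  have [measurable]: "g \<in> borel_measurable borel" using cont by (rule borel_measurable_continuous_onI)
  have D: "((\<lambda>t. \<phi> (x + t *\<^sub>R h)) has_real_derivative g t) (at t)" for t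
  proof -
    have "((\<lambda>t. \<phi> (x + t *\<^sub>R h)) has_derivative (\<lambda>s. classical_grad \<phi> (x + t *\<^sub>R h) \<bullet> (s *\<^sub>R h))) (at t)"
      by (rule has_derivative_compose[OF _ has_derivative_classical_grad[OF \<phi>]])
        (auto intro!: derivative_eq_intros)
    then show ?thesis
      unfolding has_field_derivative_def by (rule has_derivative_eq_rhs) (auto simp: fun_eq_iff g_def)
  qed
  have "(LINT t|lborel. g t * indicator {0..1} t) = \<phi> (x + 1 *\<^sub>R h) - \<phi> (x + 0 *\<^sub>R h)"
    by (rule integral_FTC_Icc_real[of 0 1 "\<lambda>t. \<phi> (x + t *\<^sub>R h)" g])
      (use D cont in \<open>auto simp: continuous_on_eq_continuous_at\<close>)
  then have FTC: "\<phi> (x + h) - \<phi> x = (LINT t|lborel. g t * indicator {0..1} t)" by simp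
  define q where "q = p / (p - 1)"
  have pq: "p > 1" "q > 1" "1 / p + 1 / q = 1" using p by (auto simp: q_def field_simps)
  have powr_ind: "(\<bar>g t\<bar> * indicator {0..1} t) powr p = indicator {0..1} t *\<^sub>R (\<bar>g t\<bar> powr p)"
    "(indicator {0..1} t :: real) powr q = indicator {0..1} t" for t
    using pq by (auto simp: indicator_def)
  have I: "integrable lborel (\<lambda>t. (\<bar>g t\<bar> * indicator {0..1} t) powr p)"
    unfolding powr_ind using p
    by (intro borel_integrable_compact continuous_on_powr' continuous_intros continuous_on_subset[OF cont]) auto
  \<comment> \<open>The second indicator is the partner in Hoelder's inequality; its norm is 1
    because the interval has length 1.\<close>
  have "\<bar>\<phi> (x + h) - \<phi> x\<bar> \<le> (LINT t|lborel. (\<bar>g t\<bar> * indicator {0..1} t) * indicator {0..1} t)"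
    unfolding FTC
    by (rule order_trans[OF integral_abs_bound]) (auto intro!: eq_refl Bochner_Integration.integral_cong simp: indicator_def abs_mult)
  also have "\<dots> \<le> (LINT t|lborel. (\<bar>g t\<bar> * indicator {0..1} t) powr p) powr (1 / p)
      * (LINT t|lborel. (indicator {0..1} (t :: real) :: real) powr q) powr (1 / q)"
    using I by (intro holder_inequality(2)[OF pq, of "\<lambda>t. \<bar>g t\<bar> * indicator {0..1} t" lborel "indicator {0..1}"])
      (auto simp: powr_ind(2))
  also have "\<dots> = (LINT t|lborel. (\<bar>g t\<bar> * indicator {0..1} t) powr p) powr (1 / p)"
    unfolding powr_ind by simp
  finally have "\<bar>\<phi> (x + h) - \<phi> x\<bar> powr p
      \<le> ((LINT t|lborel. (\<bar>g t\<bar> * indicator {0..1} t) powr p) powr (1 / p)) powr p"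
    using p by (intro powr_mono2) auto
  also have "\<dots> = (LINT t|lborel. (\<bar>g t\<bar> * indicator {0..1} t) powr p)"
    using p by (simp add: powr_powr)
  finally have "ennreal (\<bar>\<phi> (x + h) - \<phi> x\<bar> powr p) \<le> (\<integral>\<^sup>+t. ennreal ((\<bar>g t\<bar> * indicator {0..1} t) powr p) \<partial>lborel)"
    using I by (subst nn_integral_eq_integral) (auto intro: ennreal_leI)
  also have "\<dots> \<le> (\<integral>\<^sup>+t. ennreal (norm h powr p * norm (classical_grad \<phi> (x + t *\<^sub>R h)) powr p) * indicator {0..1} t \<partial>lborel)"
  proof (rule nn_integral_mono)
    fix t
    have "\<bar>g t\<bar> powr p \<le> (norm (classical_grad \<phi> (x + t *\<^sub>R h)) * norm h) powr p"
      unfolding g_def using p by (intro powr_mono2 Cauchy_Schwarz_ineq2) auto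
    then show "ennreal ((\<bar>g t\<bar> * indicator {0..1} t) powr p)
        \<le> ennreal (norm h powr p * norm (classical_grad \<phi> (x + t *\<^sub>R h)) powr p) * indicator {0..1} t"
      using p by (auto simp: indicator_def powr_mult mult.commute intro: ennreal_leI)
  qed
  finally show ?thesis .
qed

text \<open>Integrate the bound along segments over x and exchange the integrals; for each t the
  inner integral does not depend on the shift t h.\<close>

lemma translation_estimate:
  fixes \<phi> :: "real ^ 'N \<Rightarrow> real"
  assumes \<phi>: "\<phi> \<in> test_functions \<Omega>" and p: "p > 1"
  shows "(\<integral>\<^sup>+x. ennreal (\<bar>\<phi> (x + h) - \<phi> x\<bar> powr p) \<partial>lborel)
    \<le> ennreal (norm h powr p) * (\<integral>\<^sup>+x. ennreal (norm (classical_grad \<phi> x) powr p) \<partial>lborel)"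
proof -
  note [measurable] = borel_measurable_test_functions[OF \<phi>]
  let ?G = "\<lambda>x. ennreal (norm (classical_grad \<phi> x) powr p)"
  have "(\<integral>\<^sup>+x. ennreal (\<bar>\<phi> (x + h) - \<phi> x\<bar> powr p) \<partial>lborel)
      \<le> (\<integral>\<^sup>+x. (\<integral>\<^sup>+t. ennreal (norm h powr p * norm (classical_grad \<phi> (x + t *\<^sub>R h)) powr p) * indicator {0..1} t \<partial>lborel) \<partial>lborel)"
    by (intro nn_integral_mono increment_powr_le[OF \<phi> p])
  also have "\<dots> = (\<integral>\<^sup>+t. (\<integral>\<^sup>+x. ennreal (norm h powr p * norm (classical_grad \<phi> (x + t *\<^sub>R h)) powr p) * indicator {0..1} t \<partial>lborel) \<partial>lborel)"
    by (rule lborel_pair.Fubini') measurable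
  also have "\<dots> = (\<integral>\<^sup>+t. ennreal (norm h powr p) * (\<integral>\<^sup>+x. ?G x \<partial>lborel) * indicator {0..1::real} t \<partial>lborel)"
  proof (rule nn_integral_cong)
    fix t :: real
    have "(\<integral>\<^sup>+x. ennreal (norm h powr p * norm (classical_grad \<phi> (x + t *\<^sub>R h)) powr p) * indicator {0..1} t \<partial>lborel)
        = (\<integral>\<^sup>+x. (ennreal (norm h powr p) * ?G (x + t *\<^sub>R h)) * indicator {0..1} t \<partial>lborel)"
      by (simp add: ennreal_mult)
    also have "\<dots> = ennreal (norm h powr p) * (\<integral>\<^sup>+x. ?G (x + t *\<^sub>R h) \<partial>lborel) * indicator {0..1} t"
      by (simp add: nn_integral_multc nn_integral_cmult)
    also have "(\<integral>\<^sup>+x. ?G (x + t *\<^sub>R h) \<partial>lborel) = (\<integral>\<^sup>+x. ?G x \<partial>lborel)"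
      by (rule nn_integral_lborel_translate) measurable
    finally show "(\<integral>\<^sup>+x. ennreal (norm h powr p * norm (classical_grad \<phi> (x + t *\<^sub>R h)) powr p) * indicator {0..1} t \<partial>lborel)
        = ennreal (norm h powr p) * (\<integral>\<^sup>+x. ?G x \<partial>lborel) * indicator {0..1} t" .
  qed
  also have "\<dots> = ennreal (norm h powr p) * (\<integral>\<^sup>+x. ?G x \<partial>lborel)"
    by (simp add: nn_integral_cmult)
  finally show ?thesis .
qed

lemma ennreal_Lp_norm_eq_nn_integral:
  fixes f :: "real ^ 'N \<Rightarrow> 'b::euclidean_space"
  assumes "f \<in> Lp_space p \<Omega>" "f \<in> borel_measurable borel" "\<And>x. x \<notin> \<Omega> \<Longrightarrow> f x = 0"
    and \<Omega>: "\<Omega> \<in> sets lebesgue" and p: "p > 0"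
  shows "ennreal (Lp_norm p \<Omega> f powr p) = (\<integral>\<^sup>+x. ennreal (norm (f x) powr p) \<partial>lborel)"
proof -
  note [measurable] = assms(2)
  have "integrable lborel (\<lambda>x. norm (f x) powr p)"
    using Lp_spaceD(2)[OF assms(1)] LINT_lebesgue_on_eq_lborel(2)[OF \<Omega>, of "\<lambda>x. norm (f x) powr p"] assms(3) by simp
  then show ?thesis
    using LINT_lebesgue_on_eq_lborel(1)[OF \<Omega>, of "\<lambda>x. norm (f x) powr p"] assms(3)
    by (simp add: Lp_norm_powr[OF p] nn_integral_eq_integral)
qed

text \<open>
  A translation by \<open>h\<close> outside a set of measure at most \<open>|\<Omega>|\<close> moves a given point out of \<open>\<Omega>\<close>. Averaging
  the translation estimate over the \<open>h\<close> in a ball of measure at least \<open>|\<Omega>| + 1\<close> therefore bounds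
  \<open>\<phi>\<close> itself, also for unbounded \<open>\<Omega>\<close>.
\<close>

lemma friedrichs_test_functions:
  fixes \<Omega> :: "(real ^ 'N) set"
  assumes \<Omega>: "open \<Omega>" "emeasure lebesgue \<Omega> < \<infinity>" and p: "p > 1"
  obtains c where "c \<ge> 0"
    "\<And>\<phi>. \<phi> \<in> test_functions \<Omega> \<Longrightarrow> Lp_norm p \<Omega> \<phi> \<le> c * Lp_norm p \<Omega> (classical_grad \<phi>)"
proof -
  have [measurable]: "\<Omega> \<in> sets borel" using \<Omega>(1) by simp
  have \<Omega>m: "\<Omega> \<in> sets lebesgue" by simp
  have fin: "emeasure lborel \<Omega> < \<infinity>" using \<Omega>(2) by simp
  have "(SUP n. emeasure lborel (ball (0 :: real ^ 'N) (real n))) = emeasure lborel (\<Union>n. ball (0 :: real ^ 'N) (real n))"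
    by (rule SUP_emeasure_incseq) (auto simp: incseq_def)
  also have "(\<Union>n. ball (0 :: real ^ 'N) (real n)) = UNIV"
    by (auto simp: reals_Archimedean2)
  finally have "(SUP n. emeasure lborel (ball (0 :: real ^ 'N) (real n))) = \<infinity>" by (simp add: emeasure_lborel_UNIV)
  moreover have "emeasure lborel \<Omega> + 1 < \<infinity>" using fin by (simp add: ennreal_add_less_top)
  \<comment> \<open>The surplus 1 leaves, for every x, admissible translations of total measure at
    least 1, so that averaging needs no division.\<close>
  ultimately obtain n where n: "emeasure lborel \<Omega> + 1 < emeasure lborel (ball (0 :: real ^ 'N) (real n))"
    by (metis less_SUP_iff)
  define B where "B = ball (0 :: real ^ 'N) (real n)"
  have [measurable]: "B \<in> sets borel" by (simp add: B_def)
  have Bfin: "emeasure lborel B < \<infinity>" unfolding B_def by (intro emeasure_bounded_finite bounded_ball)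
  define m where "m = measure lborel B"
  have m: "emeasure lborel B = ennreal m" "m \<ge> 0"
    using Bfin by (auto simp: m_def emeasure_eq_ennreal_measure less_top)
  \<comment> \<open>n bounds \<open>norm h\<close> on B, and m is the measure of the ball over which
    the translation estimate is integrated.\<close>
  define c where "c = (real n powr p * m) powr (1 / p)"
  have main: "Lp_norm p \<Omega> \<phi> \<le> c * Lp_norm p \<Omega> (classical_grad \<phi>)" if \<phi>: "\<phi> \<in> test_functions \<Omega>" for \<phi>
  proof -
    note [measurable] = borel_measurable_test_functions[OF \<phi>]
    have K: "\<phi> x = 0" "classical_grad \<phi> x = 0" if "x \<notin> \<Omega>" for x
      using \<phi> that by (elim test_functionsE; blast)+
    note Lp = test_functions_Lp_space[OF \<phi> \<Omega>m, of p]
    let ?I = "\<integral>\<^sup>+x. ennreal (norm (classical_grad \<phi> x) powr p) \<partial>lborel"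
    have pw: "ennreal (\<bar>\<phi> x\<bar> powr p) \<le> (\<integral>\<^sup>+h. ennreal (\<bar>\<phi> (x + h) - \<phi> x\<bar> powr p) * indicator B h \<partial>lborel)" for x
    proof -
      let ?D = "{h \<in> B. x + h \<notin> \<Omega>}"
      have [measurable]: "?D \<in> sets borel" by measurable
      have [measurable]: "(+) x -` \<Omega> \<in> sets borel"
        by (intro borel_open open_vimage \<Omega>(1) continuous_intros)
      have "emeasure lborel {h \<in> B. x + h \<in> \<Omega>} \<le> emeasure lborel ((\<lambda>h. x + h) -` \<Omega> \<inter> space lborel)"
        by (intro emeasure_mono) auto
      also have "\<dots> = emeasure (distr lborel borel ((+) x)) \<Omega>" by (simp add: emeasure_distr)
      also have "\<dots> = emeasure lborel \<Omega>" by (simp add: lborel_distr_plus)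
      finally have le: "emeasure lborel {h \<in> B. x + h \<in> \<Omega>} \<le> emeasure lborel \<Omega>" .
      have "emeasure lborel \<Omega> + 1 \<le> emeasure lborel B" using n by (simp add: B_def)
      also have "B = {h \<in> B. x + h \<in> \<Omega>} \<union> ?D" by auto
      also have "emeasure lborel \<dots> = emeasure lborel {h \<in> B. x + h \<in> \<Omega>} + emeasure lborel ?D"
        by (rule plus_emeasure[symmetric]) auto
      also have "\<dots> \<le> emeasure lborel \<Omega> + emeasure lborel ?D" using le by (rule add_right_mono)
      finally have D1: "1 \<le> emeasure lborel ?D" using fin by (auto simp: ennreal_add_left_cancel_le)
      have "ennreal (\<bar>\<phi> x\<bar> powr p) * 1 \<le> ennreal (\<bar>\<phi> x\<bar> powr p) * emeasure lborel ?D"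
        using D1 by (intro mult_left_mono) auto
      also have "\<dots> = (\<integral>\<^sup>+h. ennreal (\<bar>\<phi> x\<bar> powr p) * indicator ?D h \<partial>lborel)"
        by (simp add: nn_integral_cmult)
      also have "\<dots> \<le> (\<integral>\<^sup>+h. ennreal (\<bar>\<phi> (x + h) - \<phi> x\<bar> powr p) * indicator B h \<partial>lborel)"
      proof (rule nn_integral_mono)
        fix h
        have "\<phi> (x + h) = 0" if "x + h \<notin> \<Omega>" using that by (rule K(1))
        then show "ennreal (\<bar>\<phi> x\<bar> powr p) * indicator ?D h \<le> ennreal (\<bar>\<phi> (x + h) - \<phi> x\<bar> powr p) * indicator B h"
          by (auto simp: indicator_def)
      qed
      finally show ?thesis by simp
    qed
    have "(\<integral>\<^sup>+x. ennreal (\<bar>\<phi> x\<bar> powr p) \<partial>lborel)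
        \<le> (\<integral>\<^sup>+x. (\<integral>\<^sup>+h. ennreal (\<bar>\<phi> (x + h) - \<phi> x\<bar> powr p) * indicator B h \<partial>lborel) \<partial>lborel)"
      by (intro nn_integral_mono pw)
    also have "\<dots> = (\<integral>\<^sup>+h. (\<integral>\<^sup>+x. ennreal (\<bar>\<phi> (x + h) - \<phi> x\<bar> powr p) * indicator B h \<partial>lborel) \<partial>lborel)"
      by (rule lborel_pair.Fubini') measurable
    also have "\<dots> \<le> (\<integral>\<^sup>+h. ennreal (real n powr p) * ?I * indicator B h \<partial>lborel)"
    proof (rule nn_integral_mono)
      fix h :: "real ^ 'N"
      have "(\<integral>\<^sup>+x. ennreal (\<bar>\<phi> (x + h) - \<phi> x\<bar> powr p) * indicator B h \<partial>lborel)
          = (\<integral>\<^sup>+x. ennreal (\<bar>\<phi> (x + h) - \<phi> x\<bar> powr p) \<partial>lborel) * indicator B h"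
        by (simp add: nn_integral_multc)
      also have "\<dots> \<le> (ennreal (norm h powr p) * ?I) * indicator B h"
        by (intro mult_right_mono translation_estimate[OF \<phi> p]) auto
      also have "\<dots> \<le> (ennreal (real n powr p) * ?I) * indicator B h"
        using p by (cases "h \<in> B") (auto intro!: mult_right_mono ennreal_leI powr_mono2 simp: B_def)
      finally show "(\<integral>\<^sup>+x. ennreal (\<bar>\<phi> (x + h) - \<phi> x\<bar> powr p) * indicator B h \<partial>lborel)
          \<le> ennreal (real n powr p) * ?I * indicator B h" .
    qed
    also have "\<dots> = ennreal (real n powr p) * ?I * ennreal m"
      by (simp add: nn_integral_cmult m)
    finally have "ennreal (Lp_norm p \<Omega> \<phi> powr p) \<le> ennreal (real n powr p) * ennreal (Lp_norm p \<Omega> (classical_grad \<phi>) powr p) * ennreal m"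
      using p ennreal_Lp_norm_eq_nn_integral[OF Lp(1) _ K(1) \<Omega>m] ennreal_Lp_norm_eq_nn_integral[OF Lp(2) _ K(2) \<Omega>m]
      by simp
    then have "Lp_norm p \<Omega> \<phi> powr p \<le> (real n powr p * m) * Lp_norm p \<Omega> (classical_grad \<phi>) powr p"
      using m(2) by (simp flip: ennreal_mult add: mult_ac)
    also have "\<dots> = (c * Lp_norm p \<Omega> (classical_grad \<phi>)) powr p"
      using p m(2) by (simp add: c_def powr_mult powr_powr)
    finally show ?thesis
      using p m(2) by (subst Lp_norm_le_iff_integral) (auto simp: c_def Lp_norm_powr)
  qed
  show thesis by (rule that[of c]) (use main in \<open>auto simp: c_def\<close>)
qed

section \<open>The fundamental lemma of the calculus of variations\<close>

text \<open>Products of the factors exp (-1 / ((n + 1) t)), with t the distance of a coordinate to a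
  face of the box: each factor is 0 for t \<le> 0 and tends to 1 for t > 0.\<close>

lemma box_indicator_approximation:
  fixes a b :: "real ^ 'N"
  assumes "cbox a b \<subseteq> \<Omega>"
  obtains \<psi> :: "nat \<Rightarrow> real ^ 'N \<Rightarrow> real"
  where "\<And>n. \<psi> n \<in> test_functions \<Omega>" "\<And>n x. 0 \<le> \<psi> n x" "\<And>n x. \<psi> n x \<le> 1"
    "\<And>n x. x \<notin> cbox a b \<Longrightarrow> \<psi> n x = 0" "\<And>n x. x \<in> box a b \<Longrightarrow> \<psi> n x > 0"
    "\<And>x. (\<lambda>n. \<psi> n x) \<longlonglongrightarrow> indicator (box a b) x"
proof
  define e where "e n t = exp_bump 1 (real (Suc n) * t)" for n t
  define \<psi> where "\<psi> n x = (\<Prod>i\<in>UNIV. e n (x $ i - a $ i) * e n (b $ i - x $ i))" for n x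
  have e: "0 \<le> e n t" "e n t \<le> 1" "t \<le> 0 \<Longrightarrow> e n t = 0" "t > 0 \<Longrightarrow> e n t > 0" for n t
    by (auto simp: e_def exp_bump_1 zero_less_mult_iff mult_less_0_iff)
  have e_lim: "(\<lambda>n. e n t) \<longlonglongrightarrow> indicator {0<..} t" for t
  proof (cases "t > 0")
    case True
    have "(\<lambda>n. exp (- (inverse (real (Suc n)) * (1 / t)))) \<longlonglongrightarrow> exp (- (0 * (1 / t)))"
      by (intro tendsto_intros LIMSEQ_inverse_real_of_nat)
    moreover have "e n t = exp (- (inverse (real (Suc n)) * (1 / t)))" for n
      using True by (simp add: e_def exp_bump_1 zero_less_mult_iff divide_inverse del: of_nat_Suc)
    ultimately show ?thesis using True by simp
  next
    case False
    then show ?thesis using e(3)[of t] by simp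
  qed
  show 0: "\<psi> n x = 0" if x: "x \<notin> cbox a b" for n x
  proof -
    obtain i where "x $ i < a $ i \<or> b $ i < x $ i" using x by (auto simp: mem_box_cart not_le)
    then have "e n (x $ i - a $ i) * e n (b $ i - x $ i) = 0" using e(3) by auto
    then show ?thesis unfolding \<psi>_def by (intro prod_zero) auto
  qed
  show "\<psi> n \<in> test_functions \<Omega>" for n
  proof (rule test_functionsI[OF _ compact_cbox assms 0])
    show "C_k k (\<psi> n)" for k
      unfolding \<psi>_def[abs_def] e_def
      by (intro C_k_prod C_k_mult C_k_exp_bump C_k_diff C_k_const C_k_nth)
  qed
  show "0 \<le> \<psi> n x" for n x
    unfolding \<psi>_def by (intro prod_nonneg mult_nonneg_nonneg ballI e)
  show "\<psi> n x \<le> 1" for n x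
    unfolding \<psi>_def by (intro prod_le_1 conjI mult_nonneg_nonneg mult_le_one e)
  show "\<psi> n x > 0" if "x \<in> box a b" for n x
    unfolding \<psi>_def using that by (intro prod_pos) (auto simp: mem_box_cart intro!: mult_pos_pos e)
  show "(\<lambda>n. \<psi> n x) \<longlonglongrightarrow> indicator (box a b) x" for x
  proof -
    have "(\<lambda>n. \<psi> n x) \<longlonglongrightarrow> (\<Prod>i\<in>UNIV. indicator {0<..} (x $ i - a $ i) * indicator {0<..} (b $ i - x $ i))"
      unfolding \<psi>_def by (intro tendsto_prod tendsto_mult e_lim)
    also have "(\<Prod>i\<in>UNIV. indicator {0<..} (x $ i - a $ i) * indicator {0<..} (b $ i - x $ i)) = (indicator (box a b) x :: real)"
    proof (cases "x \<in> box a b")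
      case True
      then show ?thesis by (auto simp: mem_box_cart intro!: prod.neutral)
    next
      case False
      then obtain i where "\<not> (a $ i < x $ i \<and> x $ i < b $ i)" by (auto simp: mem_box_cart)
      then have "indicator {0<..} (x $ i - a $ i) * indicator {0<..} (b $ i - x $ i) = (0 :: real)" by auto
      with False show ?thesis by (intro prod_zero[THEN trans]) auto
    qed
    finally show ?thesis .
  qed
qed

text \<open>Ensures that the supremum defining \<open>F_deriv_norm\<close> runs over a nonempty
  set.\<close>

lemma nonzero_test_function:
  fixes \<Omega> :: "(real ^ 'N) set"
  assumes "open \<Omega>" "\<Omega> \<noteq> {}"
  obtains \<phi> where "\<phi> \<in> test_functions \<Omega>" "\<not> (AE x in lebesgue_on \<Omega>. \<phi> x = 0)"
proof -
  obtain z where "z \<in> \<Omega>" using assms by auto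
  then obtain a b where ab: "z \<in> box a b" "cbox a b \<subseteq> \<Omega>"
    using open_contains_cbox[OF assms(1), of z] by metis
  obtain \<psi> :: "nat \<Rightarrow> real ^ 'N \<Rightarrow> real" where \<psi>: "\<And>n. \<psi> n \<in> test_functions \<Omega>"
    "\<And>n x. x \<in> box a b \<Longrightarrow> \<psi> n x > 0"
    by (rule box_indicator_approximation[OF ab(2)]) blast
  have \<Omega>: "\<Omega> \<in> sets lebesgue" using assms(1) by auto
  have "\<not> (AE x in lebesgue_on \<Omega>. \<psi> 0 x = 0)"
  proof
    assume "AE x in lebesgue_on \<Omega>. \<psi> 0 x = 0"
    then have "AE x in lebesgue. x \<in> \<Omega> \<longrightarrow> \<psi> 0 x = 0" using \<Omega> by (simp add: AE_restrict_space_iff)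
    then have "AE x in lebesgue. x \<notin> box a b"
    proof eventually_elim
      case (elim x)
      show ?case
      proof
        assume x: "x \<in> box a b"
        then have "x \<in> \<Omega>" using ab(2) box_subset_cbox by blast
        with elim \<psi>(2)[OF x, of 0] show False by simp
      qed
    qed
    then have "box a b \<in> null_sets lebesgue" by (subst AE_iff_null_sets) auto
    then have "negligible (box a b)" by (simp add: negligible_iff_null_sets)
    then show False using open_not_negligible[of "box a b"] ab(1) by auto
  qed
  with \<psi>(1) that show thesis by blast
qed

text \<open>Open boxes are an intersection-stable generator of the Borel sets, so vanishing
  integrals extend to all Borel sets; \<open>total\<close> handles complements. A function with zero
  integral over every Borel set is zero almost everywhere.\<close>

lemma integral_zero_on_boxes_imp_AE_zero:
  fixes g :: "'a::euclidean_space \<Rightarrow> real"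
  assumes g: "integrable lebesgue g"
    and 0: "\<And>a b. (LINT x|lebesgue. g x * indicator (box a b) x) = 0"
    and total: "(LINT x|lebesgue. g x) = 0"
  shows "AE x in lebesgue. g x = 0"
proof -
  note [measurable] = borel_measurable_integrable[OF g]
  \<comment> \<open>Boxes generate only the Borel sets, so g is replaced by a Borel
    representative.\<close>
  obtain g' where g' [measurable]: "g' \<in> borel_measurable lborel" and eq: "AE x in lborel. g x = g' x"
    using completion_ex_borel_measurable_real[of g lborel] by auto
  have eq': "AE x in lebesgue. g x = g' x" using eq by (rule AE_completion)
  have gl: "g' \<in> borel_measurable lebesgue" using g' by (rule measurable_completion)
  have "integrable lebesgue g'" using g eq' gl by (subst integrable_cong_AE[symmetric, of g]) auto
  then have I: "integrable lborel g'" by (simp add: integrable_completion)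
  have trans: "(LINT x:A|lborel. g' x) = (LINT x|lebesgue. g x * indicator A x)" if [measurable]: "A \<in> sets lborel" for A
  proof -
    have "(LINT x|lborel. g' x * indicator A x) = (LINT x|lebesgue. g' x * indicator A x)"
      by (rule integral_completion[symmetric]) measurable
    also have "\<dots> = (LINT x|lebesgue. g x * indicator A x)"
    proof (rule integral_cong_AE)
      note [measurable] = gl
      have [measurable]: "A \<in> sets lebesgue" using that by auto
      show "(\<lambda>x. g' x * indicator A x) \<in> borel_measurable lebesgue" by measurable
      show "(\<lambda>x. g x * indicator A x) \<in> borel_measurable lebesgue" by measurable
      show "AE x in lebesgue. g' x * indicator A x = g x * indicator A x"
        using eq' by eventually_elim simp
    qed
    finally show ?thesis by (simp add: set_lebesgue_integral_def mult.commute)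
  qed
  have SI: "set_integrable lborel A g'" if "A \<in> sets lborel" for A
    using I that unfolding set_integrable_def by (rule integrable_mult_indicator[rotated])
  have UN: "(LINT x:UNIV|lborel. g' x) = 0" using trans[of UNIV] total by simp
  have "(LINT x:A|lborel. g' x) = 0" if "A \<in> sets lborel" for A
  proof -
    let ?E = "range (\<lambda>(a, b). box a b :: 'a set)"
    have sets: "sets lborel = sigma_sets UNIV ?E"
      by (simp add: borel_eq_box)
    have "Int_stable ?E" by (auto simp: Int_stable_def box_Int_box)
    moreover have "?E \<subseteq> Pow UNIV" by simp
    moreover have "A \<in> sigma_sets UNIV ?E" using that sets by simp
    ultimately show ?thesis
    proof (induction rule: sigma_sets_induct_disjoint)
      case (basic A)
      then show ?case using trans 0 by auto
    next
      case empty
      then show ?case by (simp add: set_lebesgue_integral_def)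
    next
      case (compl A)
      then have A: "A \<in> sets lborel" using sets by simp
      have "(LINT x:UNIV|lborel. g' x) = (LINT x:(UNIV - A) \<union> A|lborel. g' x)" by simp
      also have "\<dots> = (LINT x:(UNIV - A)|lborel. g' x) + (LINT x:A|lborel. g' x)"
        using A by (intro set_integral_Un SI) auto
      finally show ?case using compl UN by simp
    next
      case (union A)
      then have A: "A i \<in> sets lborel" for i using sets by auto
      have "(LINT x:(\<Union>i. A i)|lborel. g' x) = (\<Sum>i. (LINT x:(A i)|lborel. g' x))"
        using union(1) A by (intro lebesgue_integral_countable_add SI) (auto simp: disjoint_family_on_def)
      then show ?case using union by simp
    qed
  qed
  then have "AE x in lborel. g' x = 0" by (rule sigma_finite_measure.density_zero[OF sigma_finite_lborel I])
  with eq have "AE x in lborel. g x = 0" by eventually_elim simp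
  then show ?thesis by (rule AE_completion)
qed

lemma locally_integrable_if:
  fixes g :: "real ^ 'N \<Rightarrow> 'b::euclidean_space"
  assumes "locally_integrable \<Omega> g" "compact K" "K \<subseteq> \<Omega>"
  shows "integrable lebesgue (\<lambda>x. if x \<in> K then g x else 0)"
  using assms Lebesgue_Measure.integrable_restrict_UNIV[of K g]
  by (auto simp: locally_integrable_def lmeasurable_compact fmeasurableD)

lemma LINT_lebesgue_on_compact_support:
  fixes g :: "real ^ 'N \<Rightarrow> real" and \<psi> :: "real ^ 'N \<Rightarrow> real"
  assumes \<Omega>: "\<Omega> \<in> sets lebesgue" and "K \<subseteq> \<Omega>" "\<And>x. x \<notin> K \<Longrightarrow> \<psi> x = 0"
  shows "(LINT x|lebesgue_on \<Omega>. g x * \<psi> x) = (LINT x|lebesgue. (if x \<in> K then g x else 0) * \<psi> x)"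
    and "integrable (lebesgue_on \<Omega>) (\<lambda>x. g x * \<psi> x) \<longleftrightarrow> integrable lebesgue (\<lambda>x. (if x \<in> K then g x else 0) * \<psi> x)"
proof -
  have *: "(\<lambda>x. if x \<in> \<Omega> then g x * \<psi> x else 0) = (\<lambda>x. (if x \<in> K then g x else 0) * \<psi> x)"
    using assms(2,3) by (auto simp: fun_eq_iff)
  show "(LINT x|lebesgue_on \<Omega>. g x * \<psi> x) = (LINT x|lebesgue. (if x \<in> K then g x else 0) * \<psi> x)"
    using Lebesgue_Measure.integral_restrict_UNIV[OF \<Omega>, of "\<lambda>x. g x * \<psi> x"] by (simp add: *)
  show "integrable (lebesgue_on \<Omega>) (\<lambda>x. g x * \<psi> x) \<longleftrightarrow> integrable lebesgue (\<lambda>x. (if x \<in> K then g x else 0) * \<psi> x)"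
    using Lebesgue_Measure.integrable_restrict_UNIV[OF \<Omega>, of "\<lambda>x. g x * \<psi> x"] by (simp add: *)
qed

lemma locally_integrable_times_test_function:
  fixes g :: "real ^ 'N \<Rightarrow> real"
  assumes g: "locally_integrable \<Omega> g" and \<phi>: "\<phi> \<in> test_functions \<Omega>" and \<Omega>: "\<Omega> \<in> sets lebesgue"
  shows "integrable (lebesgue_on \<Omega>) (\<lambda>x. g x * \<phi> x)"
proof -
  obtain K where K: "compact K" "K \<subseteq> \<Omega>" "\<And>x. x \<notin> K \<Longrightarrow> \<phi> x = 0"
    using \<phi> by (elim test_functionsE) blast
  obtain B where B: "B > 0" "\<And>x. norm (\<phi> x) \<le> B"
    using continuous_compact_support_bounded[OF continuous_test_functions(1)[OF \<phi>] K(1,3)] by blast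
  let ?g = "\<lambda>x. if x \<in> K then g x else 0"
  have I: "integrable lebesgue ?g" by (rule locally_integrable_if[OF g K(1,2)])
  have "\<phi> \<in> borel_measurable lebesgue"
    using borel_measurable_test_functions(1)[OF \<phi>] by (simp add: measurable_completion)
  then have "integrable lebesgue (\<lambda>x. ?g x * \<phi> x)"
    using B by (intro Bochner_Integration.integrable_bound[OF integrable_mult_right[OF I, of B]]
        borel_measurable_times borel_measurable_integrable[OF I])
      (auto simp: abs_mult mult.commute intro!: AE_I2 mult_mono)
  then show ?thesis using LINT_lebesgue_on_compact_support(2)[OF \<Omega> K(2), of \<phi> g] K(3) by blast
qed

text \<open>Smooth approximations of box indicators show that g integrates to 0 over every open box
  whose closed box lies in \<Omega>. On such a closed box this gives g = 0 almost everywhere, its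
  boundary being negligible, and \<Omega> is a countable union of closed boxes.\<close>

lemma fundamental_lemma_calculus_of_variations:
  fixes g :: "real ^ 'N \<Rightarrow> real"
  assumes \<Omega>: "open \<Omega>" and g: "locally_integrable \<Omega> g"
    and 0: "\<And>\<phi>. \<phi> \<in> test_functions \<Omega> \<Longrightarrow> (LINT x|lebesgue_on \<Omega>. g x * \<phi> x) = 0"
  shows "AE x in lebesgue_on \<Omega>. g x = 0"
proof -
  have \<Omega>m: "\<Omega> \<in> sets lebesgue" using \<Omega> by auto
  have box0: "(LINT x|lebesgue. (if x \<in> cbox a b then g x else 0) * indicator (box a b) x) = 0"
    if ab: "cbox a b \<subseteq> \<Omega>" for a b
  proof -
    let ?g = "\<lambda>x. if x \<in> cbox a b then g x else 0"
    have I: "integrable lebesgue ?g" by (rule locally_integrable_if[OF g compact_cbox ab])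
    note [measurable] = borel_measurable_integrable[OF I]
    obtain \<psi> :: "nat \<Rightarrow> real ^ 'N \<Rightarrow> real" where \<psi>: "\<And>n. \<psi> n \<in> test_functions \<Omega>"
      "\<And>n x. 0 \<le> \<psi> n x" "\<And>n x. \<psi> n x \<le> 1" "\<And>n x. x \<notin> cbox a b \<Longrightarrow> \<psi> n x = 0"
      "\<And>x. (\<lambda>n. \<psi> n x) \<longlonglongrightarrow> indicator (box a b) x"
      by (rule box_indicator_approximation[OF ab]) blast
    have [measurable]: "\<psi> n \<in> borel_measurable lebesgue" for n
      using borel_measurable_test_functions(1)[OF \<psi>(1)] by (simp add: measurable_completion)
    have "(\<lambda>n. LINT x|lebesgue. ?g x * \<psi> n x) \<longlonglongrightarrow> (LINT x|lebesgue. ?g x * indicator (box a b) x)"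
    proof (rule integral_dominated_convergence[where w = "\<lambda>x. \<bar>?g x\<bar>"])
      show "AE x in lebesgue. (\<lambda>n. ?g x * \<psi> n x) \<longlonglongrightarrow> ?g x * indicator (box a b) x"
        by (intro AE_I2 tendsto_intros \<psi>(5))
      show "AE x in lebesgue. norm (?g x * \<psi> n x) \<le> \<bar>?g x\<bar>" for n
        using \<psi>(2,3) by (intro AE_I2) (simp add: abs_mult mult_left_le)
      have [measurable]: "box a b \<in> sets lebesgue" by simp
      show "(\<lambda>x. ?g x * indicator (box a b) x) \<in> borel_measurable lebesgue" by measurable
    qed (use I in auto)
    moreover have "(LINT x|lebesgue. ?g x * \<psi> n x) = 0" for n
      using LINT_lebesgue_on_compact_support(1)[OF \<Omega>m ab, of "\<psi> n" g] \<psi>(4) 0[OF \<psi>(1)] by simp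
    ultimately show ?thesis by (simp add: LIMSEQ_const_iff)
  qed
  have cbox0: "AE x in lebesgue. x \<in> cbox c d \<longrightarrow> g x = 0" if cd: "cbox c d \<subseteq> \<Omega>" for c d
  proof -
    let ?g = "\<lambda>x. (if x \<in> cbox c d then g x else 0) * indicator (box c d) x"
    have "AE x in lebesgue. ?g x = 0"
    proof (rule integral_zero_on_boxes_imp_AE_zero)
      show "integrable lebesgue ?g"
        using locally_integrable_if[OF g compact_cbox cd] by (intro integrable_real_mult_indicator) auto
      show "(LINT x|lebesgue. ?g x) = 0" by (rule box0[OF cd])
      show "(LINT x|lebesgue. ?g x * indicator (box a b) x) = 0" for a b
      proof -
        obtain a' b' where ab': "box c d \<inter> box a b = box a' b'" by (auto simp: box_Int_box)
        show ?thesis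
        \<comment> \<open>Only for a nonempty open box is the closed box its closure, hence
          contained in \<open>cbox c d\<close>, so that \<open>box0\<close> applies.\<close>
        proof (cases "box a' b' = {}")
          case True
          then have "(\<lambda>x. ?g x * indicator (box a b) x) = (\<lambda>x. 0)"
            using ab' by (auto simp: fun_eq_iff indicator_def)
          then show ?thesis by simp
        next
          case False
          have sub: "cbox a' b' \<subseteq> cbox c d"
            using ab' closure_mono[of "box a' b'" "box c d"] closure_box[OF False] closure_box[of c d] False
            by (cases "box c d = {}") auto
          have "(\<lambda>x. ?g x * indicator (box a b) x) = (\<lambda>x. (if x \<in> cbox a' b' then g x else 0) * indicator (box a' b') x)"
            using sub box_subset_cbox[of a' b'] unfolding ab'[symmetric]
            by (auto simp: fun_eq_iff indicator_def)
          then show ?thesis using box0[of a' b'] sub cd by auto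
        qed
      qed
    qed
    moreover have "AE x in lebesgue. x \<notin> cbox c d - box c d"
      by (rule AE_not_in) (use negligible_frontier_interval[of c d] in \<open>simp only: negligible_iff_null_sets\<close>)
    ultimately show ?thesis by eventually_elim (auto simp: indicator_def split: if_splits)
  qed
  obtain D where D: "countable D" "D \<subseteq> Pow \<Omega>" "\<And>X. X \<in> D \<Longrightarrow> \<exists>a b. X = cbox a b" "\<Union>D = \<Omega>"
    using open_countable_Union_open_cbox[OF \<Omega>] by metis
  have "AE x in lebesgue. \<forall>X\<in>D. x \<in> X \<longrightarrow> g x = 0"
    using D cbox0 by (subst AE_ball_countable) (auto, blast)
  then have "AE x in lebesgue. x \<in> \<Omega> \<longrightarrow> g x = 0"
    by eventually_elim (use D(4) in auto)
  then show ?thesis using \<Omega>m by (simp add: AE_restrict_space_iff)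
qed

section \<open>Weak derivatives and zero boundary values\<close>

text \<open>Holds because Lebesgue measure is complete.\<close>

lemma lebesgue_on_measurable_AE_cong:
  fixes f g :: "real ^ 'N \<Rightarrow> 'b::euclidean_space"
  assumes f: "f \<in> borel_measurable (lebesgue_on \<Omega>)" and eq: "AE x in lebesgue_on \<Omega>. f x = g x"
    and \<Omega>: "\<Omega> \<in> sets lebesgue"
  shows "g \<in> borel_measurable (lebesgue_on \<Omega>)"
proof -
  have "AE x in lebesgue. (if x \<in> \<Omega> then f x else 0) = (if x \<in> \<Omega> then g x else 0)"
    using eq \<Omega> by (simp add: AE_restrict_space_iff)
  moreover have "(\<lambda>x. if x \<in> \<Omega> then f x else 0) \<in> borel_measurable lebesgue"
    by (rule borel_measurable_if_I[OF f \<Omega>])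
  ultimately have "(\<lambda>x. if x \<in> \<Omega> then g x else 0) \<in> borel_measurable lebesgue"
    by (rule borel_measurable_AE[rotated])
  then show ?thesis by (rule borel_measurable_if_D)
qed

text \<open>Needed because \<open>weak_grad\<close> and \<open>weak_div\<close> are arbitrary
  choices: that they lie in the Lebesgue space is inherited from some representative that
  does.\<close>

lemma Lp_space_AE_cong:
  fixes f g :: "real ^ 'N \<Rightarrow> 'b::euclidean_space"
  assumes f: "f \<in> Lp_space q \<Omega>" and eq: "AE x in lebesgue_on \<Omega>. f x = g x"
    and \<Omega>: "\<Omega> \<in> sets lebesgue" and q: "q > 0"
  shows "g \<in> Lp_space q \<Omega>"
proof (rule Lp_space_dominated(1)[OF f _ _ q])
  show "g \<in> borel_measurable (lebesgue_on \<Omega>)"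
    by (rule lebesgue_on_measurable_AE_cong[OF Lp_spaceD(1)[OF f] eq \<Omega>])
  show "AE x in lebesgue_on \<Omega>. norm (g x) \<le> norm (f x)" using eq by eventually_elim simp
qed

lemma locally_integrable_nth:
  "locally_integrable \<Omega> G \<Longrightarrow> locally_integrable \<Omega> (\<lambda>x. G x $ j)"
  for G :: "real ^ 'N \<Rightarrow> real ^ 'n"
  unfolding locally_integrable_def
  by (auto intro: integrable_bounded_linear[OF bounded_linear_vec_nth])

lemma locally_integrable_diff:
  "locally_integrable \<Omega> f \<Longrightarrow> locally_integrable \<Omega> g \<Longrightarrow> locally_integrable \<Omega> (\<lambda>x. f x - g x)"
  by (auto simp: locally_integrable_def)

text \<open>The form of the fundamental lemma from which uniqueness of weak gradients and of weak
  divergences both follow.\<close>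

lemma locally_integrable_eq_AE:
  fixes f g :: "real ^ 'N \<Rightarrow> real"
  assumes \<Omega>: "open \<Omega>" and f: "locally_integrable \<Omega> f" and g: "locally_integrable \<Omega> g"
    and eq: "\<And>\<phi>. \<phi> \<in> test_functions \<Omega> \<Longrightarrow> (LINT x|lebesgue_on \<Omega>. f x * \<phi> x) = (LINT x|lebesgue_on \<Omega>. g x * \<phi> x)"
  shows "AE x in lebesgue_on \<Omega>. f x = g x"
proof -
  have \<Omega>m: "\<Omega> \<in> sets lebesgue" using \<Omega> by auto
  have "AE x in lebesgue_on \<Omega>. f x - g x = 0"
  proof (rule fundamental_lemma_calculus_of_variations[OF \<Omega> locally_integrable_diff[OF f g]])
    fix \<phi> assume \<phi>: "\<phi> \<in> test_functions \<Omega>"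
    show "(LINT x|lebesgue_on \<Omega>. (f x - g x) * \<phi> x) = 0"
      using eq[OF \<phi>] locally_integrable_times_test_function[OF f \<phi> \<Omega>m]
        locally_integrable_times_test_function[OF g \<phi> \<Omega>m]
      by (simp add: left_diff_distrib)
  qed
  then show ?thesis by eventually_elim simp
qed

lemma has_weak_grad_unique:
  assumes \<Omega>: "open \<Omega>" and G: "has_weak_grad \<Omega> w G" and G': "has_weak_grad \<Omega> w G'"
  shows "AE x in lebesgue_on \<Omega>. G x = G' x"
proof -
  have "AE x in lebesgue_on \<Omega>. G x $ j = G' x $ j" for j
  proof (rule locally_integrable_eq_AE[OF \<Omega>])
    fix \<phi> assume \<phi>: "\<phi> \<in> test_functions \<Omega>"
    have "(LINT x|lebesgue_on \<Omega>. w x * partial j \<phi> x) = - (LINT x|lebesgue_on \<Omega>. G x $ j * \<phi> x)"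
      using G \<phi> unfolding has_weak_grad_def by blast
    moreover have "(LINT x|lebesgue_on \<Omega>. w x * partial j \<phi> x) = - (LINT x|lebesgue_on \<Omega>. G' x $ j * \<phi> x)"
      using G' \<phi> unfolding has_weak_grad_def by blast
    ultimately show "(LINT x|lebesgue_on \<Omega>. G x $ j * \<phi> x) = (LINT x|lebesgue_on \<Omega>. G' x $ j * \<phi> x)"
      by linarith
  qed (use G G' in \<open>auto simp: has_weak_grad_def intro: locally_integrable_nth\<close>)
  then have "AE x in lebesgue_on \<Omega>. \<forall>j. G x $ j = G' x $ j" by (rule eventually_all_finite)
  then show ?thesis by eventually_elim (simp add: vec_eq_iff)
qed

lemma has_weak_div_unique:
  assumes \<Omega>: "open \<Omega>" and d: "has_weak_div \<Omega> g d" and d': "has_weak_div \<Omega> g d'"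
  shows "AE x in lebesgue_on \<Omega>. d x = d' x"
proof (rule locally_integrable_eq_AE[OF \<Omega>])
  fix \<phi> assume \<phi>: "\<phi> \<in> test_functions \<Omega>"
  have "(LINT x|lebesgue_on \<Omega>. g x \<bullet> classical_grad \<phi> x) = - (LINT x|lebesgue_on \<Omega>. d x * \<phi> x)"
    using d \<phi> unfolding has_weak_div_def by blast
  moreover have "(LINT x|lebesgue_on \<Omega>. g x \<bullet> classical_grad \<phi> x) = - (LINT x|lebesgue_on \<Omega>. d' x * \<phi> x)"
    using d' \<phi> unfolding has_weak_div_def by blast
  ultimately show "(LINT x|lebesgue_on \<Omega>. d x * \<phi> x) = (LINT x|lebesgue_on \<Omega>. d' x * \<phi> x)"
    by linarith
qed (use d d' in \<open>auto simp: has_weak_div_def\<close>)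

lemma weak_grad_eq_AE:
  assumes \<Omega>: "open \<Omega>" and G: "has_weak_grad \<Omega> w G"
  shows "AE x in lebesgue_on \<Omega>. G x = weak_grad \<Omega> w x"
  using has_weak_grad_unique[OF \<Omega> G] someI[of "has_weak_grad \<Omega> w", OF G]
  by (simp add: weak_grad_def)

lemma weak_div_eq_AE:
  assumes \<Omega>: "open \<Omega>" and d: "has_weak_div \<Omega> g d"
  shows "AE x in lebesgue_on \<Omega>. d x = weak_div \<Omega> g x"
  using has_weak_div_unique[OF \<Omega> d] someI[of "has_weak_div \<Omega> g", OF d]
  by (simp add: weak_div_def)

text \<open>t \<le> 1 + t powr q for t \<ge> 0, and constants are integrable over a set of finite
  measure.\<close>

lemma Lp_space_integrable:
  fixes f :: "real ^ 'N \<Rightarrow> 'b::euclidean_space"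
  assumes f: "f \<in> Lp_space q \<Omega>" and \<Omega>: "\<Omega> \<in> sets lebesgue" "emeasure lebesgue \<Omega> < \<infinity>" and q: "q \<ge> 1"
  shows "integrable (lebesgue_on \<Omega>) f"
proof (rule Bochner_Integration.integrable_bound[of _ "\<lambda>x. 1 + norm (f x) powr q"])
  have "finite_measure (lebesgue_on \<Omega>)"
    using \<Omega> by (intro finite_measureI) (auto simp: emeasure_restrict_space)
  then show "integrable (lebesgue_on \<Omega>) (\<lambda>x. 1 + norm (f x) powr q)"
    using Lp_spaceD(2)[OF f] by (auto intro: finite_measure.integrable_const)
  have "t \<le> 1 + t powr q" if "t \<ge> 0" for t :: real
  proof (cases "t \<le> 1")
    case True
    then show ?thesis by (simp add: add_increasing2)
  next
    case False
    then have "t powr 1 \<le> t powr q" using q by (intro powr_mono) auto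
    then show ?thesis using False by simp
  qed
  then show "AE x in lebesgue_on \<Omega>. norm (f x) \<le> norm (1 + norm (f x) powr q)"
    by (intro AE_I2 order_trans[OF _ abs_ge_self[folded real_norm_def]]) auto
qed (use Lp_spaceD(1)[OF f] in auto)

lemma Lp_space_locally_integrable:
  fixes f :: "real ^ 'N \<Rightarrow> 'b::euclidean_space"
  assumes f: "f \<in> Lp_space q \<Omega>" and \<Omega>: "\<Omega> \<in> sets lebesgue" "emeasure lebesgue \<Omega> < \<infinity>" and q: "q \<ge> 1"
  shows "locally_integrable \<Omega> f"
  unfolding locally_integrable_def
proof safe
  fix K assume K: "compact K" "K \<subseteq> \<Omega>"
  then have [measurable]: "K \<in> sets lebesgue" by (simp add: fmeasurableD lmeasurable_compact)
  have "integrable lebesgue (\<lambda>x. if x \<in> \<Omega> then f x else 0)"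
    using Lp_space_integrable[OF assms] Lebesgue_Measure.integrable_restrict_UNIV[OF \<Omega>(1)] by blast
  then have "integrable lebesgue (\<lambda>x. indicator K x *\<^sub>R (if x \<in> \<Omega> then f x else 0))"
    by (rule integrable_mult_indicator[rotated]) simp
  moreover have "(\<lambda>x. indicator K x *\<^sub>R (if x \<in> \<Omega> then f x else 0)) = (\<lambda>x. if x \<in> K then f x else 0)"
    using K(2) by (auto simp: fun_eq_iff indicator_def)
  ultimately show "integrable (lebesgue_on K) f"
    using Lebesgue_Measure.integrable_restrict_UNIV[of K f] by simp
qed

section \<open>The space \<open>W0\<close> as a closure\<close>

text \<open>Integration by parts for the approximating test functions passes to the limit, so the
  limit G of the gradients is automatically a weak gradient of w. Membership in \<open>W0\<close>
  thus needs no prior knowledge of weak differentiability.\<close>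

lemma W0I:
  assumes \<Omega>: "open \<Omega>" "emeasure lebesgue \<Omega> < \<infinity>" and p: "p > 1"
    and w: "w \<in> Lp_space p \<Omega>" and G: "G \<in> Lp_space p \<Omega>"
    and \<phi>: "\<And>k. \<phi> k \<in> test_functions \<Omega>"
    and lim: "(\<lambda>k. Lp_norm p \<Omega> (\<lambda>x. \<phi> k x - w x)) \<longlonglongrightarrow> 0"
      "(\<lambda>k. Lp_norm p \<Omega> (\<lambda>x. classical_grad (\<phi> k) x - G x)) \<longlonglongrightarrow> 0"
  shows "w \<in> W0 p \<Omega>" and "AE x in lebesgue_on \<Omega>. G x = weak_grad \<Omega> w x"
proof -
  have \<Omega>m: "\<Omega> \<in> sets lebesgue" using \<Omega>(1) by auto
  define q where "q = p / (p - 1)"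
  have pq: "p > 1" "q > 1" "1 / p + 1 / q = 1" using p by (auto simp: q_def field_simps)
  have p0: "p > 0" using p by simp
  note \<phi>Lp = test_functions_Lp_space[OF \<phi> \<Omega>m p0]
  have "has_weak_grad \<Omega> w G"
    unfolding has_weak_grad_def
  proof (intro conjI ballI allI)
    show "locally_integrable \<Omega> w" "locally_integrable \<Omega> G"
      using p by (auto intro: Lp_space_locally_integrable[OF w \<Omega>m \<Omega>(2)] Lp_space_locally_integrable[OF G \<Omega>m \<Omega>(2)])
    fix \<psi> j assume \<psi>: "\<psi> \<in> test_functions \<Omega>"
    have \<psi>0: "\<psi> x = 0" "partial j \<psi> x = 0" if "x \<notin> \<Omega>" for x
      using \<psi> that by (elim test_functionsE; blast)+
    \<comment> \<open>Pairing with this vector field picks out the j-th component of a gradient, so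
      the limit lemma for pairings applies.\<close>
    let ?e = "\<lambda>x. \<psi> x *\<^sub>R (axis j 1 :: real ^ 'a)"
    have e: "?e \<in> Lp_space q \<Omega>"
    proof (rule Lp_space_dominated(1)[OF test_functions_Lp_space(1)[OF \<psi> \<Omega>m, of q]])
      show "?e \<in> borel_measurable (lebesgue_on \<Omega>)"
        by (intro borel_measurable_lebesgue_on borel_measurable_scaleR borel_measurable_const
            borel_measurable_test_functions(1)[OF \<psi>])
    qed (use pq in auto)
    have "(\<lambda>k. LINT x|lebesgue_on \<Omega>. \<phi> k x \<bullet> partial j \<psi> x) \<longlonglongrightarrow> (LINT x|lebesgue_on \<Omega>. w x \<bullet> partial j \<psi> x)"
      using pq test_functions_Lp_space(1)[OF test_functions_partial[OF \<psi>] \<Omega>m, of q] \<phi>Lp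
      by (intro Lp_pairing_tendsto[OF pq _ w _ lim(1)]) auto
    moreover have "(\<lambda>k. LINT x|lebesgue_on \<Omega>. classical_grad (\<phi> k) x \<bullet> ?e x) \<longlonglongrightarrow> (LINT x|lebesgue_on \<Omega>. G x \<bullet> ?e x)"
      using pq \<phi>Lp by (intro Lp_pairing_tendsto[OF pq _ G e lim(2)]) auto
    moreover have "(LINT x|lebesgue_on \<Omega>. \<phi> k x \<bullet> partial j \<psi> x) = - (LINT x|lebesgue_on \<Omega>. classical_grad (\<phi> k) x \<bullet> ?e x)" for k
    proof -
      note [measurable] = borel_measurable_test_functions(1)[OF \<phi>] borel_measurable_test_functions(1)[OF \<psi>]
        borel_measurable_test_functions(1)[OF test_functions_partial[OF \<phi>]]
        borel_measurable_test_functions(1)[OF test_functions_partial[OF \<psi>]]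
      have "(LINT x|lebesgue_on \<Omega>. \<phi> k x * partial j \<psi> x) = (LINT x|lborel. \<phi> k x * partial j \<psi> x)"
        using \<psi>0 by (intro LINT_lebesgue_on_eq_lborel(1)[OF \<Omega>m]) auto
      also have "\<dots> = - (LINT x|lborel. partial j (\<phi> k) x * \<psi> x)"
        by (rule integration_by_parts_test_functions[OF \<phi> \<psi>])
      also have "(LINT x|lborel. partial j (\<phi> k) x * \<psi> x) = (LINT x|lebesgue_on \<Omega>. partial j (\<phi> k) x * \<psi> x)"
        using \<psi>0 by (intro LINT_lebesgue_on_eq_lborel(1)[OF \<Omega>m, symmetric]) auto
      finally show ?thesis by (simp add: inner_axis classical_grad_def mult.commute)
    qed
    ultimately have "(\<lambda>k. - (LINT x|lebesgue_on \<Omega>. classical_grad (\<phi> k) x \<bullet> ?e x)) \<longlonglongrightarrow> (LINT x|lebesgue_on \<Omega>. w x \<bullet> partial j \<psi> x)"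
      and "(\<lambda>k. - (LINT x|lebesgue_on \<Omega>. classical_grad (\<phi> k) x \<bullet> ?e x)) \<longlonglongrightarrow> - (LINT x|lebesgue_on \<Omega>. G x \<bullet> ?e x)"
      by (auto intro: tendsto_minus)
    then have "(LINT x|lebesgue_on \<Omega>. w x \<bullet> partial j \<psi> x) = - (LINT x|lebesgue_on \<Omega>. G x \<bullet> ?e x)"
      by (rule LIMSEQ_unique)
    then show "(LINT x|lebesgue_on \<Omega>. w x * partial j \<psi> x) = - (LINT x|lebesgue_on \<Omega>. G x $ j * \<psi> x)"
      by (simp add: inner_axis mult.commute)
  qed
  then show eq: "AE x in lebesgue_on \<Omega>. G x = weak_grad \<Omega> w x"
    using weak_grad_eq_AE[OF \<Omega>(1)] by blast
  have wg: "weak_grad \<Omega> w \<in> Lp_space p \<Omega>"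
    using Lp_space_AE_cong[OF G eq \<Omega>m] p by simp
  have "Lp_norm p \<Omega> (\<lambda>x. classical_grad (\<phi> k) x - weak_grad \<Omega> w x) = Lp_norm p \<Omega> (\<lambda>x. classical_grad (\<phi> k) x - G x)" for k
  proof (rule Lp_norm_cong_AE)
    show "AE x in lebesgue_on \<Omega>. classical_grad (\<phi> k) x - weak_grad \<Omega> w x = classical_grad (\<phi> k) x - G x"
      using eq by eventually_elim simp
  qed (intro borel_measurable_diff Lp_spaceD(1)[OF \<phi>Lp(2)] Lp_spaceD(1)[OF G] Lp_spaceD(1)[OF wg])+
  with lim(2) have "(\<lambda>k. Lp_norm p \<Omega> (\<lambda>x. classical_grad (\<phi> k) x - weak_grad \<Omega> w x)) \<longlonglongrightarrow> 0" by simp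
  then show "w \<in> W0 p \<Omega>"
    using w G \<open>has_weak_grad \<Omega> w G\<close> \<phi> lim(1) unfolding W0_def W1p_def by blast
qed

lemma W0_Lp_space: "w \<in> W0 p \<Omega> \<Longrightarrow> w \<in> Lp_space p \<Omega>"
  by (auto simp: W0_def W1p_def)

lemma W0_weak_grad_Lp_space:
  assumes "open \<Omega>" "w \<in> W0 p \<Omega>" "p > 1"
  shows "weak_grad \<Omega> w \<in> Lp_space p \<Omega>"
proof -
  obtain G where G: "G \<in> Lp_space p \<Omega>" "has_weak_grad \<Omega> w G"
    using assms(2) by (auto simp: W0_def W1p_def)
  show ?thesis
    by (rule Lp_space_AE_cong[OF G(1) weak_grad_eq_AE[OF assms(1) G(2)]]) (use assms in auto)
qed

lemma W0_approximation:
  assumes "w \<in> W0 p \<Omega>"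
  obtains \<phi> where "\<And>k. \<phi> k \<in> test_functions \<Omega>"
    "(\<lambda>k. Lp_norm p \<Omega> (\<lambda>x. \<phi> k x - w x)) \<longlonglongrightarrow> 0"
    "(\<lambda>k. Lp_norm p \<Omega> (\<lambda>x. classical_grad (\<phi> k) x - weak_grad \<Omega> w x)) \<longlonglongrightarrow> 0"
  using assms by (auto simp: W0_def)

lemma test_functions_W0:
  assumes \<Omega>: "open \<Omega>" "emeasure lebesgue \<Omega> < \<infinity>" and p: "p > 1" and \<phi>: "\<phi> \<in> test_functions \<Omega>"
  shows "\<phi> \<in> W0 p \<Omega>" and "AE x in lebesgue_on \<Omega>. classical_grad \<phi> x = weak_grad \<Omega> \<phi> x"
proof -
  have \<Omega>m: "\<Omega> \<in> sets lebesgue" using \<Omega>(1) by auto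
  note Lp = test_functions_Lp_space[OF \<phi> \<Omega>m, of p]
  show "\<phi> \<in> W0 p \<Omega>" "AE x in lebesgue_on \<Omega>. classical_grad \<phi> x = weak_grad \<Omega> \<phi> x"
    using p Lp \<phi> W0I[OF \<Omega> p, of \<phi> "classical_grad \<phi>" "\<lambda>k. \<phi>"] by auto
qed

lemma Lp_norm_linear_combination_tendsto_0:
  fixes f g :: "nat \<Rightarrow> real ^ 'N \<Rightarrow> 'b::euclidean_space"
  assumes "\<And>k. f k \<in> Lp_space p \<Omega>" "\<And>k. g k \<in> Lp_space p \<Omega>" "p \<ge> 1"
    and "(\<lambda>k. Lp_norm p \<Omega> (f k)) \<longlonglongrightarrow> 0" "(\<lambda>k. Lp_norm p \<Omega> (g k)) \<longlonglongrightarrow> 0"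
  shows "(\<lambda>k. Lp_norm p \<Omega> (\<lambda>x. a *\<^sub>R f k x + b *\<^sub>R g k x)) \<longlonglongrightarrow> 0"
proof (rule Lim_null_comparison)
  have "Lp_norm p \<Omega> (\<lambda>x. a *\<^sub>R f k x + b *\<^sub>R g k x) \<le> \<bar>a\<bar> * Lp_norm p \<Omega> (f k) + \<bar>b\<bar> * Lp_norm p \<Omega> (g k)" for k
    using Lp_norm_triangle[OF Lp_space_scaleR[OF assms(1)] Lp_space_scaleR[OF assms(2)], of a k b k] assms(3)
    by (simp add: Lp_norm_scaleR)
  then show "\<forall>\<^sub>F k in sequentially. norm (Lp_norm p \<Omega> (\<lambda>x. a *\<^sub>R f k x + b *\<^sub>R g k x))
      \<le> \<bar>a\<bar> * Lp_norm p \<Omega> (f k) + \<bar>b\<bar> * Lp_norm p \<Omega> (g k)" by simp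
  have "(\<lambda>k. \<bar>a\<bar> * Lp_norm p \<Omega> (f k) + \<bar>b\<bar> * Lp_norm p \<Omega> (g k)) \<longlonglongrightarrow> \<bar>a\<bar> * 0 + \<bar>b\<bar> * 0"
    by (intro tendsto_intros assms)
  then show "(\<lambda>k. \<bar>a\<bar> * Lp_norm p \<Omega> (f k) + \<bar>b\<bar> * Lp_norm p \<Omega> (g k)) \<longlonglongrightarrow> 0" by simp
qed

text \<open>The combined approximating sequences satisfy the hypotheses of \<open>W0I\<close>. The
  gradient identity holds only almost everywhere because each \<open>weak_grad\<close> is a separate
  choice.\<close>

lemma W0_linear_combination:
  assumes \<Omega>: "open \<Omega>" "emeasure lebesgue \<Omega> < \<infinity>" and p: "p > 1"
    and w: "w \<in> W0 p \<Omega>" and z: "z \<in> W0 p \<Omega>"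
  shows "(\<lambda>x. a * w x + b * z x) \<in> W0 p \<Omega>"
    and "AE x in lebesgue_on \<Omega>.
      a *\<^sub>R weak_grad \<Omega> w x + b *\<^sub>R weak_grad \<Omega> z x = weak_grad \<Omega> (\<lambda>x. a * w x + b * z x) x"
proof -
  have \<Omega>m: "\<Omega> \<in> sets lebesgue" using \<Omega>(1) by auto
  have p1: "p \<ge> 1" "p > 0" using p by auto
  note Lp = W0_Lp_space[OF w] W0_Lp_space[OF z] W0_weak_grad_Lp_space[OF \<Omega>(1) w p] W0_weak_grad_Lp_space[OF \<Omega>(1) z p]
  obtain \<phi> where \<phi>: "\<And>k. \<phi> k \<in> test_functions \<Omega>"
    "(\<lambda>k. Lp_norm p \<Omega> (\<lambda>x. \<phi> k x - w x)) \<longlonglongrightarrow> 0"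
    "(\<lambda>k. Lp_norm p \<Omega> (\<lambda>x. classical_grad (\<phi> k) x - weak_grad \<Omega> w x)) \<longlonglongrightarrow> 0"
    by (rule W0_approximation[OF w]) blast
  obtain \<psi> where \<psi>: "\<And>k. \<psi> k \<in> test_functions \<Omega>"
    "(\<lambda>k. Lp_norm p \<Omega> (\<lambda>x. \<psi> k x - z x)) \<longlonglongrightarrow> 0"
    "(\<lambda>k. Lp_norm p \<Omega> (\<lambda>x. classical_grad (\<psi> k) x - weak_grad \<Omega> z x)) \<longlonglongrightarrow> 0"
    by (rule W0_approximation[OF z]) blast
  note tLp = test_functions_Lp_space[OF \<phi>(1) \<Omega>m p1(2)] test_functions_Lp_space[OF \<psi>(1) \<Omega>m p1(2)]
  have 1: "(\<lambda>x. a * w x + b * z x) \<in> Lp_space p \<Omega>"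
    using Lp_space_add[OF Lp_space_scaleR[OF Lp(1)] Lp_space_scaleR[OF Lp(2)] p1(1), of a b] by simp
  have 2: "(\<lambda>x. a *\<^sub>R weak_grad \<Omega> w x + b *\<^sub>R weak_grad \<Omega> z x) \<in> Lp_space p \<Omega>"
    by (rule Lp_space_add[OF Lp_space_scaleR[OF Lp(3)] Lp_space_scaleR[OF Lp(4)] p1(1)])
  have 3: "(\<lambda>x. a * \<phi> k x + b * \<psi> k x) \<in> test_functions \<Omega>" for k
    by (intro test_functions_add test_functions_cmult \<phi>(1) \<psi>(1))
  have 4: "(\<lambda>k. Lp_norm p \<Omega> (\<lambda>x. (a * \<phi> k x + b * \<psi> k x) - (a * w x + b * z x))) \<longlonglongrightarrow> 0"
    using Lp_norm_linear_combination_tendsto_0[OF Lp_space_diff[OF tLp(1) Lp(1) p1(1)]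
        Lp_space_diff[OF tLp(3) Lp(2) p1(1)] p1(1) \<phi>(2) \<psi>(2), of a b]
    by (simp add: algebra_simps)
  have 5: "(\<lambda>k. Lp_norm p \<Omega> (\<lambda>x. classical_grad (\<lambda>x. a * \<phi> k x + b * \<psi> k x) x
      - (a *\<^sub>R weak_grad \<Omega> w x + b *\<^sub>R weak_grad \<Omega> z x))) \<longlonglongrightarrow> 0"
    using Lp_norm_linear_combination_tendsto_0[OF Lp_space_diff[OF tLp(2) Lp(3) p1(1)]
        Lp_space_diff[OF tLp(4) Lp(4) p1(1)] p1(1) \<phi>(3) \<psi>(3), of a b]
    by (simp add: classical_grad_linear_combination[OF \<phi>(1) \<psi>(1)] algebra_simps)
  show "(\<lambda>x. a * w x + b * z x) \<in> W0 p \<Omega>"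
    and "AE x in lebesgue_on \<Omega>.
      a *\<^sub>R weak_grad \<Omega> w x + b *\<^sub>R weak_grad \<Omega> z x = weak_grad \<Omega> (\<lambda>x. a * w x + b * z x) x"
    using W0I[OF \<Omega> p 1 2 3 4 5] by auto
qed

text \<open>The inequality for test functions extends to \<open>W0\<close> by density, so the set of
  admissible constants is nonempty; the infimum is then itself admissible.\<close>

lemma friedrichs_C_F:
  assumes \<Omega>: "open \<Omega>" "emeasure lebesgue \<Omega> < \<infinity>" and p: "p > 1"
  shows "C_F p \<Omega> \<ge> 0"
    and "\<And>w. w \<in> W0 p \<Omega> \<Longrightarrow> Lp_norm p \<Omega> w \<le> C_F p \<Omega> * Lp_norm p \<Omega> (weak_grad \<Omega> w)"
proof -
  have \<Omega>m: "\<Omega> \<in> sets lebesgue" using \<Omega>(1) by auto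
  have p1: "p \<ge> 1" "p > 0" using p by auto
  let ?S = "{C. 0 \<le> C \<and> (\<forall>w\<in>W0 p \<Omega>. Lp_norm p \<Omega> w \<le> C * Lp_norm p \<Omega> (weak_grad \<Omega> w))}"
  obtain c where c: "c \<ge> 0" "\<And>\<phi>. \<phi> \<in> test_functions \<Omega> \<Longrightarrow> Lp_norm p \<Omega> \<phi> \<le> c * Lp_norm p \<Omega> (classical_grad \<phi>)"
    using friedrichs_test_functions[OF \<Omega> p] by blast
  have "Lp_norm p \<Omega> w \<le> c * Lp_norm p \<Omega> (weak_grad \<Omega> w)" if w: "w \<in> W0 p \<Omega>" for w
  proof -
    obtain \<phi> where \<phi>: "\<And>k. \<phi> k \<in> test_functions \<Omega>"
      "(\<lambda>k. Lp_norm p \<Omega> (\<lambda>x. \<phi> k x - w x)) \<longlonglongrightarrow> 0"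
      "(\<lambda>k. Lp_norm p \<Omega> (\<lambda>x. classical_grad (\<phi> k) x - weak_grad \<Omega> w x)) \<longlonglongrightarrow> 0"
      by (rule W0_approximation[OF w]) blast
    note tLp = test_functions_Lp_space[OF \<phi>(1) \<Omega>m p1(2)]
    have "(\<lambda>k. Lp_norm p \<Omega> (\<phi> k)) \<longlonglongrightarrow> Lp_norm p \<Omega> w"
      by (rule Lp_norm_tendsto[OF tLp(1) W0_Lp_space[OF w] p1(1) \<phi>(2)])
    moreover have "(\<lambda>k. c * Lp_norm p \<Omega> (classical_grad (\<phi> k))) \<longlonglongrightarrow> c * Lp_norm p \<Omega> (weak_grad \<Omega> w)"
      by (intro tendsto_intros Lp_norm_tendsto[OF tLp(2) W0_weak_grad_Lp_space[OF \<Omega>(1) w p] p1(1) \<phi>(3)])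
    ultimately show ?thesis
      by (rule LIMSEQ_le) (use c(2)[OF \<phi>(1)] in auto)
  qed
  then have ne: "?S \<noteq> {}" using c(1) by blast
  show "C_F p \<Omega> \<ge> 0" unfolding C_F_def by (rule cInf_greatest[OF ne]) auto
  fix w assume w: "w \<in> W0 p \<Omega>"
  show "Lp_norm p \<Omega> w \<le> C_F p \<Omega> * Lp_norm p \<Omega> (weak_grad \<Omega> w)"
  \<comment> \<open>If the gradient norm is 0, any admissible constant forces the norm of w to be 0;
    otherwise the quotient of the norms is a lower bound of the admissible constants.\<close>
  proof (cases "Lp_norm p \<Omega> (weak_grad \<Omega> w) = 0")
    case True
    then show ?thesis using ne w by fastforce
  next
    case False
    then have pos: "Lp_norm p \<Omega> (weak_grad \<Omega> w) > 0" using Lp_norm_nonneg[of p \<Omega> "weak_grad \<Omega> w"] by linarith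
    have "Lp_norm p \<Omega> w / Lp_norm p \<Omega> (weak_grad \<Omega> w) \<le> C_F p \<Omega>"
      unfolding C_F_def by (rule cInf_greatest[OF ne]) (use w pos in \<open>auto simp: divide_le_eq\<close>)
    then show ?thesis using pos by (simp add: divide_le_eq)
  qed
qed

section \<open>Vector functions\<close>

text \<open>The flux has norm \<open>norm a powr (p - 1)\<close>, and (p - 1) q = p.\<close>

lemma p_flux_Lp_space:
  assumes a: "a \<in> Lp_space p \<Omega>" and p: "p > 1" and q: "q = p / (p - 1)"
  shows "(\<lambda>x. p_flux p (a x)) \<in> Lp_space q \<Omega>"
proof -
  note [measurable] = Lp_spaceD(1)[OF a]
  have "norm (p_flux p (a x)) powr q = norm (a x) powr p" for x
  proof -
    have "norm (p_flux p (a x)) = norm (a x) powr (p - 1)"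
      using powr_sub2_mult_base[of "norm (a x)" p] by (simp add: p_flux_def)
    then show ?thesis using p by (simp add: q powr_powr)
  qed
  then show ?thesis using Lp_spaceD(2)[OF a] by (simp add: Lp_space_def p_flux_def)
qed

lemma p_flux_inner_self: "p_flux p a \<bullet> a = norm a powr p"
  using powr_mult_base[of "norm a" p] powr_sub2_mult_base[of "norm a" p]
  by (simp add: p_flux_def dot_square_norm power2_eq_square mult.assoc[symmetric])

lemma integrable_p_flux_diff:
  fixes a b :: "real ^ 'N \<Rightarrow> 'b::euclidean_space"
  assumes a: "a \<in> Lp_space p \<Omega>" and b: "b \<in> Lp_space p \<Omega>" and p: "p > 1"
  shows "integrable (lebesgue_on \<Omega>) (\<lambda>x. (p_flux p (a x) - p_flux p (b x)) \<bullet> (a x - b x))"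
proof -
  define q where "q = p / (p - 1)"
  have pq: "q > 1" "p > 1" "1 / q + 1 / p = 1" using p by (auto simp: q_def field_simps)
  show ?thesis
    using pq by (intro Lp_holder(1)[OF pq] Lp_space_diff p_flux_Lp_space[OF _ p q_def] a b) auto
qed

lemma Lp_norm_diff_le_p_flux_ge2:
  fixes a b :: "real ^ 'N \<Rightarrow> 'b::euclidean_space"
  assumes a: "a \<in> Lp_space p \<Omega>" and b: "b \<in> Lp_space p \<Omega>" and p: "p \<ge> 2"
  shows "2 powr (2 - p) * Lp_norm p \<Omega> (\<lambda>x. a x - b x) powr p
    \<le> (LINT x|lebesgue_on \<Omega>. (p_flux p (a x) - p_flux p (b x)) \<bullet> (a x - b x))"
proof -
  have "2 powr (2 - p) * Lp_norm p \<Omega> (\<lambda>x. a x - b x) powr p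
      = (LINT x|lebesgue_on \<Omega>. 2 powr (2 - p) * norm (a x - b x) powr p)"
    using p by (simp add: Lp_norm_powr)
  also have "\<dots> \<le> (LINT x|lebesgue_on \<Omega>. (p_flux p (a x) - p_flux p (b x)) \<bullet> (a x - b x))"
    using Lp_spaceD(2)[OF Lp_space_diff[OF a b]] integrable_p_flux_diff[OF a b] p
    by (intro integral_mono p_flux_monotone_ge2) auto
  finally show ?thesis .
qed

text \<open>The pointwise bound controls only the weighted square \<open>e\<close>, whose weight
  decays where the gradients are large. Factoring \<open>norm (a - b) powr p\<close> into
  \<open>e powr (p / 2)\<close> and a power of M, Hoelder's inequality with exponents 2 / p and 2 /
  (2 - p) removes the weight at the cost of the integral of \<open>M powr p\<close>.\<close>

lemma Lp_norm_diff_le_p_flux_lt2: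
  fixes a b :: "real ^ 'N \<Rightarrow> 'b::euclidean_space"
  assumes a: "a \<in> Lp_space p \<Omega>" and b: "b \<in> Lp_space p \<Omega>" and p: "1 < p" "p < 2"
  shows "(p - 1) * Lp_norm p \<Omega> (\<lambda>x. a x - b x) ^ 2
    \<le> (LINT x|lebesgue_on \<Omega>. (p_flux p (a x) - p_flux p (b x)) \<bullet> (a x - b x))
      * (Lp_norm p \<Omega> a powr p + Lp_norm p \<Omega> b powr p) powr ((2 - p) / p)"
proof -
  note [measurable] = Lp_spaceD(1)[OF a] Lp_spaceD(1)[OF b]
  define M where "M x = max (norm (a x)) (norm (b x))" for x
  define e where "e x = norm (a x - b x) ^ 2 * M x powr (p - 2)" for x
  define D where "D = (LINT x|lebesgue_on \<Omega>. (p_flux p (a x) - p_flux p (b x)) \<bullet> (a x - b x))"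
  define S where "S = Lp_norm p \<Omega> a powr p + Lp_norm p \<Omega> b powr p"
  let ?X = "Lp_norm p \<Omega> (\<lambda>x. a x - b x)"
  have [measurable]: "M \<in> borel_measurable (lebesgue_on \<Omega>)" "e \<in> borel_measurable (lebesgue_on \<Omega>)"
    by (auto simp: M_def[abs_def] e_def[abs_def])
  have M0: "M x \<ge> 0" and e0: "e x \<ge> 0" for x by (auto simp: M_def e_def le_max_iff_disj)
  have e_le: "e x \<le> ((p_flux p (a x) - p_flux p (b x)) \<bullet> (a x - b x)) / (p - 1)" for x
    using p_flux_monotone_lt2[OF p, of "a x" "b x"] p by (simp add: e_def M_def field_simps)
  have IDD: "integrable (lebesgue_on \<Omega>) (\<lambda>x. ((p_flux p (a x) - p_flux p (b x)) \<bullet> (a x - b x)) / (p - 1))"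
    using integrable_p_flux_diff[OF a b p(1)] by simp
  have Ie: "integrable (lebesgue_on \<Omega>) e"
    by (rule Bochner_Integration.integrable_bound[OF IDD])
      (use e_le e0 in \<open>auto intro!: AE_I2 order_trans[OF _ abs_ge_self] simp del: abs_divide\<close>)
  have eD: "(LINT x|lebesgue_on \<Omega>. e x) \<le> D / (p - 1)"
    using integral_mono[OF Ie IDD e_le] by (simp add: D_def)
  have Mp: "M x powr p \<le> norm (a x) powr p + norm (b x) powr p" for x
    by (auto simp: M_def max_def)
  have IS: "integrable (lebesgue_on \<Omega>) (\<lambda>x. norm (a x) powr p + norm (b x) powr p)"
    using Lp_spaceD(2)[OF a] Lp_spaceD(2)[OF b] by auto
  have IM: "integrable (lebesgue_on \<Omega>) (\<lambda>x. M x powr p)"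
    by (rule Bochner_Integration.integrable_bound[OF IS])
      (use Mp in \<open>auto intro!: AE_I2 order_trans[OF _ abs_ge_self]\<close>)
  have MS: "(LINT x|lebesgue_on \<Omega>. M x powr p) \<le> S"
    using integral_mono[OF IM IS Mp] p Lp_spaceD(2)[OF a] Lp_spaceD(2)[OF b]
    by (simp add: S_def Lp_norm_powr)
  have prod: "e x powr (p / 2) * M x powr (p * (2 - p) / 2) = norm (a x - b x) powr p" for x
  proof (cases "M x = 0")
    \<comment> \<open>Where both gradients vanish the negative power of M has the value 0, and so
      does the difference.\<close>
    case True
    then have "norm (a x) \<le> 0" "norm (b x) \<le> 0" by (metis M_def max.cobounded1, metis M_def max.cobounded2)
    then have "a x = 0" "b x = 0" by auto
    then show ?thesis by (simp add: e_def)
  next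
    case False
    then have M: "M x > 0" using M0[of x] by simp
    have "e x powr (p / 2) = (norm (a x - b x) ^ 2) powr (p / 2) * (M x powr (p - 2)) powr (p / 2)"
      by (simp add: e_def powr_mult)
    also have "(norm (a x - b x) ^ 2) powr (p / 2) = norm (a x - b x) powr p"
      by (cases "a x = b x") (auto simp: powr_powr simp flip: powr_numeral)
    also have "(M x powr (p - 2)) powr (p / 2) = M x powr ((p - 2) * (p / 2))"
      by (simp add: powr_powr)
    finally have "e x powr (p / 2) * M x powr (p * (2 - p) / 2)
        = norm (a x - b x) powr p * M x powr ((p - 2) * (p / 2) + p * (2 - p) / 2)"
      by (simp add: powr_add)
    also have "(p - 2) * (p / 2) + p * (2 - p) / 2 = 0" by (simp add: field_simps)
    finally show ?thesis using M by simp
  qed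
  have exps: "2 / p > 1" "2 / (2 - p) > 1" "1 / (2 / p) + 1 / (2 / (2 - p)) = 1"
    using p by (auto simp: field_simps)
  have pe: "(e x powr (p / 2)) powr (2 / p) = e x" "(M x powr (p * (2 - p) / 2)) powr (2 / (2 - p)) = M x powr p" for x
    using p e0[of x] M0[of x] by (auto simp: powr_powr)
  have "(LINT x|lebesgue_on \<Omega>. e x powr (p / 2) * M x powr (p * (2 - p) / 2))
      \<le> (LINT x|lebesgue_on \<Omega>. (e x powr (p / 2)) powr (2 / p)) powr (1 / (2 / p))
        * (LINT x|lebesgue_on \<Omega>. (M x powr (p * (2 - p) / 2)) powr (2 / (2 - p))) powr (1 / (2 / (2 - p)))"
    by (rule holder_inequality(2)[OF exps]) (auto simp: pe Ie IM)
  then have "?X powr p \<le> (LINT x|lebesgue_on \<Omega>. e x) powr (p / 2) * (LINT x|lebesgue_on \<Omega>. M x powr p) powr ((2 - p) / 2)"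
    unfolding pe prod using p by (simp add: Lp_norm_powr)
  also have "\<dots> \<le> (D / (p - 1)) powr (p / 2) * S powr ((2 - p) / 2)"
    using p eD MS e0 by (intro mult_mono powr_mono2) (auto intro!: Bochner_Integration.integral_nonneg)
  finally have "(?X powr p) powr (2 / p) \<le> ((D / (p - 1)) powr (p / 2) * S powr ((2 - p) / 2)) powr (2 / p)"
    using p by (intro powr_mono2) auto
  \<comment> \<open>Needed to read \<open>powr 1\<close> as the identity below.\<close>
  moreover have "D / (p - 1) \<ge> 0"
    using eD Bochner_Integration.integral_nonneg[where f = e and M = "lebesgue_on \<Omega>"] e0
    by (meson order_trans)
  moreover have "(?X powr p) powr (2 / p) = ?X powr 2"
    using p by (simp add: powr_powr)
  moreover have "((D / (p - 1)) powr (p / 2) * S powr ((2 - p) / 2)) powr (2 / p) = (D / (p - 1)) powr 1 * S powr ((2 - p) / p)"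
  proof -
    have "(2 - p) / 2 * (2 / p) = (2 - p) / p" "p / 2 * (2 / p) = 1" using p by (auto simp: field_simps)
    then show ?thesis by (simp only: powr_mult powr_powr)
  qed
  ultimately have "?X powr 2 \<le> D / (p - 1) * S powr ((2 - p) / p)"
    by (simp del: abs_divide add: abs_of_nonneg)
  then have "?X ^ 2 \<le> D / (p - 1) * S powr ((2 - p) / p)" by (simp add: powr_numeral)
  then show ?thesis using p by (simp add: D_def S_def field_simps)
qed

section \<open>The Friedrichs inequality for vector functions\<close>

text \<open>Cauchy-Schwarz over the components. It keeps the gradient of the smoothed modulus below
  the Frobenius norm of the full gradient, without a factor depending on the number of
  components.\<close>

lemma norm_sum_scaleR_le_vec:
  fixes g :: "'n::finite \<Rightarrow> 'b::euclidean_space"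
  shows "norm (\<Sum>i\<in>UNIV. c i *\<^sub>R g i) \<le> norm (\<chi> i. c i) * norm (\<chi> i. g i)"
proof -
  have "norm (\<Sum>i\<in>UNIV. c i *\<^sub>R g i) \<le> (\<Sum>i\<in>UNIV. \<bar>c i\<bar> * \<bar>norm (g i)\<bar>)"
    by (rule order_trans[OF norm_sum]) simp
  also have "\<dots> \<le> L2_set c UNIV * L2_set (\<lambda>i. norm (g i)) UNIV"
    by (rule L2_set_mult_ineq)
  finally show ?thesis by (simp add: norm_vec_def L2_set_def)
qed

text \<open>
  The scalar best constant also works for vector functions: apply the scalar inequality to
  a smoothed modulus \<open>\<surd>(\<epsilon>\<^sup>2 + |\<Phi>|\<^sup>2) - \<epsilon>\<close>, whose gradient is pointwise at most \<open>|\<nabla>\<Phi>|\<close>.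
\<close>

lemma friedrichs_C_F_vec_test_functions:
  fixes \<phi> :: "'n::finite \<Rightarrow> real ^ 'N \<Rightarrow> real"
  assumes \<Omega>: "open \<Omega>" "emeasure lebesgue \<Omega> < \<infinity>" and p: "p > 1"
    and \<phi>: "\<And>i. \<phi> i \<in> test_functions \<Omega>"
  shows "Lp_norm p \<Omega> (\<lambda>x. \<chi> i. \<phi> i x) \<le> C_F p \<Omega> * Lp_norm p \<Omega> (\<lambda>x. \<chi> i. classical_grad (\<phi> i) x)"
proof -
  have \<Omega>m: "\<Omega> \<in> sets lebesgue" using \<Omega>(1) by auto
  have p1: "p \<ge> 1" "p > 0" using p by auto
  define \<Phi> where "\<Phi> x = (\<chi> i. \<phi> i x)" for x
  define G where "G x = (\<chi> i. classical_grad (\<phi> i) x)" for x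
  have \<Phi>Lp: "\<Phi> \<in> Lp_space p \<Omega>" and GLp: "G \<in> Lp_space p \<Omega>"
    using test_functions_Lp_space[OF \<phi> \<Omega>m p1(2)] by (auto simp: Lp_space_vec_iff[OF p1(1)] \<Phi>_def G_def)
  have fin: "finite_measure (lebesgue_on \<Omega>)"
    using \<Omega> by (intro finite_measureI) (auto simp: emeasure_restrict_space)
  have one: "(\<lambda>x. c) \<in> Lp_space p \<Omega>" for c :: real
    using fin by (auto simp: Lp_space_def intro: finite_measure.integrable_const)
  have norm_sq: "norm (\<Phi> x) ^ 2 = (\<Sum>i\<in>UNIV. \<phi> i x ^ 2)" for x
    by (simp add: \<Phi>_def norm_vec_def L2_set_def sum_nonneg)
  have main: "Lp_norm p \<Omega> \<Phi> \<le> C_F p \<Omega> * Lp_norm p \<Omega> G + \<epsilon> * Lp_norm p \<Omega> (\<lambda>x. 1 :: real)" if \<epsilon>: "\<epsilon> > 0" for \<epsilon>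
  proof -
    \<comment> \<open>The positive shift keeps the root smooth where the vector function vanishes;
      subtracting \<epsilon> in \<open>w\<close> restores compact support.\<close>
    define F where "F x = \<epsilon> ^ 2 + (\<Sum>i\<in>UNIV. \<phi> i x * \<phi> i x)" for x
    define w where "w x = sqrt (F x) - \<epsilon>" for x
    have F: "F x = \<epsilon> ^ 2 + norm (\<Phi> x) ^ 2" for x by (simp add: F_def norm_sq[unfolded power2_eq_square] power2_eq_square)
    have F0: "F x > 0" for x using \<epsilon> by (simp add: F add_pos_nonneg)
    have w_test: "w \<in> test_functions \<Omega>"
    proof -
      have "\<exists>K. compact K \<and> K \<subseteq> \<Omega> \<and> (\<forall>x. x \<notin> K \<longrightarrow> \<phi> i x = 0)" for i
        by (rule test_functionsE[OF \<phi>[of i]]) blast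
      then obtain K where K: "\<And>i. compact (K i)" "\<And>i. K i \<subseteq> \<Omega>" "\<And>i x. x \<notin> K i \<Longrightarrow> \<phi> i x = 0"
        by metis
      show ?thesis
      proof (rule test_functionsI[where K = "\<Union>i. K i"])
        fix k
        have "C_k k (\<lambda>x. F x powr (1/2) - \<epsilon>)"
          using F0 unfolding F_def
          by (intro C_k_diff C_k_powr C_k_add C_k_const C_k_sum C_k_mult test_functions_C_k[OF \<phi>])
        then show "C_k k w" using F0 by (simp add: w_def[abs_def] powr_half_sqrt less_imp_le)
      next
        show "compact (\<Union>i. K i)" using K(1) by (intro compact_UN) auto
        show "(\<Union>i. K i) \<subseteq> \<Omega>" using K(2) by auto
        show "w x = 0" if "x \<notin> (\<Union>i. K i)" for x
          using that K(3) \<epsilon> by (simp add: w_def F_def)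
      qed
    qed
    have grad: "classical_grad w x = (1 / sqrt (F x)) *\<^sub>R (\<Sum>i\<in>UNIV. \<phi> i x *\<^sub>R classical_grad (\<phi> i) x)" for x
    proof (rule classical_grad_eqI)
      note [derivative_intros] = has_derivative_classical_grad[OF \<phi>]
      have F': "(F has_derivative (\<lambda>h. 2 * (\<Sum>i\<in>UNIV. \<phi> i x * (classical_grad (\<phi> i) x \<bullet> h)))) (at x)"
        unfolding F_def
        by (auto intro!: derivative_eq_intros simp: sum_distrib_left fun_eq_iff intro!: sum.cong)
      have "(w has_derivative (\<lambda>h. 2 * (\<Sum>i\<in>UNIV. \<phi> i x * (classical_grad (\<phi> i) x \<bullet> h)) * (inverse (sqrt (F x)) / 2))) (at x)"
        unfolding w_def using F0[of x] F' by (auto intro!: derivative_eq_intros)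
      moreover have "2 * (\<Sum>i\<in>UNIV. \<phi> i x * (classical_grad (\<phi> i) x \<bullet> h)) * (inverse (sqrt (F x)) / 2)
          = ((1 / sqrt (F x)) *\<^sub>R (\<Sum>i\<in>UNIV. \<phi> i x *\<^sub>R classical_grad (\<phi> i) x)) \<bullet> h" for h
        unfolding inner_scaleR_left inner_sum_left by (simp add: inverse_eq_divide)
      ultimately show "(w has_derivative (\<lambda>h. ((1 / sqrt (F x)) *\<^sub>R (\<Sum>i\<in>UNIV. \<phi> i x *\<^sub>R classical_grad (\<phi> i) x)) \<bullet> h)) (at x)"
        by simp
    qed
    have grad_le: "norm (classical_grad w x) \<le> norm (G x)" for x
    proof -
      have "norm (classical_grad w x) \<le> (1 / sqrt (F x)) * (norm (\<Phi> x) * norm (G x))"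
        using norm_sum_scaleR_le_vec[of "\<lambda>i. \<phi> i x" "\<lambda>i. classical_grad (\<phi> i) x"] F0[of x]
        by (simp add: grad \<Phi>_def G_def divide_right_mono less_imp_le)
      also have "norm (\<Phi> x) \<le> sqrt (F x)" by (rule real_le_rsqrt) (simp add: F)
      then have "(1 / sqrt (F x)) * (norm (\<Phi> x) * norm (G x)) \<le> (1 / sqrt (F x)) * (sqrt (F x) * norm (G x))"
        using F0[of x] by (intro mult_left_mono mult_right_mono) auto
      also have "\<dots> = norm (G x)" using F0[of x] by simp
      finally show ?thesis .
    qed
    have w0: "w x \<ge> 0" for x
      unfolding w_def using \<epsilon> by (simp add: real_le_rsqrt F)
    have \<Phi>w: "norm (\<Phi> x) \<le> w x + \<epsilon>" for x
      unfolding w_def by (simp add: real_le_rsqrt F)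
    have wLp: "w \<in> Lp_space p \<Omega>" "classical_grad w \<in> Lp_space p \<Omega>"
      using test_functions_Lp_space[OF w_test \<Omega>m p1(2)] by auto
    have "Lp_norm p \<Omega> \<Phi> \<le> Lp_norm p \<Omega> (\<lambda>x. w x + \<epsilon>)"
      using \<Phi>w w0 \<epsilon> p1 Lp_spaceD(1)[OF \<Phi>Lp]
      by (intro Lp_space_dominated(2)[OF Lp_space_add[OF wLp(1) one]]) (auto intro!: AE_I2 order_trans[OF _ abs_ge_self])
    also have "\<dots> \<le> Lp_norm p \<Omega> w + Lp_norm p \<Omega> (\<lambda>x. \<epsilon>)"
      by (rule Lp_norm_triangle[OF wLp(1) one p1(1)])
    also have "Lp_norm p \<Omega> (\<lambda>x. \<epsilon>) = \<epsilon> * Lp_norm p \<Omega> (\<lambda>x. 1 :: real)"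
      using Lp_norm_scaleR[OF p1(2), of \<Omega> \<epsilon> "\<lambda>x. 1 :: real"] \<epsilon> by simp
    also have "Lp_norm p \<Omega> w \<le> C_F p \<Omega> * Lp_norm p \<Omega> (weak_grad \<Omega> w)"
      by (rule friedrichs_C_F(2)[OF \<Omega> p test_functions_W0(1)[OF \<Omega> p w_test]])
    also have "Lp_norm p \<Omega> (weak_grad \<Omega> w) = Lp_norm p \<Omega> (classical_grad w)"
    proof (rule Lp_norm_cong_AE)
      show "AE x in lebesgue_on \<Omega>. weak_grad \<Omega> w x = classical_grad w x"
        using test_functions_W0(2)[OF \<Omega> p w_test] by eventually_elim simp
      show "weak_grad \<Omega> w \<in> borel_measurable (lebesgue_on \<Omega>)"
        by (rule Lp_spaceD(1)[OF W0_weak_grad_Lp_space[OF \<Omega>(1) test_functions_W0(1)[OF \<Omega> p w_test] p]])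
    qed (rule Lp_spaceD(1)[OF wLp(2)])
    also have "Lp_norm p \<Omega> (classical_grad w) \<le> Lp_norm p \<Omega> G"
      using grad_le p1 Lp_spaceD(1)[OF wLp(2)] by (intro Lp_space_dominated(2)[OF GLp]) auto
    finally show ?thesis using friedrichs_C_F(1)[OF \<Omega> p] by (simp add: mult_left_mono)
  qed
  \<comment> \<open>The smoothing costs \<epsilon> times the norm of the constant 1, which lies in
    the Lebesgue space because \<Omega> has finite measure; the cost vanishes as \<epsilon> tends to
    0.\<close>
  have "((\<lambda>\<epsilon>. C_F p \<Omega> * Lp_norm p \<Omega> G + \<epsilon> * Lp_norm p \<Omega> (\<lambda>x. 1 :: real))
      \<longlongrightarrow> C_F p \<Omega> * Lp_norm p \<Omega> G + 0 * Lp_norm p \<Omega> (\<lambda>x. 1 :: real)) (at_right 0)"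
    by (intro tendsto_intros)
  then have "Lp_norm p \<Omega> \<Phi> \<le> C_F p \<Omega> * Lp_norm p \<Omega> G + 0 * Lp_norm p \<Omega> (\<lambda>x. 1 :: real)"
    by (rule tendsto_lowerbound) (use main in \<open>auto simp: eventually_at_right_field intro!: exI[of _ 1]\<close>)
  then show ?thesis by (simp add: \<Phi>_def[abs_def] G_def[abs_def])
qed

lemma W0_vec_Lp_space:
  assumes "open \<Omega>" "u \<in> W0_vec p \<Omega>" "p > 1"
  shows "u \<in> Lp_space p \<Omega>" "vgrad \<Omega> u \<in> Lp_space p \<Omega>"
proof -
  have p1: "p \<ge> 1" using assms by simp
  have "(\<lambda>x. u x $ i) \<in> W0 p \<Omega>" for i using assms(2) by (simp add: W0_vec_def)
  then show "u \<in> Lp_space p \<Omega>" "vgrad \<Omega> u \<in> Lp_space p \<Omega>"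
    using W0_Lp_space W0_weak_grad_Lp_space[OF assms(1) _ assms(3)]
    by (auto simp: Lp_space_vec_iff[OF p1] vgrad_def)
qed

text \<open>Approximating sequences of the single components are assembled into vectors of test
  functions, for which the inequality is known, and both norms converge.\<close>

lemma friedrichs_C_F_vec:
  fixes u :: "real ^ 'N \<Rightarrow> real ^ 'n"
  assumes \<Omega>: "open \<Omega>" "emeasure lebesgue \<Omega> < \<infinity>" and p: "p > 1" and u: "u \<in> W0_vec p \<Omega>"
  shows "Lp_norm p \<Omega> u \<le> C_F p \<Omega> * Lp_norm p \<Omega> (vgrad \<Omega> u)"
proof -
  have \<Omega>m: "\<Omega> \<in> sets lebesgue" using \<Omega>(1) by auto
  have p1: "p \<ge> 1" "p > 0" using p by auto
  note uLp = W0_vec_Lp_space[OF \<Omega>(1) u p]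
  have "\<forall>i. \<exists>\<phi>. (\<forall>k. \<phi> k \<in> test_functions \<Omega>) \<and>
    (\<lambda>k. Lp_norm p \<Omega> (\<lambda>x. \<phi> k x - u x $ i)) \<longlonglongrightarrow> 0 \<and>
    (\<lambda>k. Lp_norm p \<Omega> (\<lambda>x. classical_grad (\<phi> k) x - weak_grad \<Omega> (\<lambda>y. u y $ i) x)) \<longlonglongrightarrow> 0"
    using u by (auto simp: W0_vec_def W0_def)
  from choice[OF this] obtain \<phi> where \<phi>: "\<And>i k. \<phi> i k \<in> test_functions \<Omega>"
    "\<And>i. (\<lambda>k. Lp_norm p \<Omega> (\<lambda>x. \<phi> i k x - u x $ i)) \<longlonglongrightarrow> 0"
    "\<And>i. (\<lambda>k. Lp_norm p \<Omega> (\<lambda>x. classical_grad (\<phi> i k) x - weak_grad \<Omega> (\<lambda>y. u y $ i) x)) \<longlonglongrightarrow> 0"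
    by blast
  define \<Phi> where "\<Phi> k x = (\<chi> i. \<phi> i k x)" for k x
  define G where "G k x = (\<chi> i. classical_grad (\<phi> i k) x)" for k x
  have Lp: "\<Phi> k \<in> Lp_space p \<Omega>" "G k \<in> Lp_space p \<Omega>" for k
    using test_functions_Lp_space[OF \<phi>(1) \<Omega>m p1(2)] by (auto simp: Lp_space_vec_iff[OF p1(1)] \<Phi>_def G_def)
  have "(\<lambda>k. Lp_norm p \<Omega> (\<lambda>x. \<Phi> k x - u x)) \<longlonglongrightarrow> 0"
  proof (rule Lim_null_comparison)
    show "\<forall>\<^sub>F k in sequentially. norm (Lp_norm p \<Omega> (\<lambda>x. \<Phi> k x - u x)) \<le> (\<Sum>i\<in>UNIV. Lp_norm p \<Omega> (\<lambda>x. \<phi> i k x - u x $ i))"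
      using Lp_norm_vec_le[OF p1(1) Lp_space_diff[OF Lp(1) uLp(1) p1(1)]] by (simp add: \<Phi>_def)
    have "(\<lambda>k. \<Sum>i\<in>UNIV. Lp_norm p \<Omega> (\<lambda>x. \<phi> i k x - u x $ i)) \<longlonglongrightarrow> (\<Sum>i\<in>(UNIV :: 'n set). 0)"
      by (intro tendsto_sum \<phi>(2))
    then show "(\<lambda>k. \<Sum>i\<in>UNIV. Lp_norm p \<Omega> (\<lambda>x. \<phi> i k x - u x $ i)) \<longlonglongrightarrow> 0" by simp
  qed
  then have "(\<lambda>k. Lp_norm p \<Omega> (\<Phi> k)) \<longlonglongrightarrow> Lp_norm p \<Omega> u"
    by (rule Lp_norm_tendsto[OF Lp(1) uLp(1) p1(1)])
  moreover have "(\<lambda>k. Lp_norm p \<Omega> (\<lambda>x. G k x - vgrad \<Omega> u x)) \<longlonglongrightarrow> 0"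
  proof (rule Lim_null_comparison)
    show "\<forall>\<^sub>F k in sequentially. norm (Lp_norm p \<Omega> (\<lambda>x. G k x - vgrad \<Omega> u x))
        \<le> (\<Sum>i\<in>UNIV. Lp_norm p \<Omega> (\<lambda>x. classical_grad (\<phi> i k) x - weak_grad \<Omega> (\<lambda>y. u y $ i) x))"
      using Lp_norm_vec_le[OF p1(1) Lp_space_diff[OF Lp(2) uLp(2) p1(1)]] by (simp add: G_def vgrad_def)
    have "(\<lambda>k. \<Sum>i\<in>UNIV. Lp_norm p \<Omega> (\<lambda>x. classical_grad (\<phi> i k) x - weak_grad \<Omega> (\<lambda>y. u y $ i) x))
        \<longlonglongrightarrow> (\<Sum>i\<in>(UNIV :: 'n set). 0)"
      by (intro tendsto_sum \<phi>(3))
    then show "(\<lambda>k. \<Sum>i\<in>UNIV. Lp_norm p \<Omega> (\<lambda>x. classical_grad (\<phi> i k) x - weak_grad \<Omega> (\<lambda>y. u y $ i) x)) \<longlonglongrightarrow> 0"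
      by simp
  qed
  then have "(\<lambda>k. C_F p \<Omega> * Lp_norm p \<Omega> (G k)) \<longlonglongrightarrow> C_F p \<Omega> * Lp_norm p \<Omega> (vgrad \<Omega> u)"
    by (intro tendsto_intros Lp_norm_tendsto[OF Lp(2) uLp(2) p1(1)])
  ultimately show ?thesis
    by (rule LIMSEQ_le)
      (use friedrichs_C_F_vec_test_functions[OF \<Omega> p, of "\<lambda>i. \<phi> i k" for k] \<phi>(1)
        in \<open>auto simp: \<Phi>_def[abs_def] G_def[abs_def]\<close>)
qed

lemma W0_vec_diff:
  fixes u v :: "real ^ 'N \<Rightarrow> real ^ 'n"
  assumes \<Omega>: "open \<Omega>" "emeasure lebesgue \<Omega> < \<infinity>" and p: "p > 1"
    and u: "u \<in> W0_vec p \<Omega>" and v: "v \<in> W0_vec p \<Omega>"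
  shows "(\<lambda>x. u x - v x) \<in> W0_vec p \<Omega>"
    and "AE x in lebesgue_on \<Omega>. vgrad \<Omega> u x - vgrad \<Omega> v x = vgrad \<Omega> (\<lambda>x. u x - v x) x"
proof -
  have uv: "(\<lambda>x. u x $ i) \<in> W0 p \<Omega>" "(\<lambda>x. v x $ i) \<in> W0 p \<Omega>" for i
    using u v by (auto simp: W0_vec_def)
  note lin = W0_linear_combination[OF \<Omega> p uv, where a = 1 and b = "-1", simplified]
  show "(\<lambda>x. u x - v x) \<in> W0_vec p \<Omega>" using lin(1) by (simp add: W0_vec_def)
  have "AE x in lebesgue_on \<Omega>. \<forall>i. weak_grad \<Omega> (\<lambda>x. u x $ i) x - weak_grad \<Omega> (\<lambda>x. v x $ i) x
      = weak_grad \<Omega> (\<lambda>x. u x $ i - v x $ i) x"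
    using lin(2) by (intro eventually_all_finite)
  then show "AE x in lebesgue_on \<Omega>. vgrad \<Omega> u x - vgrad \<Omega> v x = vgrad \<Omega> (\<lambda>x. u x - v x) x"
    by eventually_elim (simp add: vgrad_def vec_eq_iff)
qed

lemma zero_W0_vec:
  assumes \<Omega>: "open \<Omega>" "emeasure lebesgue \<Omega> < \<infinity>" and p: "p > 1"
  shows "(\<lambda>x. 0) \<in> W0_vec p \<Omega>"
  using test_functions_W0(1)[OF \<Omega> p test_functions_zero] by (simp add: W0_vec_def)

text \<open>The zero field is a weak gradient of such a function, so uniqueness applies. This
  settles directions that \<open>F_deriv_norm\<close> excludes from its supremum.\<close>

lemma vgrad_AE_zero:
  fixes u :: "real ^ 'N \<Rightarrow> real ^ 'n"
  assumes \<Omega>: "open \<Omega>" "emeasure lebesgue \<Omega> < \<infinity>" and p: "p > 1"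
    and u: "u \<in> W0_vec p \<Omega>" and 0: "AE x in lebesgue_on \<Omega>. u x = 0"
  shows "AE x in lebesgue_on \<Omega>. vgrad \<Omega> u x = 0"
proof -
  have \<Omega>m: "\<Omega> \<in> sets lebesgue" using \<Omega>(1) by auto
  have "AE x in lebesgue_on \<Omega>. 0 = weak_grad \<Omega> (\<lambda>x. u x $ i) x" for i
  proof (rule weak_grad_eq_AE[OF \<Omega>(1)])
    have uLp: "(\<lambda>x. u x $ i) \<in> Lp_space p \<Omega>" using u by (auto simp: W0_vec_def intro: W0_Lp_space)
    show "has_weak_grad \<Omega> (\<lambda>x. u x $ i) (\<lambda>x. 0)"
      unfolding has_weak_grad_def
    proof (intro conjI ballI allI)
      show "locally_integrable \<Omega> (\<lambda>x. u x $ i)"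
        using Lp_space_locally_integrable[OF uLp \<Omega>m \<Omega>(2)] p by simp
      show "locally_integrable \<Omega> (\<lambda>x. 0 :: real ^ 'N)" by (simp add: locally_integrable_def)
      fix \<psi> j assume \<psi>: "\<psi> \<in> test_functions \<Omega>"
      note [measurable] = Lp_spaceD(1)[OF uLp]
        borel_measurable_lebesgue_on[OF borel_measurable_test_functions(1)[OF test_functions_partial[OF \<psi>]]]
      have "(LINT x|lebesgue_on \<Omega>. u x $ i * partial j \<psi> x) = (LINT x|lebesgue_on \<Omega>. 0)"
      proof (rule integral_cong_AE)
        show "AE x in lebesgue_on \<Omega>. u x $ i * partial j \<psi> x = 0" using 0 by eventually_elim simp
      qed auto
      then show "(LINT x|lebesgue_on \<Omega>. u x $ i * partial j \<psi> x) = - (LINT x|lebesgue_on \<Omega>. 0 $ j * \<psi> x)"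
        by simp
    qed
  qed
  then have "AE x in lebesgue_on \<Omega>. \<forall>i. 0 = weak_grad \<Omega> (\<lambda>x. u x $ i) x" by (rule eventually_all_finite)
  then show ?thesis by eventually_elim (simp add: vgrad_def vec_eq_iff)
qed

section \<open>The error estimate\<close>

text \<open>Makes the infimum of the theorem run over a nonempty set, and provides the finite upper
  bound for the supremum in \<open>F_deriv_norm\<close>.\<close>

lemma zero_Q_vec: "(\<lambda>x. 0) \<in> Q_vec q \<Omega>"
  by (auto simp: Q_vec_def has_weak_div_def locally_integrable_def intro!: bexI[of _ "\<lambda>x. 0"])

lemma Q_vec_vdiv:
  fixes \<eta> :: "real ^ 'N \<Rightarrow> real ^ 'N ^ 'n"
  assumes \<Omega>: "open \<Omega>" and \<eta>: "\<eta> \<in> Q_vec q \<Omega>" and q: "q \<ge> 1"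
  shows "vdiv \<Omega> \<eta> \<in> Lp_space q \<Omega>"
    and "\<And>i \<phi>. \<phi> \<in> test_functions \<Omega> \<Longrightarrow>
      (LINT x|lebesgue_on \<Omega>. \<eta> x $ i \<bullet> classical_grad \<phi> x) = - (LINT x|lebesgue_on \<Omega>. vdiv \<Omega> \<eta> x $ i * \<phi> x)"
proof -
  have \<Omega>m: "\<Omega> \<in> sets lebesgue" using \<Omega> by auto
  have "weak_div \<Omega> (\<lambda>x. \<eta> x $ i) \<in> Lp_space q \<Omega> \<and> has_weak_div \<Omega> (\<lambda>x. \<eta> x $ i) (weak_div \<Omega> (\<lambda>x. \<eta> x $ i))" for i
  proof -
    obtain d where d: "d \<in> Lp_space q \<Omega>" "has_weak_div \<Omega> (\<lambda>x. \<eta> x $ i) d"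
      using \<eta> by (auto simp: Q_vec_def)
    have "weak_div \<Omega> (\<lambda>x. \<eta> x $ i) \<in> Lp_space q \<Omega>"
      by (rule Lp_space_AE_cong[OF d(1) weak_div_eq_AE[OF \<Omega> d(2)] \<Omega>m]) (use q in auto)
    moreover have "has_weak_div \<Omega> (\<lambda>x. \<eta> x $ i) (weak_div \<Omega> (\<lambda>x. \<eta> x $ i))"
      unfolding weak_div_def by (rule someI[of "has_weak_div \<Omega> (\<lambda>x. \<eta> x $ i)", OF d(2)])
    ultimately show ?thesis by blast
  qed
  then show "vdiv \<Omega> \<eta> \<in> Lp_space q \<Omega>"
    and "\<And>i \<phi>. \<phi> \<in> test_functions \<Omega> \<Longrightarrow>
      (LINT x|lebesgue_on \<Omega>. \<eta> x $ i \<bullet> classical_grad \<phi> x) = - (LINT x|lebesgue_on \<Omega>. vdiv \<Omega> \<eta> x $ i * \<phi> x)"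
    by (auto simp: Lp_space_vec_iff[OF q] vdiv_def has_weak_div_def)
qed

text \<open>The weak divergence is defined through test functions only; density in
  \<open>W0\<close>, applied to each component, extends the identity since both pairings are
  continuous.\<close>

lemma integration_by_parts_Q_vec_W0_vec:
  fixes \<eta> :: "real ^ 'N \<Rightarrow> real ^ 'N ^ 'n"
  assumes \<Omega>: "open \<Omega>" and p: "p > 1" and q: "q = p / (p - 1)"
    and \<eta>: "\<eta> \<in> Q_vec q \<Omega>" and \<xi>: "\<xi> \<in> W0_vec p \<Omega>"
  shows "(LINT x|lebesgue_on \<Omega>. \<eta> x \<bullet> vgrad \<Omega> \<xi> x) = - (LINT x|lebesgue_on \<Omega>. vdiv \<Omega> \<eta> x \<bullet> \<xi> x)"
proof -
  have \<Omega>m: "\<Omega> \<in> sets lebesgue" using \<Omega> by auto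
  have pq: "p > 1" "q > 1" "1 / p + 1 / q = 1" using p by (auto simp: q field_simps)
  have p1: "p \<ge> 1" "p > 0" "q \<ge> 1" using pq by auto
  note div = Q_vec_vdiv[OF \<Omega> \<eta> p1(3)]
  have \<eta>Lp: "(\<lambda>x. \<eta> x $ i) \<in> Lp_space q \<Omega>" for i
    using \<eta> by (auto simp: Q_vec_def Lp_space_vec_iff[OF p1(3)])
  have dLp: "(\<lambda>x. vdiv \<Omega> \<eta> x $ i) \<in> Lp_space q \<Omega>" for i
    using div(1) by (simp add: Lp_space_vec_iff[OF p1(3)])
  have \<xi>0: "(\<lambda>x. \<xi> x $ i) \<in> W0 p \<Omega>" for i using \<xi> by (simp add: W0_vec_def)
  let ?g = "\<lambda>i. weak_grad \<Omega> (\<lambda>y. \<xi> y $ i)"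
  note gLp = W0_weak_grad_Lp_space[OF \<Omega> \<xi>0 p] and \<xi>Lp = W0_Lp_space[OF \<xi>0]
  have comp: "(LINT x|lebesgue_on \<Omega>. ?g i x \<bullet> \<eta> x $ i) = - (LINT x|lebesgue_on \<Omega>. \<xi> x $ i \<bullet> vdiv \<Omega> \<eta> x $ i)" for i
  proof -
    obtain \<phi> where \<phi>: "\<And>k. \<phi> k \<in> test_functions \<Omega>"
      "(\<lambda>k. Lp_norm p \<Omega> (\<lambda>x. \<phi> k x - \<xi> x $ i)) \<longlonglongrightarrow> 0"
      "(\<lambda>k. Lp_norm p \<Omega> (\<lambda>x. classical_grad (\<phi> k) x - ?g i x)) \<longlonglongrightarrow> 0"
      by (rule W0_approximation[OF \<xi>0[of i]]) blast
    note tLp = test_functions_Lp_space[OF \<phi>(1) \<Omega>m p1(2)]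
    have "(\<lambda>k. LINT x|lebesgue_on \<Omega>. classical_grad (\<phi> k) x \<bullet> \<eta> x $ i) \<longlonglongrightarrow> (LINT x|lebesgue_on \<Omega>. ?g i x \<bullet> \<eta> x $ i)"
      by (rule Lp_pairing_tendsto[OF pq tLp(2) gLp \<eta>Lp \<phi>(3)])
    moreover have "(\<lambda>k. - (LINT x|lebesgue_on \<Omega>. \<phi> k x \<bullet> vdiv \<Omega> \<eta> x $ i)) \<longlonglongrightarrow> - (LINT x|lebesgue_on \<Omega>. \<xi> x $ i \<bullet> vdiv \<Omega> \<eta> x $ i)"
      by (intro tendsto_minus Lp_pairing_tendsto[OF pq tLp(1) \<xi>Lp dLp \<phi>(2)])
    moreover have "(LINT x|lebesgue_on \<Omega>. classical_grad (\<phi> k) x \<bullet> \<eta> x $ i) = - (LINT x|lebesgue_on \<Omega>. \<phi> k x \<bullet> vdiv \<Omega> \<eta> x $ i)" for k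
      using div(2)[OF \<phi>(1), of i k] by (simp add: inner_commute mult.commute)
    ultimately show ?thesis by (simp add: LIMSEQ_unique)
  qed
  have "(LINT x|lebesgue_on \<Omega>. \<eta> x \<bullet> vgrad \<Omega> \<xi> x) = (\<Sum>i\<in>UNIV. LINT x|lebesgue_on \<Omega>. ?g i x \<bullet> \<eta> x $ i)"
    using Lp_holder(1)[OF pq gLp \<eta>Lp]
    by (subst Bochner_Integration.integral_sum[symmetric]) (auto simp: inner_vec_def[where 'a = "real ^ 'N"] vgrad_def inner_commute)
  also have "\<dots> = - (\<Sum>i\<in>UNIV. LINT x|lebesgue_on \<Omega>. \<xi> x $ i \<bullet> vdiv \<Omega> \<eta> x $ i)"
    by (simp only: comp sum_negf)
  also have "(\<Sum>i\<in>UNIV. LINT x|lebesgue_on \<Omega>. \<xi> x $ i \<bullet> vdiv \<Omega> \<eta> x $ i) = (LINT x|lebesgue_on \<Omega>. vdiv \<Omega> \<eta> x \<bullet> \<xi> x)"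
    using Lp_holder(1)[OF pq \<xi>Lp dLp]
    by (subst Bochner_Integration.integral_sum[symmetric]) (auto simp: inner_vec_def[where 'a = real] mult.commute)
  finally show ?thesis .
qed

lemma F_deriv_le_functional_majorant:
  fixes h v :: "real ^ 'N \<Rightarrow> real ^ 'n"
  assumes \<Omega>: "open \<Omega>" "emeasure lebesgue \<Omega> < \<infinity>" and p: "p > 1" and q: "q = p / (p - 1)"
    and h: "h \<in> Lp_space q \<Omega>" and v: "v \<in> W0_vec p \<Omega>"
    and \<eta>: "\<eta> \<in> Q_vec q \<Omega>" and \<xi>: "\<xi> \<in> W0_vec p \<Omega>"
  shows "F_deriv p \<Omega> h v \<xi> \<le>
    (Lp_norm q \<Omega> (\<lambda>x. p_flux p (vgrad \<Omega> v x) - \<eta> x) + C_F p \<Omega> * Lp_norm q \<Omega> (\<lambda>x. vdiv \<Omega> \<eta> x + h x))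
      * Lp_norm p \<Omega> (vgrad \<Omega> \<xi>)"
proof -
  have qp: "q > 1" "p > 1" "1 / q + 1 / p = 1" using p by (auto simp: q field_simps)
  have q1: "q \<ge> 1" using qp by simp
  note \<xi>Lp = W0_vec_Lp_space[OF \<Omega>(1) \<xi> p]
  have \<tau>Lp: "(\<lambda>x. p_flux p (vgrad \<Omega> v x)) \<in> Lp_space q \<Omega>"
    by (rule p_flux_Lp_space[OF W0_vec_Lp_space(2)[OF \<Omega>(1) v p] p q])
  have \<eta>Lp: "\<eta> \<in> Lp_space q \<Omega>" using \<eta> by (simp add: Q_vec_def)
  note dLp = Q_vec_vdiv(1)[OF \<Omega>(1) \<eta> q1]
  note I = Lp_holder(1)[OF qp \<tau>Lp \<xi>Lp(2)] Lp_holder(1)[OF qp \<eta>Lp \<xi>Lp(2)]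
    Lp_holder(1)[OF qp dLp \<xi>Lp(1)] Lp_holder(1)[OF qp h \<xi>Lp(1)]
  \<comment> \<open>Subtracting \<eta> from the flux adds the integral of its divergence against
    \<xi>, which joins the term with \<open>h\<close>.\<close>
  have "F_deriv p \<Omega> h v \<xi> = (LINT x|lebesgue_on \<Omega>. (p_flux p (vgrad \<Omega> v x) - \<eta> x) \<bullet> vgrad \<Omega> \<xi> x)
      - (LINT x|lebesgue_on \<Omega>. (vdiv \<Omega> \<eta> x + h x) \<bullet> \<xi> x)"
    using I integration_by_parts_Q_vec_W0_vec[OF \<Omega>(1) p q \<eta> \<xi>]
    by (simp add: F_deriv_def inner_diff_left inner_add_left)
  also have "\<dots> \<le> Lp_norm q \<Omega> (\<lambda>x. p_flux p (vgrad \<Omega> v x) - \<eta> x) * Lp_norm p \<Omega> (vgrad \<Omega> \<xi>)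
      + Lp_norm q \<Omega> (\<lambda>x. vdiv \<Omega> \<eta> x + h x) * Lp_norm p \<Omega> \<xi>"
    using Lp_holder(2)[OF qp Lp_space_diff[OF \<tau>Lp \<eta>Lp q1] \<xi>Lp(2)]
      Lp_holder(2)[OF qp Lp_space_add[OF dLp h q1] \<xi>Lp(1)] by linarith
  also have "\<dots> \<le> Lp_norm q \<Omega> (\<lambda>x. p_flux p (vgrad \<Omega> v x) - \<eta> x) * Lp_norm p \<Omega> (vgrad \<Omega> \<xi>)
      + Lp_norm q \<Omega> (\<lambda>x. vdiv \<Omega> \<eta> x + h x) * (C_F p \<Omega> * Lp_norm p \<Omega> (vgrad \<Omega> \<xi>))"
    by (intro add_left_mono mult_left_mono friedrichs_C_F_vec[OF \<Omega> p \<xi>]) auto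
  finally show ?thesis by (simp add: algebra_simps)
qed

lemma nonzero_W0_vec:
  fixes \<Omega> :: "(real ^ 'N) set"
  assumes \<Omega>: "open \<Omega>" "emeasure lebesgue \<Omega> < \<infinity>" "\<Omega> \<noteq> {}" and p: "p > 1"
  obtains \<xi> :: "real ^ 'N \<Rightarrow> real ^ 'n" where "\<xi> \<in> W0_vec p \<Omega>" "\<not> (AE x in lebesgue_on \<Omega>. \<xi> x = 0)"
proof -
  obtain \<phi> where \<phi>: "\<phi> \<in> test_functions \<Omega>" "\<not> (AE x in lebesgue_on \<Omega>. \<phi> x = 0)"
    using nonzero_test_function[OF \<Omega>(1,3)] by blast
  show thesis
  proof (rule that)
    show "(\<lambda>x. \<chi> i. \<phi> x) \<in> W0_vec p \<Omega>"
      using test_functions_W0(1)[OF \<Omega>(1,2) p \<phi>(1)] by (simp add: W0_vec_def)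
    show "\<not> (AE x in lebesgue_on \<Omega>. (\<chi> i. \<phi> x :: real ^ 'n) = 0)"
      using \<phi>(2) by (simp add: vec_eq_iff)
  qed
qed

section \<open>The dual norm as a genuine supremum\<close>

text \<open>The three claims share one fact: the majorant at \<open>\<eta> = 0\<close> bounds all
  quotients, so the supremum is finite and can be compared with each quotient. Nonnegativity comes
  from comparing a direction with its negative.\<close>

lemma
  fixes h v :: "real ^ 'N \<Rightarrow> real ^ 'n"
  assumes \<Omega>: "open \<Omega>" "emeasure lebesgue \<Omega> < \<infinity>" "\<Omega> \<noteq> {}" and p: "p > 1" and q: "q = p / (p - 1)"
    and h: "h \<in> Lp_space q \<Omega>" and v: "v \<in> W0_vec p \<Omega>"
  shows F_deriv_norm_le_functional_majorant: "\<And>\<eta>. \<eta> \<in> Q_vec q \<Omega> \<Longrightarrow> F_deriv_norm p \<Omega> h v \<le>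
      Lp_norm q \<Omega> (\<lambda>x. p_flux p (vgrad \<Omega> v x) - \<eta> x) + C_F p \<Omega> * Lp_norm q \<Omega> (\<lambda>x. vdiv \<Omega> \<eta> x + h x)"
    and F_deriv_le_F_deriv_norm: "\<And>\<xi>. \<xi> \<in> W0_vec p \<Omega> \<Longrightarrow> \<not> (AE x in lebesgue_on \<Omega>. \<xi> x = 0) \<Longrightarrow>
      F_deriv p \<Omega> h v \<xi> \<le> F_deriv_norm p \<Omega> h v * Lp_norm p \<Omega> (vgrad \<Omega> \<xi>)"
    and F_deriv_norm_nonneg: "F_deriv_norm p \<Omega> h v \<ge> 0"
proof -
  let ?S = "{\<xi> :: real ^ 'N \<Rightarrow> real ^ 'n. \<xi> \<in> W0_vec p \<Omega> \<and> \<not> (AE x in lebesgue_on \<Omega>. \<xi> x = 0)}"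
  let ?N = "\<lambda>\<xi> :: real ^ 'N \<Rightarrow> real ^ 'n. Lp_norm p \<Omega> (vgrad \<Omega> \<xi>)"
  let ?f = "\<lambda>\<xi>. F_deriv p \<Omega> h v \<xi> / ?N \<xi>"
  let ?m = "\<lambda>\<eta>. Lp_norm q \<Omega> (\<lambda>x. p_flux p (vgrad \<Omega> v x) - \<eta> x) + C_F p \<Omega> * Lp_norm q \<Omega> (\<lambda>x. vdiv \<Omega> \<eta> x + h x)"
  have m0: "?m \<eta> \<ge> 0" for \<eta> using friedrichs_C_F(1)[OF \<Omega>(1,2) p] by simp
  have le: "?f \<xi> \<le> ?m \<eta>" if "\<xi> \<in> W0_vec p \<Omega>" "\<eta> \<in> Q_vec q \<Omega>" for \<xi> \<eta>
  proof (cases "?N \<xi> = 0")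
    \<comment> \<open>The quotient is 0 by the convention for division by zero.\<close>
    case True
    then show ?thesis using m0 by simp
  next
    case False
    then have "?N \<xi> > 0" using Lp_norm_nonneg[of p \<Omega> "vgrad \<Omega> \<xi>"] by linarith
    then show ?thesis
      using F_deriv_le_functional_majorant[OF \<Omega>(1,2) p q h v that(2,1)] by (simp add: divide_le_eq)
  qed
  obtain \<xi>0 :: "real ^ 'N \<Rightarrow> real ^ 'n" where \<xi>0: "\<xi>0 \<in> W0_vec p \<Omega>" "\<not> (AE x in lebesgue_on \<Omega>. \<xi>0 x = 0)"
    using nonzero_W0_vec[OF \<Omega> p] by blast
  have "\<xi>0 \<in> ?S" using \<xi>0 by simp
  then have ne: "?S \<noteq> {}" by (metis empty_iff)
  have bdd: "bdd_above (?f ` ?S)"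
    by (rule bdd_aboveI[of _ "?m (\<lambda>x. 0)"]) (use le zero_Q_vec in blast)
  show "F_deriv_norm p \<Omega> h v \<le> ?m \<eta>" if "\<eta> \<in> Q_vec q \<Omega>" for \<eta>
    unfolding F_deriv_norm_def by (rule cSUP_least[OF ne]) (use le that in blast)
  have upper: "?f \<xi> \<le> F_deriv_norm p \<Omega> h v" if "\<xi> \<in> W0_vec p \<Omega>" "\<not> (AE x in lebesgue_on \<Omega>. \<xi> x = 0)" for \<xi>
    unfolding F_deriv_norm_def by (rule cSUP_upper[OF _ bdd]) (use that in blast)
  show "F_deriv p \<Omega> h v \<xi> \<le> F_deriv_norm p \<Omega> h v * ?N \<xi>"
    if \<xi>: "\<xi> \<in> W0_vec p \<Omega>" "\<not> (AE x in lebesgue_on \<Omega>. \<xi> x = 0)" for \<xi>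
  proof (cases "?N \<xi> = 0")
    \<comment> \<open>The quotient carries no information here; the majorant, multiplied by the zero
      gradient norm, gives \<open>F_deriv\<close> \<le> 0 directly.\<close>
    case True
    then show ?thesis
      using F_deriv_le_functional_majorant[OF \<Omega>(1,2) p q h v zero_Q_vec \<xi>(1)] by simp
  next
    case False
    then have "?N \<xi> > 0" using Lp_norm_nonneg[of p \<Omega> "vgrad \<Omega> \<xi>"] by linarith
    then show ?thesis using upper[OF \<xi>] by (simp add: divide_le_eq)
  qed
  show "F_deriv_norm p \<Omega> h v \<ge> 0"
  proof -
    \<comment> \<open>The negative of \<open>\<xi>0\<close>, written as a difference so that
      \<open>W0_vec_diff\<close> applies. Its quotient is the negative of that of
      \<open>\<xi>0\<close>, and the supremum dominates both.\<close>
    let ?\<zeta> = "\<lambda>x. 0 - \<xi>0 x"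
    note diff = W0_vec_diff[OF \<Omega>(1,2) p zero_W0_vec[OF \<Omega>(1,2) p] \<xi>0(1)]
    have "AE x in lebesgue_on \<Omega>. vgrad \<Omega> (\<lambda>x. 0 :: real ^ 'n) x = 0"
      by (rule vgrad_AE_zero[OF \<Omega>(1,2) p zero_W0_vec[OF \<Omega>(1,2) p]]) simp
    with diff(2) have neg: "AE x in lebesgue_on \<Omega>. vgrad \<Omega> ?\<zeta> x = - vgrad \<Omega> \<xi>0 x"
      by eventually_elim simp
    note [measurable] = Lp_spaceD(1)[OF W0_vec_Lp_space(2)[OF \<Omega>(1) \<xi>0(1) p]]
      Lp_spaceD(1)[OF W0_vec_Lp_space(2)[OF \<Omega>(1) diff(1) p]]
      Lp_spaceD(1)[OF p_flux_Lp_space[OF W0_vec_Lp_space(2)[OF \<Omega>(1) v p] p q]]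
    have "?N ?\<zeta> = Lp_norm p \<Omega> (\<lambda>x. - vgrad \<Omega> \<xi>0 x)"
      by (rule Lp_norm_cong_AE[OF neg]) measurable
    then have N: "?N ?\<zeta> = ?N \<xi>0" by simp
    have "(LINT x|lebesgue_on \<Omega>. p_flux p (vgrad \<Omega> v x) \<bullet> vgrad \<Omega> ?\<zeta> x)
        = (LINT x|lebesgue_on \<Omega>. - (p_flux p (vgrad \<Omega> v x) \<bullet> vgrad \<Omega> \<xi>0 x))"
    proof (rule integral_cong_AE)
      show "AE x in lebesgue_on \<Omega>. p_flux p (vgrad \<Omega> v x) \<bullet> vgrad \<Omega> ?\<zeta> x = - (p_flux p (vgrad \<Omega> v x) \<bullet> vgrad \<Omega> \<xi>0 x)"
        using neg by eventually_elim simp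
    qed measurable
    then have F: "F_deriv p \<Omega> h v ?\<zeta> = - F_deriv p \<Omega> h v \<xi>0" by (simp add: F_deriv_def)
    have "\<not> (AE x in lebesgue_on \<Omega>. ?\<zeta> x = 0)" using \<xi>0(2) by simp
    from upper[OF diff(1) this] upper[OF \<xi>0] show ?thesis unfolding F N by simp
  qed
qed

section \<open>Energy identity and error bound\<close>

text \<open>Testing with u itself bounds the p-th power of the gradient norm by \<open>C_F\<close>
  times the norm of h times the gradient norm. Cancel one factor and raise to the power q, using (p
  - 1) q = p.\<close>

lemma energy_bound:
  fixes h u :: "real ^ 'N \<Rightarrow> real ^ 'n"
  assumes \<Omega>: "open \<Omega>" "emeasure lebesgue \<Omega> < \<infinity>" and p: "p > 1" and q: "q = p / (p - 1)"
    and h: "h \<in> Lp_space q \<Omega>" and u: "u \<in> W0_vec p \<Omega>"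
    and eq: "(LINT x|lebesgue_on \<Omega>. p_flux p (vgrad \<Omega> u x) \<bullet> vgrad \<Omega> u x) = (LINT x|lebesgue_on \<Omega>. h x \<bullet> u x)"
  shows "Lp_norm p \<Omega> (vgrad \<Omega> u) powr p \<le> C_F p \<Omega> powr q * Lp_norm q \<Omega> h powr q"
proof -
  have qp: "q > 1" "p > 1" "1 / q + 1 / p = 1" using p by (auto simp: q field_simps)
  let ?N = "Lp_norm p \<Omega> (vgrad \<Omega> u)"
  have CF: "C_F p \<Omega> \<ge> 0" by (rule friedrichs_C_F(1)[OF \<Omega> p])
  show ?thesis
  proof (cases "?N = 0")
    case True
    then show ?thesis by simp
  next
    case False
    then have N: "?N > 0" using Lp_norm_nonneg[of p \<Omega> "vgrad \<Omega> u"] by linarith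
    have "?N powr p = (LINT x|lebesgue_on \<Omega>. h x \<bullet> u x)"
      using eq p by (simp add: Lp_norm_powr p_flux_inner_self)
    also have "\<dots> \<le> Lp_norm q \<Omega> h * Lp_norm p \<Omega> u"
      using Lp_holder(2)[OF qp h W0_vec_Lp_space(1)[OF \<Omega>(1) u p]] by linarith
    also have "\<dots> \<le> Lp_norm q \<Omega> h * (C_F p \<Omega> * ?N)"
      by (intro mult_left_mono friedrichs_C_F_vec[OF \<Omega> p u]) auto
    finally have "?N powr (p - 1) * ?N \<le> (C_F p \<Omega> * Lp_norm q \<Omega> h) * ?N"
      using powr_mult_base[of ?N p] N by (simp add: mult_ac)
    then have "?N powr (p - 1) \<le> C_F p \<Omega> * Lp_norm q \<Omega> h" using N by simp
    then have "(?N powr (p - 1)) powr q \<le> (C_F p \<Omega> * Lp_norm q \<Omega> h) powr q"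
      using qp by (intro powr_mono2) auto
    then show ?thesis using p CF by (simp add: powr_powr powr_mult q)
  qed
qed

text \<open>The direction v - u, not u - v, gives \<open>F_deriv\<close> the sign of the
  monotonicity integral. The second claim reconciles the gradient chosen for u - v with the
  difference of the chosen gradients.\<close>

lemma error_le_F_deriv_norm:
  fixes h u v :: "real ^ 'N \<Rightarrow> real ^ 'n"
  assumes \<Omega>: "open \<Omega>" "emeasure lebesgue \<Omega> < \<infinity>" "\<Omega> \<noteq> {}" and p: "p > 1" and q: "q = p / (p - 1)"
    and h: "h \<in> Lp_space q \<Omega>" and u: "u \<in> W0_vec p \<Omega>" and v: "v \<in> W0_vec p \<Omega>"
    and eq: "\<And>\<xi>. \<xi> \<in> W0_vec p \<Omega> \<Longrightarrow>
      (LINT x|lebesgue_on \<Omega>. p_flux p (vgrad \<Omega> u x) \<bullet> vgrad \<Omega> \<xi> x) = (LINT x|lebesgue_on \<Omega>. h x \<bullet> \<xi> x)"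
  shows "(LINT x|lebesgue_on \<Omega>. (p_flux p (vgrad \<Omega> u x) - p_flux p (vgrad \<Omega> v x)) \<bullet> (vgrad \<Omega> u x - vgrad \<Omega> v x))
      \<le> F_deriv_norm p \<Omega> h v * Lp_norm p \<Omega> (\<lambda>x. vgrad \<Omega> u x - vgrad \<Omega> v x)" (is "?D \<le> _")
    and "Lp_norm p \<Omega> (vgrad \<Omega> (\<lambda>x. u x - v x)) = Lp_norm p \<Omega> (\<lambda>x. vgrad \<Omega> u x - vgrad \<Omega> v x)"
proof -
  have qp: "q > 1" "p > 1" "1 / q + 1 / p = 1" using p by (auto simp: q field_simps)
  note uLp = W0_vec_Lp_space(2)[OF \<Omega>(1) u p] and vLp = W0_vec_Lp_space(2)[OF \<Omega>(1) v p]
  have "Lp_norm p \<Omega> (vgrad \<Omega> (\<lambda>x. a x - b x)) = Lp_norm p \<Omega> (\<lambda>x. vgrad \<Omega> a x - vgrad \<Omega> b x)"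
    if "a \<in> W0_vec p \<Omega>" "b \<in> W0_vec p \<Omega>" for a b :: "real ^ 'N \<Rightarrow> real ^ 'n"
  proof (rule Lp_norm_cong_AE)
    show "AE x in lebesgue_on \<Omega>. vgrad \<Omega> (\<lambda>x. a x - b x) x = vgrad \<Omega> a x - vgrad \<Omega> b x"
      using W0_vec_diff(2)[OF \<Omega>(1,2) p that] by eventually_elim simp
  qed (intro borel_measurable_diff Lp_spaceD(1)[OF W0_vec_Lp_space(2)[OF \<Omega>(1) _ p]] that
      W0_vec_diff(1)[OF \<Omega>(1,2) p that])+
  note norm_diff = this
  show "Lp_norm p \<Omega> (vgrad \<Omega> (\<lambda>x. u x - v x)) = Lp_norm p \<Omega> (\<lambda>x. vgrad \<Omega> u x - vgrad \<Omega> v x)"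
    by (rule norm_diff[OF u v])
  have N: "Lp_norm p \<Omega> (vgrad \<Omega> (\<lambda>x. v x - u x)) = Lp_norm p \<Omega> (\<lambda>x. vgrad \<Omega> u x - vgrad \<Omega> v x)"
    using norm_diff[OF v u] Lp_norm_minus_commute[of p \<Omega> "vgrad \<Omega> v" "vgrad \<Omega> u"] by simp
  note w = W0_vec_diff[OF \<Omega>(1,2) p v u]
  let ?w = "\<lambda>x. v x - u x"
  note wLp = W0_vec_Lp_space(2)[OF \<Omega>(1) w(1) p]
  note f = p_flux_Lp_space[OF uLp p q] p_flux_Lp_space[OF vLp p q]
  note [measurable] = Lp_spaceD(1)[OF uLp] Lp_spaceD(1)[OF vLp] Lp_spaceD(1)[OF wLp]
    Lp_spaceD(1)[OF f(1)] Lp_spaceD(1)[OF f(2)]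
  have "F_deriv p \<Omega> h v ?w = (LINT x|lebesgue_on \<Omega>. p_flux p (vgrad \<Omega> v x) \<bullet> vgrad \<Omega> ?w x)
      - (LINT x|lebesgue_on \<Omega>. p_flux p (vgrad \<Omega> u x) \<bullet> vgrad \<Omega> ?w x)"
    by (simp add: F_deriv_def eq[OF w(1)])
  also have "\<dots> = (LINT x|lebesgue_on \<Omega>. (p_flux p (vgrad \<Omega> v x) - p_flux p (vgrad \<Omega> u x)) \<bullet> vgrad \<Omega> ?w x)"
    using Lp_holder(1)[OF qp f(1) wLp] Lp_holder(1)[OF qp f(2) wLp] by (simp add: inner_diff_left)
  also have "\<dots> = ?D"
  proof (rule integral_cong_AE)
    show "AE x in lebesgue_on \<Omega>. (p_flux p (vgrad \<Omega> v x) - p_flux p (vgrad \<Omega> u x)) \<bullet> vgrad \<Omega> ?w x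
        = (p_flux p (vgrad \<Omega> u x) - p_flux p (vgrad \<Omega> v x)) \<bullet> (vgrad \<Omega> u x - vgrad \<Omega> v x)"
      using w(2)
    proof eventually_elim
      case (elim x)
      then show ?case by (simp flip: elim add: inner_diff_left inner_diff_right)
    qed
  qed measurable
  finally have D: "?D = F_deriv p \<Omega> h v ?w" ..
  show "?D \<le> F_deriv_norm p \<Omega> h v * Lp_norm p \<Omega> (\<lambda>x. vgrad \<Omega> u x - vgrad \<Omega> v x)"
  proof (cases "AE x in lebesgue_on \<Omega>. ?w x = 0")
    \<comment> \<open>The direction v - u is then excluded from the supremum, but the integral is 0
      and the dual norm is nonnegative.\<close>
    case True
    have "AE x in lebesgue_on \<Omega>. vgrad \<Omega> ?w x = 0"
      by (rule vgrad_AE_zero[OF \<Omega>(1,2) p w(1) True])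
    with w(2) have 0: "AE x in lebesgue_on \<Omega>. vgrad \<Omega> v x - vgrad \<Omega> u x = 0" by eventually_elim simp
    have "?D = (LINT x|lebesgue_on \<Omega>. 0)"
    proof (rule integral_cong_AE)
      show "AE x in lebesgue_on \<Omega>. (p_flux p (vgrad \<Omega> u x) - p_flux p (vgrad \<Omega> v x)) \<bullet> (vgrad \<Omega> u x - vgrad \<Omega> v x) = 0"
        using 0 by eventually_elim simp
    qed measurable
    then show ?thesis using F_deriv_norm_nonneg[OF \<Omega> p q h v] by simp
  next
    case False
    show ?thesis using F_deriv_le_F_deriv_norm[OF \<Omega> p q h v w(1) False] unfolding D N .
  qed
qed

theorem theorem5p5:
  fixes p p' C :: real
    and \<Omega> :: "(real ^ 'N) set"
    and h u v :: "real ^ 'N \<Rightarrow> real ^ 'n"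
    and \<tau> :: "real ^ 'N \<Rightarrow> real ^ 'N ^ 'n"
  assumes "p > 1" and "p' = p / (p - 1)"
    and "open \<Omega>" and "connected \<Omega>" and "\<Omega> \<noteq> {}" and "emeasure lebesgue \<Omega> < \<infinity>"
    and "h \<in> Lp_space p' \<Omega>"
    and "u \<in> W0_vec p \<Omega>"
    and "\<And>\<xi>. \<xi> \<in> W0_vec p \<Omega> \<Longrightarrow>
           (LINT x|lebesgue_on \<Omega>. p_flux p (vgrad \<Omega> u x) \<bullet> vgrad \<Omega> \<xi> x) =
           (LINT x|lebesgue_on \<Omega>. h x \<bullet> \<xi> x)"
    and "v \<in> W0_vec p \<Omega>"
    and "\<tau> = (\<lambda>x. p_flux p (vgrad \<Omega> v x))"
    and "C = (if p \<ge> 2 then 2 powr ((p - 2) / (p - 1))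
              else 1 / (p - 1) * 2 powr ((2 - p) / p) *
                   (C_F p \<Omega> powr p' * Lp_norm p' \<Omega> h powr p' + Lp_norm p \<Omega> (vgrad \<Omega> v) powr p)
                     powr ((2 - p) / p))"
  shows "Lp_norm p \<Omega> (vgrad \<Omega> (\<lambda>x. u x - v x))
           \<le> C * F_deriv_norm p \<Omega> h v powr (1 / max 1 (p - 1)) \<and>
         C * F_deriv_norm p \<Omega> h v powr (1 / max 1 (p - 1))
           \<le> C * (INF \<eta>\<in>Q_vec p' \<Omega>.
                    (Lp_norm p' \<Omega> (\<lambda>x. \<tau> x - \<eta> x) + C_F p \<Omega> * Lp_norm p' \<Omega> (\<lambda>x. vdiv \<Omega> \<eta> x + h x))
                      powr (1 / max 1 (p - 1)))"
proof
  note p = \<open>p > 1\<close> and q = \<open>p' = p / (p - 1)\<close> and \<Omega> = \<open>open \<Omega>\<close> \<open>emeasure lebesgue \<Omega> < \<infinity>\<close> \<open>\<Omega> \<noteq> {}\<close>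
    and h = \<open>h \<in> Lp_space p' \<Omega>\<close> and u = \<open>u \<in> W0_vec p \<Omega>\<close> and v = \<open>v \<in> W0_vec p \<Omega>\<close> and eq = assms(9)
    and C = assms(12)
  let ?F = "F_deriv_norm p \<Omega> h v"
  define X where "X = Lp_norm p \<Omega> (\<lambda>x. vgrad \<Omega> u x - vgrad \<Omega> v x)"
  have F0: "?F \<ge> 0" by (rule F_deriv_norm_nonneg[OF \<Omega> p q h v])
  note err = error_le_F_deriv_norm[OF \<Omega> p q h u v eq]
  note uLp = W0_vec_Lp_space(2)[OF \<Omega>(1) u p] and vLp = W0_vec_Lp_space(2)[OF \<Omega>(1) v p]
  have X0: "X \<ge> 0" by (simp add: X_def)
  have C0: "C \<ge> 0" using p by (simp add: C)
  show "Lp_norm p \<Omega> (vgrad \<Omega> (\<lambda>x. u x - v x)) \<le> C * ?F powr (1 / max 1 (p - 1))"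
  proof (cases "X = 0")
    case True
    then show ?thesis using err(2) C0 F0 by (simp add: X_def)
  next
    case False
    then have X: "X > 0" using X0 by simp
    have "X \<le> C * ?F powr (1 / max 1 (p - 1))"
    proof (cases "p \<ge> 2")
      case True
      \<comment> \<open>Cancelling X and taking the root of order p - 1 turns the factor 2 powr (2 -
        p) into the constant \<open>C\<close>.\<close>
      have "2 powr (2 - p) * X powr p \<le> ?F * X"
        using Lp_norm_diff_le_p_flux_ge2[OF uLp vLp True] err(1) by (simp add: X_def)
      then have "(2 powr (2 - p) * X powr (p - 1)) * X \<le> ?F * X"
        using powr_mult_base[of X p] X by (simp add: mult.assoc)
      then have "2 powr (2 - p) * X powr (p - 1) \<le> ?F" using X by simp
      then have "2 powr (p - 2) * (2 powr (2 - p) * X powr (p - 1)) \<le> 2 powr (p - 2) * ?F"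
        by (intro mult_left_mono) auto
      then have "X powr (p - 1) \<le> 2 powr (p - 2) * ?F"
        by (simp flip: mult.assoc powr_add)
      then have "(X powr (p - 1)) powr (1 / (p - 1)) \<le> (2 powr (p - 2) * ?F) powr (1 / (p - 1))"
        using p by (intro powr_mono2) auto
      then have "X \<le> 2 powr ((p - 2) / (p - 1)) * ?F powr (1 / (p - 1))"
        using p X F0 by (simp add: powr_powr powr_mult)
      moreover have "max 1 (p - 1) = p - 1" using True by simp
      ultimately show ?thesis using True by (simp add: C)
    next
      case False
      define S where "S = C_F p \<Omega> powr p' * Lp_norm p' \<Omega> h powr p' + Lp_norm p \<Omega> (vgrad \<Omega> v) powr p"
      let ?s = "(2 - p) / p"
      \<comment> \<open>The energy bound eliminates the unknown u and leaves the quantity in h and v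
        that occurs in \<open>C\<close>.\<close>
      have "Lp_norm p \<Omega> (vgrad \<Omega> u) powr p + Lp_norm p \<Omega> (vgrad \<Omega> v) powr p \<le> S"
        unfolding S_def by (intro add_right_mono energy_bound[OF \<Omega>(1,2) p q h u eq[OF u]])
      then have S: "(Lp_norm p \<Omega> (vgrad \<Omega> u) powr p + Lp_norm p \<Omega> (vgrad \<Omega> v) powr p) powr ?s \<le> S powr ?s"
        using p False by (intro powr_mono2) auto
      have "(p - 1) * X ^ 2 \<le> (?F * X) * S powr ?s"
        using Lp_norm_diff_le_p_flux_lt2[OF uLp vLp p] False err(1) F0 X0
        by (intro order_trans[OF _ mult_mono[OF _ S]]) (auto simp: X_def)
      then have "((p - 1) * X) * X \<le> (?F * S powr ?s) * X"
        by (simp add: power2_eq_square mult_ac)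
      then have "(p - 1) * X \<le> ?F * S powr ?s" using X by simp
      then have "X \<le> 1 / (p - 1) * S powr ?s * ?F" using p by (simp add: field_simps)
      \<comment> \<open>\<open>C\<close> carries the further factor \<open>2 powr ?s\<close>, which
        is at least 1 because p < 2.\<close>
      also have "\<dots> \<le> 1 / (p - 1) * (2 powr ?s * S powr ?s) * ?F"
      proof (intro mult_right_mono mult_left_mono)
        have "1 \<le> 2 powr ?s" using p False by (intro ge_one_powr_ge_zero) auto
        then show "S powr ?s \<le> 2 powr ?s * S powr ?s"
          using mult_right_mono[of 1 "2 powr ?s" "S powr ?s"] by simp
      qed (use p F0 in auto)
      also have "\<dots> = C * ?F powr (1 / max 1 (p - 1))"
        using False p F0 by (simp add: C S_def max_def mult.assoc)
      finally show ?thesis .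
    qed
    then show ?thesis using err(2) by (simp add: X_def)
  qed
  show "C * ?F powr (1 / max 1 (p - 1))
      \<le> C * (INF \<eta>\<in>Q_vec p' \<Omega>.
          (Lp_norm p' \<Omega> (\<lambda>x. \<tau> x - \<eta> x) + C_F p \<Omega> * Lp_norm p' \<Omega> (\<lambda>x. vdiv \<Omega> \<eta> x + h x))
            powr (1 / max 1 (p - 1)))"
  proof (intro mult_left_mono[OF _ C0] cINF_greatest)
    show "Q_vec p' \<Omega> \<noteq> ({} :: (real ^ 'N \<Rightarrow> real ^ 'N ^ 'n) set)" using zero_Q_vec by blast
    fix \<eta> :: "real ^ 'N \<Rightarrow> real ^ 'N ^ 'n" assume \<eta>: "\<eta> \<in> Q_vec p' \<Omega>"
    show "?F powr (1 / max 1 (p - 1))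
        \<le> (Lp_norm p' \<Omega> (\<lambda>x. \<tau> x - \<eta> x) + C_F p \<Omega> * Lp_norm p' \<Omega> (\<lambda>x. vdiv \<Omega> \<eta> x + h x))
            powr (1 / max 1 (p - 1))"
      using F_deriv_norm_le_functional_majorant[OF \<Omega> p q h v \<eta>] F0 unfolding assms(11)
      by (intro powr_mono2) auto
  qed
qed

end
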